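(* Let $n\geq1$. For any log-concave and unconditional probability measure $\eta$ on $\mathbb{R}^n$ with $d\eta=e^{-V}\,dx$, where $V:\mathbb{R}^n\to\mathbb{R}\cup\{+\infty\}$ is an essentially continuous convex function, and whose moment probability measure $\nu=(\nabla V)_\#\eta$ belongs to $\mathcal{P}_2(\mathbb{R}^n)$, it holds \[ H(\eta|\gamma_n)+\frac12W_2^2(\nu,\lambda_{C_n})\leq\frac n2\log\left(\frac{\pi e}{2}\right)+\frac12I(\eta|\gamma_n). \] In other words, for such $\eta$, \[ \delta_n(\eta)\geq\frac12W_2^2(\nu,\lambda_{C_n})-\frac n2\log\left(\frac{\pi e}{2}\right). \] Moreover, there exists a sequence of product measures $(\eta_k^{\otimes n})_{k\geq1}$ belonging to this class such that \[ \delta_n(\eta_k^{\otimes n})-\frac12W_2^2(\nu_k^{\otimes n},\lambda_{C_n})+\frac n2\log\left(\frac{\pi e}{2}\right)\to0 \] as $k\to\infty$, where for $k\geq1$, $\nu_k^{\otimes n}$ denotes the moment measure of $\eta_k^{\otimes n}$.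
   Context: $C_n=\{-1,1\}^n$ and $\lambda_{C_n}$ is the uniform probability measure on $C_n$. A measure is log-concave if it is of the form $e^{-V}dx$ with $V:\mathbb{R}^n\to\mathbb{R}\cup\{+\infty\}$ convex. A probability measure is unconditional if it is invariant under all maps $x\mapsto(\varepsilon_1x_1,\ldots,\varepsilon_nx_n)$, $\varepsilon\in\{-1,1\}^n$. A lower semicontinuous convex function $V:\mathbb{R}^n\to\mathbb{R}\cup\{+\infty\}$, not identically $+\infty$, is essentially continuous if the set of points where it is discontinuous (as a function with values in $\mathbb{R}\cup\{+\infty\}$) is negligible for the $(n-1)$-dimensional Hausdorff measure; equivalently $\mathcal{H}_{n-1}(\{x\in\partial D:V(x)<\infty\})=0$ with $D=\{V<\infty\}$. The moment measure of $d\eta=e^{-V}dx$ is the push-forward $(\nabla V)_\#\eta$. $\mathcal{P}_2(\mathbb{R}^n)$ is the set of Borel probability measures with finite second moment; $W_2^2(\nu_1,\nu_2)=\inf\int|x-y|^2\,\pi(dx\,dy)$ over couplings $\pi$ of $\nu_1,\nu_2\in\mathcal{P}_2(\mathbb{R}^n)$. $\gamma_n(dx)=(2\pi)^{-n/2}e^{-|x|^2/2}dx$. For a probability measure $d\eta=h\,d\gamma_n$: $H(\eta|\gamma_n)=\int\log h\,d\eta$, and $I(\eta|\gamma_n)=4\int|\nabla(h^{1/2})|^2\,d\gamma_n$ if $h^{1/2}$ is absolutely continuous on almost every line parallel to an axis (i.e. for every $i$ and Lebesgue-a.e. values of the other coordinates, it is absolutely continuous on every segment as a function of $x_i$), and $+\infty$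 otherwise. The deficit is $\delta_n(\eta)=\frac12I(\eta|\gamma_n)-H(\eta|\gamma_n)$, for $\eta$ with $H(\eta|\gamma_n)<+\infty$. *)

theory Defs
  imports "HOL-Probability.Probability"
begin

section \<open>Extended-valued convex functions\<close>

text \<open>Functions with values in the reals extended by \<open>+\<infinity>\<close> are modelled as \<^typ>\<open>ereal\<close>-valued
  functions that avoid \<open>-\<infinity>\<close>.\<close>

definition ext_convex :: "('a::real_vector \<Rightarrow> ereal) \<Rightarrow> bool" where
  "ext_convex V \<longleftrightarrow> (\<forall>x. V x \<noteq> -\<infinity>) \<and>
     (\<forall>x y t. 0 < t \<and> t < 1 \<longrightarrow>
        V ((1 - t) *\<^sub>R x + t *\<^sub>R y) \<le> ereal (1 - t) * V x + ereal t * V y)"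

definition lower_semicontinuous :: "('a::topological_space \<Rightarrow> ereal) \<Rightarrow> bool" where
  "lower_semicontinuous V \<longleftrightarrow> (\<forall>x. V x \<le> Liminf (at x) V)"

text \<open>Hausdorff (outer) measure of integer dimension \<open>d\<close>. The empty set is treated separately because
  \<open>0 ^ 0 = 1\<close>: this makes \<open>d = 0\<close> the counting measure. Boundedness is required because
  \<^const>\<open>diameter\<close> is only meaningful for bounded sets.\<close>

definition hausdorff_premeasure :: "nat \<Rightarrow> real \<Rightarrow> 'a::metric_space set \<Rightarrow> ennreal" where
  "hausdorff_premeasure d \<delta> A =
     (INF U \<in> {U :: nat \<Rightarrow> 'a set. A \<subseteq> (\<Union>i. U i) \<and> (\<forall>i. bounded (U i) \<and> diameter (U i) \<le> \<delta>)}.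
        \<Sum>i. if U i = {} then 0 else ennreal (unit_ball_vol (real d) * (diameter (U i) / 2) ^ d))"

definition hausdorff_measure :: "nat \<Rightarrow> 'a::metric_space set \<Rightarrow> ennreal" where
  "hausdorff_measure d A = (SUP \<delta> \<in> {0<..}. hausdorff_premeasure d \<delta> A)"

definition essentially_continuous :: "('a::euclidean_space \<Rightarrow> ereal) \<Rightarrow> bool" where
  "essentially_continuous V \<longleftrightarrow>
     ext_convex V \<and> lower_semicontinuous V \<and> (\<exists>x. V x \<noteq> \<infinity>) \<and>
     hausdorff_measure (DIM('a) - 1) {x. \<not> isCont V x} = 0"

text \<open>The gradient at points near which \<open>V\<close> is finite and at which it is differentiable; the value
  \<open>0\<close> elsewhere is a dummy (for convex \<open>V\<close> this is a null set for \<open>e\<^sup>-\<^sup>V dx\<close>).\<close>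

definition has_ext_gradient :: "('a::real_inner \<Rightarrow> ereal) \<Rightarrow> 'a \<Rightarrow> 'a \<Rightarrow> bool" where
  "has_ext_gradient V x D \<longleftrightarrow>
     (\<forall>\<^sub>F y in nhds x. \<bar>V y\<bar> \<noteq> \<infinity>) \<and> GDERIV (\<lambda>y. real_of_ereal (V y)) x :> D"

definition ext_gradient :: "('a::real_inner \<Rightarrow> ereal) \<Rightarrow> 'a \<Rightarrow> 'a" where
  "ext_gradient V x = (if \<exists>D. has_ext_gradient V x D then THE D. has_ext_gradient V x D else 0)"


section \<open>Measures\<close>

definition exp_neg :: "ereal \<Rightarrow> ennreal" where
  "exp_neg v = (if v = \<infinity> then 0 else ennreal (exp (- real_of_ereal v)))"

definition exp_neg_measure :: "('a::euclidean_space \<Rightarrow> ereal) \<Rightarrow> 'a measure" where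
  "exp_neg_measure V = density lborel (\<lambda>x. exp_neg (V x))"

definition log_concave :: "'a::euclidean_space measure \<Rightarrow> bool" where
  "log_concave \<eta> \<longleftrightarrow>
     (\<exists>V. ext_convex V \<and> V \<in> borel_measurable borel \<and> \<eta> = exp_neg_measure V)"

definition moment_measure :: "('a::euclidean_space \<Rightarrow> ereal) \<Rightarrow> 'a measure" where
  "moment_measure V = distr (exp_neg_measure V) borel (ext_gradient V)"

definition cube :: "(real^'n) set" where
  "cube = {x. \<forall>i. x $ i \<in> {-1, 1}}"

definition uniform_cube :: "(real^'n) measure" where
  "uniform_cube = distr (uniform_count_measure cube) borel (\<lambda>x. x)"

definition unconditional :: "(real^'n) measure \<Rightarrow> bool" where
  "unconditional \<eta> \<longleftrightarrow> (\<forall>\<epsilon> \<in> cube. distr \<eta> borel (\<lambda>x. \<chi> i. \<epsilon> $ i * x $ i) = \<eta>)"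

definition product_measure :: "real measure \<Rightarrow> (real^'n) measure" where
  "product_measure \<mu> = distr (\<Pi>\<^sub>M i\<in>(UNIV :: 'n set). \<mu>) borel (\<lambda>f. \<chi> i. f i)"

definition P2 :: "'a::euclidean_space measure set" where
  "P2 = {\<mu>. prob_space \<mu> \<and> sets \<mu> = sets borel \<and> (\<integral>\<^sup>+ x. ennreal ((norm x)\<^sup>2) \<partial>\<mu>) < \<infinity>}"

definition couplings :: "'a::euclidean_space measure \<Rightarrow> 'a measure \<Rightarrow> ('a \<times> 'a) measure set" where
  "couplings \<mu> \<nu> = {\<pi>. prob_space \<pi> \<and> sets \<pi> = sets borel \<and>
                       distr \<pi> borel fst = \<mu> \<and> distr \<pi> borel snd = \<nu>}"

definition wasserstein2_sq :: "'a::euclidean_space measure \<Rightarrow> 'a measure \<Rightarrow> ennreal" where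
  "wasserstein2_sq \<mu> \<nu> = (INF \<pi> \<in> couplings \<mu> \<nu>. \<integral>\<^sup>+ (x, y). ennreal ((norm (x - y))\<^sup>2) \<partial>\<pi>)"


section \<open>Entropy and Fisher information relative to the Gaussian\<close>

definition gauss :: "'a::euclidean_space measure" where
  "gauss = density lborel
     (\<lambda>x. ennreal ((2 * pi) powr (- real DIM('a) / 2) * exp (- (norm x)\<^sup>2 / 2)))"

text \<open>The integral of \<open>log h\<close> is the difference of the integrals of its positive and negative
  parts; the latter is at most \<open>1/e\<close>, because \<open>h log h \<ge> -1/e\<close>, so the difference is never
  \<open>\<infinity> - \<infinity>\<close>.\<close>

definition rel_entropy :: "'a::euclidean_space measure \<Rightarrow> ereal" where
  "rel_entropy \<eta> =
     (if absolutely_continuous gauss \<eta> then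
        let l = (\<lambda>x. ln (enn2real (RN_deriv gauss \<eta> x)))
        in enn2ereal (\<integral>\<^sup>+ x. ennreal (l x) \<partial>\<eta>) - enn2ereal (\<integral>\<^sup>+ x. ennreal (- l x) \<partial>\<eta>)
      else \<infinity>)"

definition abs_continuous_on_segment :: "real \<Rightarrow> real \<Rightarrow> (real \<Rightarrow> real) \<Rightarrow> bool" where
  "abs_continuous_on_segment a b f \<longleftrightarrow>
     (\<forall>\<epsilon>>0. \<exists>\<delta>>0. \<forall>D :: (real \<times> real) set.
        finite D \<and> (\<forall>(u, v)\<in>D. a \<le> u \<and> u \<le> v \<and> v \<le> b) \<and>
        disjoint_family_on (\<lambda>(u, v). {u<..<v}) D \<and> (\<Sum>(u, v)\<in>D. v - u) < \<delta>
        \<longrightarrow> (\<Sum>(u, v)\<in>D. \<bar>f v - f u\<bar>) < \<epsilon>)"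

definition abs_continuous_on_lines :: "(real^'n \<Rightarrow> real) \<Rightarrow> bool" where
  "abs_continuous_on_lines f \<longleftrightarrow>
     (\<forall>i. AE y in (\<Pi>\<^sub>M j\<in>UNIV - {i}. lborel :: real measure).
        \<forall>a b. abs_continuous_on_segment a b (\<lambda>t. f (\<chi> j. if j = i then t else y j)))"

definition partial_deriv :: "'n \<Rightarrow> (real^'n \<Rightarrow> real) \<Rightarrow> real^'n \<Rightarrow> real" where
  "partial_deriv i f x = deriv (\<lambda>t. f (x + t *\<^sub>R axis i 1)) 0"

text \<open>The density of \<open>\<eta>\<close> is only determined almost everywhere, and \<open>I(\<eta>|\<gamma>)\<close> is finite only if some
  version of its square root is absolutely continuous on almost every line. Any two such versions have
  almost everywhere the same partial derivatives, so the infimum below ranges over at most one value;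
  over the empty set it is \<open>+\<infinity>\<close>.\<close>

definition fisher_information :: "(real^'n) measure \<Rightarrow> ennreal" where
  "fisher_information \<eta> =
     (INF h \<in> {h. h \<in> borel_measurable borel \<and> (\<forall>x. 0 \<le> h x) \<and>
                  \<eta> = density gauss (\<lambda>x. ennreal (h x)) \<and>
                  abs_continuous_on_lines (\<lambda>x. sqrt (h x))}.
        4 * (\<integral>\<^sup>+ x. ennreal (\<Sum>i\<in>UNIV. (partial_deriv i (\<lambda>z. sqrt (h z)) x)\<^sup>2) \<partial>gauss))"

definition deficit :: "(real^'n) measure \<Rightarrow> ereal" where
  "deficit \<eta> = ereal (1/2) * enn2ereal (fisher_information \<eta>) - rel_entropy \<eta>"


definition admissible :: "(real^'n) measure \<Rightarrow> (real^'n \<Rightarrow> ereal) \<Rightarrow> bool" where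
  "admissible \<eta> V \<longleftrightarrow>
     prob_space \<eta> \<and> log_concave \<eta> \<and> unconditional \<eta> \<and>
     essentially_continuous V \<and> \<eta> = exp_neg_measure V \<and> moment_measure V \<in> P2"

end

theory Submission
  imports Defs
begin

text \<open>Write \<open>f = e\<^sup>-\<^sup>V\<close> and \<open>\<eta> = f dx\<close> on \<open>\<real>\<^sup>n\<close>. Symmetry makes all terms of the inequality explicit integrals:
  \<^item> \<open>H(\<eta>|\<gamma>) = - \<integral> V d\<eta> + (1/2) \<integral> |x|\<^sup>2 d\<eta> + (n/2) ln (2\<pi>)\<close>, since the logarithm of the density of
    \<open>\<eta>\<close> with respect to \<open>\<gamma>\<close> is \<open>- V + |x|\<^sup>2/2 + (n/2) ln (2\<pi>)\<close>;
  \<^item> \<open>I(\<eta>|\<gamma>) \<ge> \<integral> |x - \<nabla>V|\<^sup>2 d\<eta> \<ge> \<integral> |x|\<^sup>2 d\<eta> + \<integral> |\<nabla>V|\<^sup>2 d\<eta> - 2 n\<close>, because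
    \<open>\<integral> x\<^sub>i \<partial>\<^sub>iV d\<eta> \<le> 1\<close> (an integration by parts on each line, whose boundary terms have a good sign);
  \<^item> \<open>W\<^sub>2\<^sup>2(\<nu>, \<lambda>) = \<integral> \<Sum>\<^sub>i (|\<partial>\<^sub>iV| - 1)\<^sup>2 d\<eta>\<close>, because \<open>\<nu>\<close> is again unconditional: a point \<open>y\<close> can be
    transported to the vertex of the cube that carries its signs, and no coupling does better.

  Both second moments cancel and the inequality reduces to
  \<open>n (1 + ln 2) + \<integral> ln f d\<eta> \<le> \<Sum>\<^sub>i \<integral> |\<partial>\<^sub>iV| d\<eta>\<close>.
  This rests on a bound along lines. An even integrable log-concave function on a line is
  nonincreasing away from the origin and tends to 0, so its value is at most half of its total variation: \<open>2 f \<le> \<integral> |\<partial>\<^sub>if| dx\<^sub>i\<close>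
  (\<open>line_grad_ge\<close>). Only the absolutely continuous part of the variation is available, so \<open>f\<close> must not
  jump at the boundary of \<open>{V < \<infinity>}\<close>. If the Fisher information is finite, a version of the square
  root of the density is continuous on almost every line, which excludes jumps
  (\<open>no_boundary_jump\<close>); if it is infinite, there is nothing to prove. To pass from lines to \<open>\<real>\<^sup>n\<close>,
  factor \<open>f\<close> into conditional densities, one coordinate at a time: if \<open>g\<close> is the marginal
  obtained by integrating out \<open>x\<^sub>i\<close>, then \<open>ln f = ln g + ln (f/g)\<close> and
  \<open>ln (2 f/g) \<le> 2 f/g - 1\<close>, while \<open>\<integral> f (2 f/g) dx \<le> \<integral> |\<partial>\<^sub>if| dx\<close> by the bound along lines; the
  bounds in the other coordinates survive integration over \<open>x\<^sub>i\<close> (\<open>triangular_entropy_bound\<close>).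

  Convexity is used without any smoothness: a convex function on a line has a derivative at all but
  countably many points of its domain, and a convex function on \<open>\<real>\<^sup>n\<close> is differentiable wherever all its
  partial derivatives exist. This gives measurability and almost everywhere existence of \<open>\<nabla>V\<close>
  (\<open>has_ext_gradient_from_lines\<close>, \<open>ext_convex_AE_ext_differentiable\<close>).

  The constant is optimal because every step is nearly an equality when \<open>f\<close> is close to the uniform
  density of the cube \<open>[-1, 1]\<^sup>n\<close>. This density has jumps, so it is approximated by
  \<open>V\<^sub>k(x) = \<Sum>\<^sub>i (ln Z\<^sub>k + x\<^sub>i ^ (2 k))\<close>, where \<open>Z\<^sub>k\<close> normalizes the mass to 1. For it the integrations by parts are exact, \<open>\<integral> V\<^sub>k d\<eta> = n (ln Z\<^sub>k + 1/(2k))\<close> and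
  \<open>\<integral> |\<partial>\<^sub>iV\<^sub>k| d\<eta> \<le> 2/Z\<^sub>k\<close>, so the gap in the inequality is at most
  \<open>n (ln Z\<^sub>k + 2/Z\<^sub>k - 1 - ln 2 + 1/(2k))\<close>, which tends to 0 because \<open>Z\<^sub>k \<rightarrow> 2\<close> (\<open>deficit_gap_bound\<close>).\<close>

section \<open>Lebesgue measure as a product and coordinate lines\<close>

interpretation lborel_PiM: product_sigma_finite "\<lambda>_::'i. lborel :: real measure"
  by unfold_locales

text \<open>Almost-everywhere statements are moved between \<open>\<real>\<^sup>n\<close> and its coordinate lines by the next
  three lemmas. In this direction \<open>P\<close> may be an arbitrary predicate: it is covered by a measurable
  null set, to which Tonelli's theorem applies. Conversely, \<open>P\<close> has to be measurable, since a set
  all of whose sections are null need not be null.\<close>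

lemma AE_PiM_insertD:
  assumes I: "finite I" "i \<notin> I"
    and P: "AE x in \<Pi>\<^sub>M j\<in>insert i I. (lborel :: real measure). P x"
  shows "AE y in \<Pi>\<^sub>M j\<in>I. (lborel :: real measure). AE t in lborel. P (y(i := t))"
proof -
  let ?M = "\<lambda>I. \<Pi>\<^sub>M j\<in>I. (lborel :: real measure)"
  obtain N where N: "{x \<in> space (?M (insert i I)). \<not> P x} \<subseteq> N" "emeasure (?M (insert i I)) N = 0"
      and [measurable]: "N \<in> sets (?M (insert i I))"
    using P by (auto elim!: AE_E)
  have "(\<integral>\<^sup>+y. (\<integral>\<^sup>+t. indicator N (y(i := t)) \<partial>lborel) \<partial>?M I) = (\<integral>\<^sup>+x. indicator N x \<partial>?M (insert i I))"
    by (rule lborel_PiM.product_nn_integral_insert[symmetric]) (use I in auto)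
  also have "\<dots> = 0" using N by simp
  finally have "AE y in ?M I. (\<integral>\<^sup>+t. indicator N (y(i := t)) \<partial>lborel) = 0"
    by (subst (asm) nn_integral_0_iff_AE) auto
  then show ?thesis
  proof (rule AE_mp[OF _ AE_I2[OF impI]])
    fix y assume y: "y \<in> space (?M I)" and 0: "(\<integral>\<^sup>+t. indicator N (y(i := t)) \<partial>lborel) = 0"
    have [measurable]: "(\<lambda>t. y(i := t)) \<in> lborel \<rightarrow>\<^sub>M ?M (insert i I)"
      using y by measurable
    from 0 have "AE t in lborel. indicator N (y(i := t)) = (0::ennreal)"
      by (subst (asm) nn_integral_0_iff_AE) auto
    then show "AE t in lborel. P (y(i := t))"
    proof (rule AE_mp[OF _ AE_I2[OF impI]])
      fix t :: real assume "t \<in> space lborel" and "indicator N (y(i := t)) = (0::ennreal)"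
      then have "y(i := t) \<notin> N" by (auto simp: indicator_def split: if_splits)
      moreover have "y(i := t) \<in> space (?M (insert i I))" using y by (auto simp: space_PiM PiE_iff extensional_def)
      ultimately show "P (y(i := t))" using N(1) by auto
    qed
  qed
qed

lemma AE_PiM_insertI:
  assumes I: "finite I" "i \<notin> I"
    and P[measurable]: "{x \<in> space (\<Pi>\<^sub>M j\<in>insert i I. (lborel :: real measure)). P x}
      \<in> sets (\<Pi>\<^sub>M j\<in>insert i I. (lborel :: real measure))"
    and AE: "AE y in \<Pi>\<^sub>M j\<in>I. (lborel :: real measure). AE t in lborel. P (y(i := t))"
  shows "AE x in \<Pi>\<^sub>M j\<in>insert i I. (lborel :: real measure). P x"
proof -
  let ?M = "\<lambda>I. \<Pi>\<^sub>M j\<in>I. (lborel :: real measure)"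
  let ?N = "{x \<in> space (?M (insert i I)). \<not> P x}"
  have [measurable]: "?N \<in> sets (?M (insert i I))" by measurable
  have "emeasure (?M (insert i I)) ?N = (\<integral>\<^sup>+y. (\<integral>\<^sup>+t. indicator ?N (y(i := t)) \<partial>lborel) \<partial>?M I)"
    by (subst lborel_PiM.product_nn_integral_insert[symmetric]) (use I in auto)
  also have "\<dots> = (\<integral>\<^sup>+y. 0 \<partial>?M I)"
  proof (rule nn_integral_cong_AE, rule AE_mp[OF AE AE_I2[OF impI]])
    fix y assume "AE t in lborel. P (y(i := t))"
    then have "(\<integral>\<^sup>+t. indicator ?N (y(i := t)) \<partial>lborel) = (\<integral>\<^sup>+(t::real). 0 \<partial>lborel)"
      by (intro nn_integral_cong_AE) (auto simp: indicator_def)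
    then show "(\<integral>\<^sup>+t. indicator ?N (y(i := t)) \<partial>lborel) = 0" by simp
  qed
  finally show ?thesis by (intro AE_I[where N="?N"]) auto
qed

text \<open>A predicate of the remaining coordinates only is the exception to the measurability
  requirement: a null set times a line is null.\<close>

lemma AE_PiM_restrict:
  assumes I: "finite I" "i \<notin> I"
    and Q: "AE y in \<Pi>\<^sub>M j\<in>I. (lborel :: real measure). Q y"
  shows "AE x in \<Pi>\<^sub>M j\<in>insert i I. (lborel :: real measure). Q (restrict x I)"
proof -
  let ?M = "\<lambda>I. \<Pi>\<^sub>M j\<in>I. (lborel :: real measure)"
  obtain N where N: "{x \<in> space (?M I). \<not> Q x} \<subseteq> N" "emeasure (?M I) N = 0"
      and [measurable]: "N \<in> sets (?M I)"
    using Q by (auto elim!: AE_E)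
  have [measurable]: "(\<lambda>x. restrict x I) \<in> ?M (insert i I) \<rightarrow>\<^sub>M ?M I"
    by (rule measurable_restrict_subset) auto
  have "AE y in ?M I. y \<notin> N" using N by (intro AE_not_in) auto
  then have "AE y in ?M I. AE t in lborel. restrict (y(i := t)) I \<notin> N"
  proof (rule AE_mp[OF _ AE_I2[OF impI]])
    fix y assume "y \<in> space (?M I)" "y \<notin> N"
    moreover have "restrict (y(i := t)) I = y" for t
      using \<open>y \<in> space (?M I)\<close> I by (auto simp: space_PiM PiE_iff extensional_def fun_eq_iff)
    ultimately show "AE t in lborel. restrict (y(i := t)) I \<notin> N" by simp
  qed
  then have "AE x in ?M (insert i I). restrict x I \<notin> N"
    by (rule AE_PiM_insertI[OF I, rotated]) measurable
  then show ?thesis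
  proof (rule AE_mp[OF _ AE_I2[OF impI]])
    fix x assume "x \<in> space (?M (insert i I))" "restrict x I \<notin> N"
    moreover have "restrict x I \<in> space (?M I)"
      using \<open>x \<in> space (?M (insert i I))\<close> by (auto simp: space_PiM PiE_iff)
    ultimately show "Q (restrict x I)" using N by auto
  qed
qed

lemma measurable_vecI:
  fixes f :: "'a \<Rightarrow> real^'n"
  assumes "\<And>i. (\<lambda>x. f x $ i) \<in> borel_measurable M"
  shows "f \<in> borel_measurable M"
proof (subst borel_measurable_euclidean_space, intro ballI)
  fix b :: "real^'n" assume "b \<in> Basis"
  then obtain j where b: "b = axis j 1" by (auto simp: Basis_vec_def)
  show "(\<lambda>x. f x \<bullet> b) \<in> borel_measurable M"
    unfolding b using assms[of j] by (simp add: inner_axis)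
qed

lemma measurable_vec_lambda_PiM [measurable]:
  "(vec_lambda :: ('n::finite \<Rightarrow> real) \<Rightarrow> real^'n) \<in> (\<Pi>\<^sub>M i\<in>UNIV. borel) \<rightarrow>\<^sub>M borel"
  by (rule measurable_vecI) simp

text \<open>The bridge between the Euclidean space \<open>real^'n\<close>, on which measures live, and the product
  space of functions, on which coordinates can be integrated out one after the other.\<close>

lemma lborel_vec:
  "(lborel :: (real^'n) measure) = distr (\<Pi>\<^sub>M i\<in>UNIV. lborel) borel vec_lambda"
proof (rule lborel_eqI)
  show "sets (distr (\<Pi>\<^sub>M i\<in>UNIV. lborel) borel vec_lambda :: (real^'n) measure) = sets borel" by simp
next
  fix l u :: "real^'n" assume le: "\<And>b. b \<in> Basis \<Longrightarrow> l \<bullet> b \<le> u \<bullet> b"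
  have le': "l $ i \<le> u $ i" for i using le[of "axis i 1"] by (simp add: inner_axis axis_in_Basis_iff)
  have [measurable]: "(vec_lambda :: ('n \<Rightarrow> real) \<Rightarrow> real^'n) \<in> (\<Pi>\<^sub>M i\<in>UNIV. lborel) \<rightarrow>\<^sub>M borel"
    using measurable_vec_lambda_PiM by (simp cong: measurable_cong_sets sets_PiM_cong)
  have "emeasure (distr (\<Pi>\<^sub>M i\<in>UNIV. lborel) borel vec_lambda) (box l u)
     = emeasure (\<Pi>\<^sub>M i\<in>UNIV. lborel) (vec_lambda -` box l u \<inter> space (\<Pi>\<^sub>M (i::'n)\<in>UNIV. (lborel::real measure)))"
    by (rule emeasure_distr) auto
  also have "vec_lambda -` box l u \<inter> space (\<Pi>\<^sub>M (i::'n)\<in>UNIV. (lborel::real measure)) = (\<Pi>\<^sub>E i\<in>UNIV. {l $ i<..<u $ i})"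
    by (auto simp: mem_box_cart space_PiM PiE_iff)
  also have "emeasure (\<Pi>\<^sub>M i\<in>UNIV. lborel) \<dots> = (\<Prod>i\<in>UNIV. ennreal (u $ i - l $ i))"
    by (subst lborel_PiM.emeasure_PiM) (auto simp: le')
  also have "\<dots> = ennreal (\<Prod>i\<in>UNIV. (u $ i - l $ i))"
    by (rule prod_ennreal) (simp add: le')
  also have "(\<Prod>i\<in>UNIV. (u $ i - l $ i)) = (\<Prod>b\<in>Basis. (u - l) \<bullet> b)"
    by (rule prod.reindex_bij_witness[of _ "\<lambda>b. SOME i. b = axis i 1" "\<lambda>i. axis i 1"])
       (auto simp: inner_axis axis_in_Basis_iff axis_eq_axis Basis_vec_def)
  finally show "emeasure (distr (\<Pi>\<^sub>M i\<in>UNIV. lborel) borel vec_lambda) (box l u) = (\<Prod>b\<in>Basis. (u - l) \<bullet> b)" .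
qed

lemma measurable_vec_lambda_lborel [measurable]:
  "(vec_lambda :: ('n::finite \<Rightarrow> real) \<Rightarrow> real^'n) \<in> (\<Pi>\<^sub>M i\<in>UNIV. lborel) \<rightarrow>\<^sub>M borel"
  using measurable_vec_lambda_PiM by (simp cong: measurable_cong_sets sets_PiM_cong)

lemma nn_integral_vec:
  fixes F :: "real^'n \<Rightarrow> ennreal"
  assumes [measurable]: "F \<in> borel_measurable borel"
  shows "(\<integral>\<^sup>+x. F x \<partial>lborel) = (\<integral>\<^sup>+y. F (vec_lambda y) \<partial>(\<Pi>\<^sub>M i\<in>UNIV. lborel))"
  by (subst lborel_vec, subst nn_integral_distr) auto

lemma AE_vec_iff:
  fixes P :: "real^'n \<Rightarrow> bool"
  shows "(AE x in lborel. P x) \<longleftrightarrow> (AE y in \<Pi>\<^sub>M i\<in>UNIV. lborel. P (vec_lambda y))"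
proof
  assume "AE x in lborel. P x"
  then show "AE y in \<Pi>\<^sub>M i\<in>UNIV. lborel. P (vec_lambda y)"
    by (subst (asm) lborel_vec) (rule AE_distrD[rotated], auto)
next
  have m: "(\<lambda>x. vec_nth x) \<in> (borel :: (real^'n) measure) \<rightarrow>\<^sub>M (\<Pi>\<^sub>M i\<in>UNIV. lborel)"
    by (rule measurable_PiM_single') (auto simp: space_PiM)
  have d: "(\<Pi>\<^sub>M i\<in>UNIV. lborel) = distr (lborel :: (real^'n) measure) (\<Pi>\<^sub>M i\<in>UNIV. lborel) vec_nth"
    by (subst lborel_vec, subst distr_distr) (use m in \<open>auto simp: o_def vec_lambda_inverse distr_id2\<close>)
  assume "AE y in \<Pi>\<^sub>M i\<in>UNIV. lborel. P (vec_lambda y)"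
  then have "AE x in (lborel :: (real^'n) measure). P (vec_lambda (vec_nth x))"
    by (subst (asm) d) (rule AE_distrD[OF m[unfolded measurable_lborel2[symmetric]], where P="\<lambda>y. P (vec_lambda y)"], simp)
  then show "AE x in lborel. P x" by simp
qed

text \<open>The point is given as a function, not as a vector, because the lines parallel to an axis are
  parametrized by the product space without the \<open>i\<close>-th factor; the value \<open>y i\<close> is ignored.\<close>

definition line :: "'n \<Rightarrow> ('n \<Rightarrow> real) \<Rightarrow> real \<Rightarrow> real^'n" where
  "line i y t = (\<chi> j. if j = i then t else y j)"

lemma line_eq: "line i y t = vec_lambda (y(i := t))"
  by (simp add: line_def vec_eq_iff)

lemma line_nth [simp]: "line i y t $ j = (if j = i then t else y j)"
  by (simp add: line_def)

lemma line_self [simp]: "line i (vec_nth x) (x $ i) = x"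
  by (simp add: vec_eq_iff)

lemma line_line [simp]: "line i (vec_nth (line i y s)) t = line i y t"
  by (simp add: vec_eq_iff)

lemma insert_Diff_UNIV: "insert i (UNIV - {i}) = UNIV" by auto

lemma measurable_line [measurable]:
  "(\<lambda>(y, t). line i y t) \<in> (\<Pi>\<^sub>M j\<in>UNIV - {i}. lborel) \<Otimes>\<^sub>M lborel \<rightarrow>\<^sub>M (borel :: (real^'n) measure)"
proof -
  have "(\<lambda>(y, t). y(i := t)) \<in> (\<Pi>\<^sub>M j\<in>UNIV - {i}. lborel) \<Otimes>\<^sub>M lborel \<rightarrow>\<^sub>M (\<Pi>\<^sub>M j\<in>insert i (UNIV - {i}). (lborel :: real measure))"
    by measurable
  then show ?thesis unfolding line_eq insert_Diff_UNIV
    using measurable_compose[OF _ measurable_vec_lambda_lborel] by (simp add: case_prod_beta')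
qed

lemma measurable_vec_nth [measurable]: "(\<lambda>x. x $ j) \<in> borel_measurable (borel :: (real^'n) measure)"
  by (intro borel_measurable_continuous_onI continuous_intros)

lemma measurable_line_fixed [measurable]: "(\<lambda>t. line i y t) \<in> borel \<rightarrow>\<^sub>M (borel :: (real^'n) measure)"
  by (rule measurable_vecI) simp

lemma measurable_line_of_point [measurable]:
  "(\<lambda>(x, t). line i (vec_nth x) t) \<in> borel \<Otimes>\<^sub>M borel \<rightarrow>\<^sub>M (borel :: (real^'n) measure)"
  by (rule measurable_vecI) (simp add: case_prod_beta)

lemma nn_integral_line:
  fixes F :: "real^'n \<Rightarrow> ennreal"
  assumes [measurable]: "F \<in> borel_measurable borel"
  shows "(\<integral>\<^sup>+x. F x \<partial>lborel) = (\<integral>\<^sup>+y. (\<integral>\<^sup>+t. F (line i y t) \<partial>lborel) \<partial>(\<Pi>\<^sub>M j\<in>UNIV - {i}. lborel))"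
proof -
  have "(\<integral>\<^sup>+x. F x \<partial>lborel) = (\<integral>\<^sup>+y. F (vec_lambda y) \<partial>(\<Pi>\<^sub>M j\<in>insert i (UNIV - {i}). lborel))"
    by (simp add: nn_integral_vec insert_Diff_UNIV)
  also have "\<dots> = (\<integral>\<^sup>+y. (\<integral>\<^sup>+t. F (line i y t) \<partial>lborel) \<partial>(\<Pi>\<^sub>M j\<in>UNIV - {i}. lborel))"
    unfolding line_eq by (rule lborel_PiM.product_nn_integral_insert) (auto simp: insert_Diff_UNIV)
  finally show ?thesis .
qed

lemma AE_lineD:
  fixes P :: "real^'n \<Rightarrow> bool"
  assumes "AE x in lborel. P x"
  shows "AE y in \<Pi>\<^sub>M j\<in>UNIV - {i}. (lborel::real measure). AE t in lborel. P (line i y t)"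
  unfolding line_eq
proof (rule AE_PiM_insertD)
  show "AE y in \<Pi>\<^sub>M j\<in>insert i (UNIV - {i}). lborel. P (vec_lambda y)"
    using assms unfolding insert_Diff_UNIV AE_vec_iff .
qed auto

lemma AE_lineI:
  fixes P :: "real^'n \<Rightarrow> bool"
  assumes [measurable]: "{x. P x} \<in> sets borel"
    and "AE y in \<Pi>\<^sub>M j\<in>UNIV - {i}. (lborel::real measure). AE t in lborel. P (line i y t)"
  shows "AE x in lborel. P x"
proof -
  have "Measurable.pred borel P" using assms(1) by (simp add: pred_def)
  note [measurable] = this
  have "AE y in \<Pi>\<^sub>M j\<in>insert i (UNIV - {i}). lborel. P (vec_lambda y)"
  proof (rule AE_PiM_insertI)
    show "{x \<in> space (\<Pi>\<^sub>M j\<in>insert i (UNIV - {i}). lborel). P (vec_lambda x)}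
        \<in> sets (\<Pi>\<^sub>M j\<in>insert i (UNIV - {i}). lborel)"
      unfolding insert_Diff_UNIV by measurable
    show "AE y in \<Pi>\<^sub>M j\<in>UNIV - {i}. (lborel::real measure). AE t in lborel. P (vec_lambda (y(i := t)))"
      using assms(2) unfolding line_eq .
  qed auto
  then show ?thesis unfolding insert_Diff_UNIV AE_vec_iff .
qed

section \<open>Entropy bound by triangular factorization\<close>

text \<open>With \<open>D i = |\<partial>\<^sub>if|\<close> this is \<open>\<integral> f ln f + n (1 + ln 2) \<le> \<Sum>\<^sub>i \<integral> |\<partial>\<^sub>if|\<close>. The induction integrates
  out one coordinate after the other. The hypothesis \<open>2 f \<le> \<integral> D i dx\<^sub>i\<close>, unlike a statement about
  derivatives, is inherited by marginals: integrating over another coordinate replaces \<open>f\<close> and \<open>D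
  i\<close> by their marginals. The function \<open>G\<close> is the sum of the quotients \<open>2 f/g\<close> of successive
  marginals; a pointwise nonnegative majorant of \<open>ln f\<close> is stated instead of \<open>\<integral> f ln f\<close>, whose
  negative part might not be integrable.\<close>

lemma triangular_entropy_bound:
  fixes f :: "('i \<Rightarrow> real) \<Rightarrow> ennreal"
  assumes "finite I"
    and "f \<in> borel_measurable (\<Pi>\<^sub>M j\<in>I. (lborel :: real measure))"
    and "\<And>i. i \<in> I \<Longrightarrow> D i \<in> borel_measurable (\<Pi>\<^sub>M j\<in>I. (lborel :: real measure))"
    and "(\<integral>\<^sup>+x. f x \<partial>(\<Pi>\<^sub>M j\<in>I. lborel)) = 1"
    and "\<And>i. i \<in> I \<Longrightarrow> AE x in \<Pi>\<^sub>M j\<in>I. lborel. 2 * f x \<le> (\<integral>\<^sup>+t. D i (x(i := t)) \<partial>lborel)"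
  shows "\<exists>G. G \<in> borel_measurable (\<Pi>\<^sub>M j\<in>I. (lborel :: real measure)) \<and> (\<forall>x. 0 \<le> G x)
     \<and> (\<integral>\<^sup>+x. f x * ennreal (G x) \<partial>(\<Pi>\<^sub>M j\<in>I. lborel)) \<le> (\<Sum>i\<in>I. \<integral>\<^sup>+x. D i x \<partial>(\<Pi>\<^sub>M j\<in>I. lborel))
     \<and> (AE x in \<Pi>\<^sub>M j\<in>I. lborel. f x \<noteq> 0 \<longrightarrow> ln (enn2real (f x)) + real (card I) * (1 + ln 2) \<le> G x)"
  using assms
proof (induction I arbitrary: f D rule: finite_induct)
  case empty
  then have f1: "f (\<lambda>_. undefined) = 1" by (simp add: lborel_PiM.nn_integral_empty)
  show ?case
    by (intro exI[of _ "\<lambda>_. 0"]) (auto simp: f1 space_PiM_empty intro!: AE_I2)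
next
  case (insert i I)
  let ?M = "\<lambda>I. \<Pi>\<^sub>M j\<in>I. (lborel :: real measure)"
  note [simp] = insert.hyps
  note [measurable] = insert.prems(1)
  have mD[measurable]: "D i \<in> borel_measurable (?M (insert i I))" using insert.prems(2) by auto
  have mD': "D j \<in> borel_measurable (?M (insert i I))" if "j \<in> I" for j using insert.prems(2) that by auto
  have upd[measurable]: "(\<lambda>(y, t). y(i := t)) \<in> ?M I \<Otimes>\<^sub>M lborel \<rightarrow>\<^sub>M ?M (insert i I)" by measurable
  define g where "g y = (\<integral>\<^sup>+t. f (y(i := t)) \<partial>lborel)" for y
  define E where "E j y = (\<integral>\<^sup>+t. D j (y(i := t)) \<partial>lborel)" for j y
  have [measurable]: "g \<in> borel_measurable (?M I)" unfolding g_def by measurable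
  have mE: "E j \<in> borel_measurable (?M I)" if "j \<in> I" for j
  proof -
    note [measurable] = mD'[OF that]
    show ?thesis unfolding E_def by measurable
  qed
  have [measurable]: "E i \<in> borel_measurable (?M I)" unfolding E_def by measurable
  have g1: "(\<integral>\<^sup>+y. g y \<partial>?M I) = 1"
    using insert.prems(3) unfolding g_def by (subst (asm) lborel_PiM.product_nn_integral_insert) auto
  have intE: "(\<integral>\<^sup>+y. E j y \<partial>?M I) = (\<integral>\<^sup>+x. D j x \<partial>?M (insert i I))" if "j \<in> insert i I" for j
    using that insert.prems(2) unfolding E_def by (subst lborel_PiM.product_nn_integral_insert) auto
  have gE: "AE y in ?M I. 2 * g y \<le> (\<integral>\<^sup>+s. E j (y(j := s)) \<partial>lborel)" if j: "j \<in> I" for j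
  proof -
    note [measurable] = mD'[OF j]
    have ji: "j \<noteq> i" using j insert.hyps by auto
    have "AE y in ?M I. AE t in lborel. 2 * f (y(i := t)) \<le> (\<integral>\<^sup>+s. D j ((y(i := t))(j := s)) \<partial>lborel)"
      by (rule AE_PiM_insertD) (use insert.prems(4)[of j] j in auto)
    then show ?thesis
    proof (rule AE_mp[OF _ AE_I2[OF impI]])
      fix y assume y: "y \<in> space (?M I)"
        and AE: "AE t in lborel. 2 * f (y(i := t)) \<le> (\<integral>\<^sup>+s. D j ((y(i := t))(j := s)) \<partial>lborel)"
      have [measurable]: "(\<lambda>t. y(i := t)) \<in> lborel \<rightarrow>\<^sub>M ?M (insert i I)" using y by measurable
      have yi: "insert j (insert i I) = insert i I" using j by auto
      have "(\<lambda>(t, s). (y(i := t))(j := s)) \<in> lborel \<Otimes>\<^sub>M lborel \<rightarrow>\<^sub>M ?M (insert j (insert i I))" by measurable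
      then have [measurable]: "(\<lambda>(t, s). (y(i := t))(j := s)) \<in> lborel \<Otimes>\<^sub>M lborel \<rightarrow>\<^sub>M ?M (insert i I)"
        unfolding yi .
      have "2 * g y = (\<integral>\<^sup>+t. 2 * f (y(i := t)) \<partial>lborel)"
        unfolding g_def by (rule nn_integral_cmult[symmetric]) measurable
      also have "\<dots> \<le> (\<integral>\<^sup>+t. (\<integral>\<^sup>+s. D j ((y(i := t))(j := s)) \<partial>lborel) \<partial>lborel)"
        by (rule nn_integral_mono_AE[OF AE])
      also have "\<dots> = (\<integral>\<^sup>+s. (\<integral>\<^sup>+t. D j ((y(i := t))(j := s)) \<partial>lborel) \<partial>lborel)"
        by (rule lborel_pair.Fubini'[symmetric]) measurable
      also have "\<dots> = (\<integral>\<^sup>+s. E j (y(j := s)) \<partial>lborel)"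
        unfolding E_def using ji by (simp add: fun_upd_twist)
      finally show "2 * g y \<le> (\<integral>\<^sup>+s. E j (y(j := s)) \<partial>lborel)" .
    qed
  qed
  obtain G where G[measurable]: "G \<in> borel_measurable (?M I)" and G0: "\<And>x. 0 \<le> G x"
    and Gint: "(\<integral>\<^sup>+y. g y * ennreal (G y) \<partial>?M I) \<le> (\<Sum>j\<in>I. \<integral>\<^sup>+y. E j y \<partial>?M I)"
    and GAE: "AE y in ?M I. g y \<noteq> 0 \<longrightarrow> ln (enn2real (g y)) + real (card I) * (1 + ln 2) \<le> G y"
    using insert.IH[of g E, OF _ mE g1 gE] by auto
  have restr[measurable]: "(\<lambda>x. restrict x I) \<in> ?M (insert i I) \<rightarrow>\<^sub>M ?M I"
    by (rule measurable_restrict_subset) auto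
  have ru: "restrict (y(i := t)) I = y" if "y \<in> space (?M I)" for y t
    using that insert.hyps by (auto simp: space_PiM PiE_iff extensional_def fun_eq_iff)
  \<comment> \<open>Where \<open>g\<close> is 0 or infinite this quotient has the value 0; such points carry no mass of \<open>f\<close>.\<close>
  define H where "H x = 2 * enn2real (f x) / enn2real (g (restrict x I))" for x
  have [measurable]: "H \<in> borel_measurable (?M (insert i I))" unfolding H_def by measurable
  have H0: "0 \<le> H x" for x by (simp add: H_def)
  have gfin: "AE y in ?M I. g y \<noteq> \<infinity>"
    by (rule nn_integral_noteq_infinite) (auto simp: g1)
  have ffin: "AE x in ?M (insert i I). f x \<noteq> \<infinity>"
    by (rule nn_integral_noteq_infinite) (auto simp: insert.prems(3))
  have f2: "AE y in ?M I. AE t in lborel. 2 * f (y(i := t)) \<le> E i y"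
  proof -
    have "AE y in ?M I. AE t in lborel. 2 * f (y(i := t)) \<le> (\<integral>\<^sup>+s. D i ((y(i := t))(i := s)) \<partial>lborel)"
      by (rule AE_PiM_insertD) (use insert.prems(4)[of i] in auto)
    then show ?thesis by (simp add: E_def)
  qed
  have intH: "(\<integral>\<^sup>+x. f x * ennreal (H x) \<partial>?M (insert i I)) \<le> (\<integral>\<^sup>+x. D i x \<partial>?M (insert i I))"
  proof -
    have "(\<integral>\<^sup>+x. f x * ennreal (H x) \<partial>?M (insert i I)) =
       (\<integral>\<^sup>+y. (\<integral>\<^sup>+t. f (y(i := t)) * ennreal (H (y(i := t))) \<partial>lborel) \<partial>?M I)"
      by (rule lborel_PiM.product_nn_integral_insert) auto
    also have "\<dots> \<le> (\<integral>\<^sup>+y. E i y \<partial>?M I)"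
    proof (rule nn_integral_mono_AE, rule AE_mp[OF f2], rule AE_mp[OF gfin], rule AE_I2, intro impI)
      fix y assume y: "y \<in> space (?M I)" and gf: "g y \<noteq> \<infinity>"
        and fE: "AE t in lborel. 2 * f (y(i := t)) \<le> E i y"
      have [measurable]: "(\<lambda>t. y(i := t)) \<in> lborel \<rightarrow>\<^sub>M ?M (insert i I)" using y by measurable
      \<comment> \<open>The bound \<open>2 f \<le> E i y\<close> is uniform in \<open>t\<close>, so one factor \<open>f\<close> can be replaced by it and
        the remaining \<open>f/g\<close> has mass at most 1.\<close>
      define c where "c = 1 / enn2real (g y)"
      have c0: "0 \<le> c" by (simp add: c_def)
      have "(\<integral>\<^sup>+t. f (y(i := t)) * ennreal (H (y(i := t))) \<partial>lborel)
          \<le> (\<integral>\<^sup>+t. E i y * (f (y(i := t)) * ennreal c) \<partial>lborel)"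
      proof (rule nn_integral_mono_AE, rule AE_mp[OF fE], rule AE_I2, rule impI)
        fix t assume le: "2 * f (y(i := t)) \<le> E i y"
        show "f (y(i := t)) * ennreal (H (y(i := t))) \<le> E i y * (f (y(i := t)) * ennreal c)"
        proof (cases "f (y(i := t)) = \<infinity>")
          case True then show ?thesis by (simp add: H_def)
        next
          case False
          then obtain a where a: "f (y(i := t)) = ennreal a" "0 \<le> a" by (cases "f (y(i := t))") auto
          have "f (y(i := t)) * ennreal (H (y(i := t))) = (2 * f (y(i := t))) * (f (y(i := t)) * ennreal c)"
            using a c0 by (simp add: H_def ru[OF y] c_def[symmetric] ennreal_mult'[symmetric] mult_ac divide_inverse flip: ennreal_numeral)
               (simp add: c_def divide_inverse mult_ac)
          also have "\<dots> \<le> E i y * (f (y(i := t)) * ennreal c)" by (rule mult_right_mono[OF le]) simp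
          finally show ?thesis .
        qed
      qed
      also have "\<dots> = E i y * (g y * ennreal c)"
        by (simp add: g_def nn_integral_cmult nn_integral_multc)
      also have "g y * ennreal c \<le> 1"
      proof -
        have "r * inverse r \<le> 1" for r :: real by (cases "r = 0") auto
        then show ?thesis using gf by (cases "g y") (auto simp: c_def ennreal_mult'[symmetric] divide_inverse)
      qed
      then have "E i y * (g y * ennreal c) \<le> E i y * 1" by (rule mult_left_mono) simp
      finally show "(\<integral>\<^sup>+t. f (y(i := t)) * ennreal (H (y(i := t))) \<partial>lborel) \<le> E i y" by simp
    qed
    finally show ?thesis using intE[of i] by simp
  qed
  have fg0: "AE x in ?M (insert i I). f x \<noteq> 0 \<longrightarrow> g (restrict x I) \<noteq> 0"
  proof (rule AE_PiM_insertI)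
    show "AE y in ?M I. AE t in lborel. f (y(i := t)) \<noteq> 0 \<longrightarrow> g (restrict (y(i := t)) I) \<noteq> 0"
    proof (rule AE_I2)
      fix y assume y: "y \<in> space (?M I)"
      have [measurable]: "(\<lambda>t. y(i := t)) \<in> lborel \<rightarrow>\<^sub>M ?M (insert i I)" using y by measurable
      show "AE t in lborel. f (y(i := t)) \<noteq> 0 \<longrightarrow> g (restrict (y(i := t)) I) \<noteq> 0"
      proof (cases "g y = 0")
        case True
        then have "AE t in lborel. f (y(i := t)) = 0"
          unfolding g_def by (subst (asm) nn_integral_0_iff_AE) auto
        then show ?thesis by eventually_elim simp
      next
        case False then show ?thesis by (simp add: ru[OF y])
      qed
    qed
  qed auto
  let ?G = "\<lambda>x. G (restrict x I) + H x"
  have "(\<integral>\<^sup>+x. f x * ennreal (?G x) \<partial>?M (insert i I))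
     = (\<integral>\<^sup>+x. f x * ennreal (G (restrict x I)) + f x * ennreal (H x) \<partial>?M (insert i I))"
    by (simp add: G0 H0 ennreal_plus distrib_left)
  also have "\<dots> = (\<integral>\<^sup>+x. f x * ennreal (G (restrict x I)) \<partial>?M (insert i I))
      + (\<integral>\<^sup>+x. f x * ennreal (H x) \<partial>?M (insert i I))"
    by (rule nn_integral_add) auto
  also have "(\<integral>\<^sup>+x. f x * ennreal (G (restrict x I)) \<partial>?M (insert i I))
      = (\<integral>\<^sup>+y. (\<integral>\<^sup>+t. f (y(i := t)) * ennreal (G (restrict (y(i := t)) I)) \<partial>lborel) \<partial>?M I)"
    by (rule lborel_PiM.product_nn_integral_insert) auto
  also have "\<dots> = (\<integral>\<^sup>+y. g y * ennreal (G y) \<partial>?M I)"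
  proof (rule nn_integral_cong)
    fix y assume y: "y \<in> space (?M I)"
    have [measurable]: "(\<lambda>t. y(i := t)) \<in> lborel \<rightarrow>\<^sub>M ?M (insert i I)" using y by measurable
    show "(\<integral>\<^sup>+t. f (y(i := t)) * ennreal (G (restrict (y(i := t)) I)) \<partial>lborel) = g y * ennreal (G y)"
      unfolding ru[OF y] g_def by (rule nn_integral_multc) measurable
  qed
  also have "\<dots> + (\<integral>\<^sup>+x. f x * ennreal (H x) \<partial>?M (insert i I))
     \<le> (\<Sum>j\<in>I. \<integral>\<^sup>+y. E j y \<partial>?M I) + (\<integral>\<^sup>+x. D i x \<partial>?M (insert i I))"
    by (rule add_mono[OF Gint intH])
  also have "\<dots> = (\<Sum>j\<in>insert i I. \<integral>\<^sup>+x. D j x \<partial>?M (insert i I))"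
    by (simp add: intE add.commute)
  finally have int: "(\<integral>\<^sup>+x. f x * ennreal (?G x) \<partial>?M (insert i I)) \<le> (\<Sum>j\<in>insert i I. \<integral>\<^sup>+x. D j x \<partial>?M (insert i I))" .
  have "AE x in ?M (insert i I). f x \<noteq> 0 \<longrightarrow> ln (enn2real (f x)) + real (card (insert i I)) * (1 + ln 2) \<le> ?G x"
    using AE_PiM_restrict[OF insert.hyps GAE] AE_PiM_restrict[OF insert.hyps gfin] ffin fg0
  proof eventually_elim
    case (elim x)
    show ?case
    proof
      assume fx: "f x \<noteq> 0"
      define a b where "a = enn2real (f x)" and "b = enn2real (g (restrict x I))"
      have a: "a > 0" using fx elim(3) unfolding a_def by (cases "f x") (auto simp: enn2real_positive_iff less_top zero_less_iff_neq_zero)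
      have b: "b > 0" using fx elim(2,4) unfolding b_def by (cases "g (restrict x I)") (auto simp: enn2real_positive_iff less_top zero_less_iff_neq_zero)
      \<comment> \<open>With \<open>a = f\<close> and \<open>b = g\<close>: \<open>ln f = ln (2 f/g) + ln g - ln 2\<close>.\<close>
      have "ln (2 * a / b) \<le> 2 * a / b - 1" by (rule ln_le_minus_one) (use a b in simp)
      then have "ln 2 + ln a - ln b + 1 \<le> 2 * a / b" using a b by (simp add: ln_mult ln_div)
      moreover have "ln b + real (card I) * (1 + ln 2) \<le> G (restrict x I)"
        using elim(1,4) fx by (simp add: b_def)
      ultimately show "ln (enn2real (f x)) + real (card (insert i I)) * (1 + ln 2) \<le> ?G x"
        by (simp add: H_def a_def[symmetric] b_def[symmetric] algebra_simps)
    qed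
  qed
  with int show ?case
    by (intro exI[of _ ?G]) (use G0 H0 in auto)
qed

section \<open>One-sided slopes of convex functions on the line\<close>

lemma ext_convexD:
  assumes "ext_convex V" "0 < t" "t < 1"
  shows "V ((1 - t) *\<^sub>R x + t *\<^sub>R y) \<le> ereal (1 - t) * V x + ereal t * V y"
  using assms by (auto simp: ext_convex_def)

lemma ext_convex_not_MInfty [simp]: "ext_convex V \<Longrightarrow> V x \<noteq> -\<infinity>"
  by (auto simp: ext_convex_def)

text \<open>Real bounds on the values at the end points avoid the arithmetic of infinities, and include
  the degenerate weights 0 and 1.\<close>

lemma ext_convex_le_real:
  assumes "ext_convex V" "V x \<le> ereal a" "V y \<le> ereal b" "0 \<le> t" "t \<le> 1"
  shows "V ((1 - t) *\<^sub>R x + t *\<^sub>R y) \<le> ereal ((1 - t) * a + t * b)"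
proof (cases "t = 0 \<or> t = 1")
  case True then show ?thesis using assms by auto
next
  case False
  then have t: "0 < t" "t < 1" using assms by auto
  have "V ((1 - t) *\<^sub>R x + t *\<^sub>R y) \<le> ereal (1 - t) * V x + ereal t * V y"
    by (rule ext_convexD[OF assms(1) t])
  also have "\<dots> \<le> ereal (1 - t) * ereal a + ereal t * ereal b"
    using t assms by (intro add_mono ereal_mult_left_mono) auto
  finally show ?thesis by simp
qed

lemma ext_convex_le_real_1D:
  fixes v :: "real \<Rightarrow> ereal"
  assumes "ext_convex v" "v x \<le> ereal a" "v z \<le> ereal b" "x \<le> y" "y \<le> z" "x < z"
  shows "v y \<le> ereal (a + (y - x) / (z - x) * (b - a))"
proof -
  define t where "t = (y - x) / (z - x)"
  have t: "0 \<le> t" "t \<le> 1" using assms by (auto simp: t_def field_simps)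
  have "t * (z - x) = y - x" using assms by (simp add: t_def)
  then have y: "y = (1 - t) *\<^sub>R x + t *\<^sub>R z" by (simp add: algebra_simps)
  have "v ((1 - t) *\<^sub>R x + t *\<^sub>R z) \<le> ereal ((1 - t) * a + t * b)"
    by (rule ext_convex_le_real) (use assms t in auto)
  also have "(1 - t) * a + t * b = a + (y - x) / (z - x) * (b - a)" by (simp add: t_def[symmetric] algebra_simps)
  finally show ?thesis unfolding y[symmetric] .
qed

text \<open>Slopes of chords, for \<open>s > 0\<close> and a finite value \<open>v t\<close>. An infinite value at the other end
  of the chord makes the slope infinite.\<close>

definition right_quot :: "(real \<Rightarrow> ereal) \<Rightarrow> real \<Rightarrow> real \<Rightarrow> ereal" where
  "right_quot v t s = ereal (1 / s) * (v (t + s) - v t)"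

definition left_quot :: "(real \<Rightarrow> ereal) \<Rightarrow> real \<Rightarrow> real \<Rightarrow> ereal" where
  "left_quot v t s = ereal (1 / s) * (v t - v (t - s))"

lemma right_quot_mono:
  assumes c: "ext_convex v" and f: "v t = ereal a" and s: "0 < s" "s \<le> s'"
  shows "right_quot v t s \<le> right_quot v t s'"
proof (cases "v (t + s') = \<infinity>")
  case True then show ?thesis using s f by (simp add: right_quot_def)
next
  case False
  then obtain b where b: "v (t + s') = ereal b" using ext_convex_not_MInfty[OF c] by (cases "v (t + s')") auto
  have le: "v (t + s) \<le> ereal (a + (t + s - t) / (t + s' - t) * (b - a))"
    by (rule ext_convex_le_real_1D[OF c]) (use s f b in auto)
  then obtain d where d: "v (t + s) = ereal d" using ext_convex_not_MInfty[OF c, of "t + s"] by (cases "v (t + s)") auto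
  have "d - a \<le> s / s' * (b - a)" using le d by simp
  then have "(d - a) / s \<le> (s / s' * (b - a)) / s" by (rule divide_right_mono) (use s in simp)
  then show ?thesis using s by (simp add: right_quot_def f b d)
qed

lemma left_quot_le_right_quot:
  assumes c: "ext_convex v" and f: "v t = ereal a" and s: "0 < s" "0 < s'"
  shows "left_quot v t s \<le> right_quot v t s'"
proof (cases "v (t + s') = \<infinity> \<or> v (t - s) = \<infinity>")
  case True then show ?thesis using s f by (auto simp: right_quot_def left_quot_def)
next
  case False
  then obtain b d where b: "v (t + s') = ereal b" and d: "v (t - s) = ereal d"
    using ext_convex_not_MInfty[OF c] by (cases "v (t + s')"; cases "v (t - s)") auto
  have "v t \<le> ereal (d + (t - (t - s)) / (t + s' - (t - s)) * (b - d))"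
    by (rule ext_convex_le_real_1D[OF c]) (use s b d in auto)
  then have "a \<le> d + s / (s + s') * (b - d)" using f by (simp add: add.commute)
  then have "(a - d) * (s + s') \<le> s * (b - d)" using s by (simp add: field_simps)
  then have "(a - d) * s' \<le> (b - a) * s" by (simp add: algebra_simps)
  then have "(a - d) / s \<le> (b - a) / s'" using s by (simp add: field_simps)
  then show ?thesis using s by (simp add: right_quot_def left_quot_def f b d)
qed

lemma left_quot_reflect:
  assumes "v t = ereal a"
  shows "left_quot v t s = - right_quot (\<lambda>x. v (- x)) (- t) s"
  using assms by (cases "v (t - s)") (auto simp: left_quot_def right_quot_def divide_inverse algebra_simps)

lemma ext_convex_reflect: "ext_convex v \<Longrightarrow> ext_convex (\<lambda>x::real. v (- x))"
  unfolding ext_convex_def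
proof (intro conjI allI impI)
  fix x y t :: real
  assume *: "(\<forall>x. v x \<noteq> - \<infinity>) \<and> (\<forall>x y t. 0 < t \<and> t < 1 \<longrightarrow> v ((1 - t) *\<^sub>R x + t *\<^sub>R y) \<le> ereal (1 - t) * v x + ereal t * v y)"
  assume "0 < t \<and> t < 1"
  then have "v ((1 - t) *\<^sub>R (-x) + t *\<^sub>R (-y)) \<le> ereal (1 - t) * v (-x) + ereal t * v (-y)" using * by blast
  also have "(1 - t) *\<^sub>R (-x) + t *\<^sub>R (-y) = - ((1 - t) *\<^sub>R x + t *\<^sub>R y)" by (simp add: algebra_simps)
  finally show "v (- ((1 - t) *\<^sub>R x + t *\<^sub>R y)) \<le> ereal (1 - t) * v (-x) + ereal t * v (-y)" .
qed auto

lemma left_quot_mono: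
  assumes c: "ext_convex v" and f: "v t = ereal a" and s: "0 < s" "s \<le> s'"
  shows "left_quot v t s' \<le> left_quot v t s"
  unfolding left_quot_reflect[where v=v and t=t, OF f]
  using right_quot_mono[OF ext_convex_reflect[OF c], of "- t" a s s'] f s by simp

text \<open>Infimum and supremum along a sequence agree with the limits as \<open>s\<close> tends to 0 since the
  quotients are monotone, and they make the slopes measurable in \<open>v\<close> and \<open>t\<close> without further work.\<close>

definition right_slope :: "(real \<Rightarrow> ereal) \<Rightarrow> real \<Rightarrow> ereal" where
  "right_slope v t = (INF k. right_quot v t (1 / real (Suc k)))"

definition left_slope :: "(real \<Rightarrow> ereal) \<Rightarrow> real \<Rightarrow> ereal" where
  "left_slope v t = (SUP k. left_quot v t (1 / real (Suc k)))"

lemma right_slope_le: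
  assumes c: "ext_convex v" and f: "v t = ereal a" and s: "0 < s"
  shows "right_slope v t \<le> right_quot v t s"
proof -
  obtain k where k: "1 / real (Suc k) < s" using nat_approx_posE[OF s] by auto
  have "right_slope v t \<le> right_quot v t (1 / real (Suc k))" unfolding right_slope_def by (rule INF_lower) simp
  also have "\<dots> \<le> right_quot v t s" by (rule right_quot_mono[OF c f]) (use k in auto)
  finally show ?thesis .
qed

lemma left_slope_ge:
  assumes c: "ext_convex v" and f: "v t = ereal a" and s: "0 < s"
  shows "left_quot v t s \<le> left_slope v t"
proof -
  obtain k where k: "1 / real (Suc k) < s" using nat_approx_posE[OF s] by auto
  have "left_quot v t s \<le> left_quot v t (1 / real (Suc k))" by (rule left_quot_mono[OF c f]) (use k in auto)
  also have "\<dots> \<le> left_slope v t" unfolding left_slope_def by (rule SUP_upper) simp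
  finally show ?thesis .
qed

text \<open>Differentiability with finiteness nearby absorbed into the error estimate; no conversion
  between \<open>ereal\<close> and \<open>real\<close> remains.\<close>

lemma has_ext_gradient_eps:
  "has_ext_gradient V x D \<longleftrightarrow> (\<exists>a. V x = ereal a \<and> (\<forall>e>0. \<exists>d>0. \<forall>h. norm h < d \<longrightarrow>
     (\<exists>b. V (x + h) = ereal b \<and> \<bar>b - a - h \<bullet> D\<bar> \<le> e * norm h)))"
  (is "?L \<longleftrightarrow> ?R")
proof
  assume ?L
  then have fin: "\<forall>\<^sub>F y in nhds x. \<bar>V y\<bar> \<noteq> \<infinity>"
    and der: "((\<lambda>y. real_of_ereal (V y)) has_derivative (\<lambda>h. h \<bullet> D)) (at x)"
    unfolding has_ext_gradient_def gderiv_def by blast+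
  have "\<bar>V x\<bar> \<noteq> \<infinity>" using eventually_nhds_x_imp_x[OF fin] .
  then obtain a where a: "V x = ereal a" by (cases "V x") auto
  obtain d1 where d1: "d1 > 0" "\<And>y. dist y x < d1 \<Longrightarrow> \<bar>V y\<bar> \<noteq> \<infinity>"
    using fin unfolding eventually_nhds_metric by blast
  show ?R
  proof (rule exI[of _ a], intro conjI allI impI)
    fix e :: real assume "e > 0"
    then obtain d2 where d2: "d2 > 0" "\<And>y. norm (y - x) < d2 \<Longrightarrow>
        norm (real_of_ereal (V y) - real_of_ereal (V x) - (y - x) \<bullet> D) \<le> e * norm (y - x)"
      using der unfolding has_derivative_at_alt by blast
    show "\<exists>d>0. \<forall>h. norm h < d \<longrightarrow> (\<exists>b. V (x + h) = ereal b \<and> \<bar>b - a - h \<bullet> D\<bar> \<le> e * norm h)"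
    proof (rule exI[of _ "min d1 d2"], intro conjI allI impI)
      fix h :: 'a assume h: "norm h < min d1 d2"
      then obtain b where b: "V (x + h) = ereal b" using d1(2)[of "x + h"] by (cases "V (x + h)") (auto simp: dist_norm)
      show "\<exists>b. V (x + h) = ereal b \<and> \<bar>b - a - h \<bullet> D\<bar> \<le> e * norm h"
        using d2(2)[of "x + h"] h by (auto simp: a b)
    qed (use d1 d2 in auto)
  qed (rule a)
next
  assume ?R
  then obtain a where a: "V x = ereal a" and small: "\<And>e. e > 0 \<Longrightarrow> \<exists>d>0. \<forall>h. norm h < d \<longrightarrow>
     (\<exists>b. V (x + h) = ereal b \<and> \<bar>b - a - h \<bullet> D\<bar> \<le> e * norm h)" by blast
  show ?L unfolding has_ext_gradient_def
  proof
    obtain d where d: "d > 0" "\<And>h. norm h < d \<Longrightarrow> \<exists>b. V (x + h) = ereal b" using small[of 1] by force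
    show "\<forall>\<^sub>F y in nhds x. \<bar>V y\<bar> \<noteq> \<infinity>" unfolding eventually_nhds_metric
    proof (rule exI[of _ d], intro conjI allI impI)
      fix y assume "dist y x < d"
      then show "\<bar>V y\<bar> \<noteq> \<infinity>" using d(2)[of "y - x"] by (auto simp: dist_norm)
    qed (rule d)
    show "GDERIV (\<lambda>y. real_of_ereal (V y)) x :> D"
      unfolding gderiv_def has_derivative_at_alt
    proof (intro conjI allI impI)
      show "bounded_linear (\<lambda>h. h \<bullet> D)" by (rule bounded_linear_inner_left)
      fix e :: real assume "e > 0"
      from small[OF this] obtain d where d: "d > 0"
        "\<And>h. norm h < d \<Longrightarrow> \<exists>b. V (x + h) = ereal b \<and> \<bar>b - a - h \<bullet> D\<bar> \<le> e * norm h" by blast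
      show "\<exists>d>0. \<forall>y. norm (y - x) < d \<longrightarrow>
         norm (real_of_ereal (V y) - real_of_ereal (V x) - (y - x) \<bullet> D) \<le> e * norm (y - x)"
      proof (rule exI[of _ d], intro conjI allI impI)
        fix y assume "norm (y - x) < d"
        from d(2)[OF this] show "norm (real_of_ereal (V y) - real_of_ereal (V x) - (y - x) \<bullet> D) \<le> e * norm (y - x)"
          by (auto simp: a)
      qed (rule d)
    qed
  qed
qed

text \<open>The quotients are monotone in the increment, so a bound on one of them holds for all smaller
  increments and agreement of the slopes already gives the uniform error estimate. Finite slopes
  also force finite values near \<open>t\<close>, because the quotients are infinite otherwise.\<close>

lemma has_ext_gradient_iff_slopes:
  assumes c: "ext_convex v" and f: "v t = ereal a"
  shows "has_ext_gradient v t D \<longleftrightarrow> right_slope v t = ereal D \<and> left_slope v t = ereal D"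
proof
  assume "has_ext_gradient v t D"
  then have approx: "\<exists>d>0. \<forall>h. \<bar>h\<bar> < d \<longrightarrow> (\<exists>b. v (t + h) = ereal b \<and> \<bar>b - a - h * D\<bar> \<le> e * \<bar>h\<bar>)" if "e > 0" for e
    using that f unfolding has_ext_gradient_eps by auto
  have small: "\<exists>d>0. \<forall>s. 0 < s \<and> s < d \<longrightarrow> right_quot v t s \<le> ereal (D + e) \<and> ereal (D - e) \<le> right_quot v t s
     \<and> left_quot v t s \<le> ereal (D + e) \<and> ereal (D - e) \<le> left_quot v t s" if e: "e > 0" for e
  proof -
    obtain d where d: "d > 0" "\<And>h. \<bar>h\<bar> < d \<Longrightarrow> \<exists>b. v (t + h) = ereal b \<and> \<bar>b - a - h * D\<bar> \<le> e * \<bar>h\<bar>"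
      using approx[OF e] by blast
    show ?thesis
    proof (rule exI[of _ d], intro conjI allI impI)
      fix s assume s: "0 < s \<and> s < d"
      obtain b where b: "v (t + s) = ereal b" "\<bar>b - a - s * D\<bar> \<le> e * s" using d(2)[of s] s by auto
      obtain b' where b': "v (t - s) = ereal b'" "\<bar>b' - a + s * D\<bar> \<le> e * s" using d(2)[of "- s"] s by auto
      show "right_quot v t s \<le> ereal (D + e)" "ereal (D - e) \<le> right_quot v t s"
          "left_quot v t s \<le> ereal (D + e)" "ereal (D - e) \<le> left_quot v t s"
        unfolding right_quot_def left_quot_def b(1) b'(1) f
        using b(2) b'(2) s by (auto simp: field_simps abs_le_iff)
    qed (rule d)
  qed
  show "right_slope v t = ereal D \<and> left_slope v t = ereal D"
  proof (intro conjI antisym)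
    show "right_slope v t \<le> ereal D"
    proof (rule ereal_le_epsilon2)
      fix e :: real assume "0 < e"
      then obtain d where d: "d > 0" "\<And>s. 0 < s \<Longrightarrow> s < d \<Longrightarrow> right_quot v t s \<le> ereal (D + e)" using small[of e] by blast
      have "right_slope v t \<le> right_quot v t (d/2)" by (rule right_slope_le[OF c f]) (use d in auto)
      also have "\<dots> \<le> ereal (D + e)" using d by auto
      finally show "right_slope v t \<le> ereal D + ereal e" by simp
    qed
    show "ereal D \<le> right_slope v t" unfolding right_slope_def
    proof (rule INF_greatest, rule ereal_le_epsilon2)
      fix k :: nat and e :: real assume "0 < e"
      then obtain d where d: "d > 0" "\<And>s. 0 < s \<Longrightarrow> s < d \<Longrightarrow> ereal (D - e) \<le> right_quot v t s" using small[of e] by blast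
      define s where "s = min (d/2) (1 / real (Suc k))"
      have "ereal (D - e) \<le> right_quot v t s" using d by (auto simp: s_def)
      also have "\<dots> \<le> right_quot v t (1 / real (Suc k))" by (rule right_quot_mono[OF c f]) (use d in \<open>auto simp: s_def\<close>)
      finally show "ereal D \<le> right_quot v t (1 / real (Suc k)) + ereal e"
        by (cases "right_quot v t (1 / real (Suc k))") auto
    qed
    show "left_slope v t \<le> ereal D" unfolding left_slope_def
    proof (rule SUP_least, rule ereal_le_epsilon2)
      fix k :: nat and e :: real assume "0 < e"
      then obtain d where d: "d > 0" "\<And>s. 0 < s \<Longrightarrow> s < d \<Longrightarrow> left_quot v t s \<le> ereal (D + e)" using small[of e] by blast
      define s where "s = min (d/2) (1 / real (Suc k))"
      have "left_quot v t (1 / real (Suc k)) \<le> left_quot v t s" by (rule left_quot_mono[OF c f]) (use d in \<open>auto simp: s_def\<close>)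
      also have "\<dots> \<le> ereal (D + e)" using d by (auto simp: s_def)
      finally show "left_quot v t (1 / real (Suc k)) \<le> ereal D + ereal e" by simp
    qed
    show "ereal D \<le> left_slope v t"
    proof (rule ereal_le_epsilon2)
      fix e :: real assume "0 < e"
      then obtain d where d: "d > 0" "\<And>s. 0 < s \<Longrightarrow> s < d \<Longrightarrow> ereal (D - e) \<le> left_quot v t s" using small[of e] by blast
      have "ereal (D - e) \<le> left_quot v t (d/2)" using d by auto
      also have "\<dots> \<le> left_slope v t" by (rule left_slope_ge[OF c f]) (use d in auto)
      finally show "ereal D \<le> left_slope v t + ereal e" by (cases "left_slope v t") auto
    qed
  qed
next
  assume R: "right_slope v t = ereal D \<and> left_slope v t = ereal D"
  have small: "\<exists>d>0. \<forall>s. 0 < s \<and> s < d \<longrightarrow> (\<exists>b. v (t + s) = ereal b \<and> \<bar>b - a - s * D\<bar> \<le> e * s)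
      \<and> (\<exists>b. v (t - s) = ereal b \<and> \<bar>b - a + s * D\<bar> \<le> e * s)" if e: "e > 0" for e
  proof -
    have "right_slope v t < ereal (D + e)" using R e by simp
    then obtain k where k: "right_quot v t (1 / real (Suc k)) < ereal (D + e)"
      unfolding right_slope_def INF_less_iff by blast
    have "ereal (D - e) < left_slope v t" using R e by simp
    then obtain l where l: "ereal (D - e) < left_quot v t (1 / real (Suc l))"
      unfolding left_slope_def less_SUP_iff by blast
    show ?thesis
    proof (rule exI[of _ "min (1 / real (Suc k)) (1 / real (Suc l))"], intro conjI allI impI)
      fix s assume s: "0 < s \<and> s < min (1 / real (Suc k)) (1 / real (Suc l))"
      have "right_quot v t s \<le> right_quot v t (1 / real (Suc k))" by (rule right_quot_mono[OF c f]) (use s in auto)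
      with k have 1: "right_quot v t s < ereal (D + e)" by auto
      then obtain b where b: "v (t + s) = ereal b" using s f ext_convex_not_MInfty[OF c, of "t + s"]
        by (cases "v (t + s)") (auto simp: right_quot_def)
      have 2: "ereal D \<le> right_quot v t s" using right_slope_le[OF c f, of s] R s by simp
      show "\<exists>b. v (t + s) = ereal b \<and> \<bar>b - a - s * D\<bar> \<le> e * s"
        using 1 2 s e b by (auto simp: right_quot_def f field_simps abs_le_iff)
      have "left_quot v t (1 / real (Suc l)) \<le> left_quot v t s" by (rule left_quot_mono[OF c f]) (use s in auto)
      with l have 1: "ereal (D - e) < left_quot v t s" by auto
      then obtain b where b: "v (t - s) = ereal b" using s f ext_convex_not_MInfty[OF c, of "t - s"]
        by (cases "v (t - s)") (auto simp: left_quot_def)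
      have 2: "left_quot v t s \<le> ereal D" using left_slope_ge[OF c f, of s] R s by simp
      show "\<exists>b. v (t - s) = ereal b \<and> \<bar>b - a + s * D\<bar> \<le> e * s"
        using 1 2 s e b by (auto simp: left_quot_def f field_simps abs_le_iff)
    qed auto
  qed
  show "has_ext_gradient v t D" unfolding has_ext_gradient_eps
  proof (rule exI[of _ a], intro conjI allI impI f)
    fix e :: real assume "e > 0"
    from small[OF this] obtain d where d: "d > 0" "\<And>s. 0 < s \<Longrightarrow> s < d \<Longrightarrow> (\<exists>b. v (t + s) = ereal b \<and> \<bar>b - a - s * D\<bar> \<le> e * s)"
      "\<And>s. 0 < s \<Longrightarrow> s < d \<Longrightarrow> (\<exists>b. v (t - s) = ereal b \<and> \<bar>b - a + s * D\<bar> \<le> e * s)" by blast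
    show "\<exists>d>0. \<forall>h. norm h < d \<longrightarrow> (\<exists>b. v (t + h) = ereal b \<and> \<bar>b - a - h \<bullet> D\<bar> \<le> e * norm h)"
    proof (rule exI[of _ d], intro conjI allI impI)
      fix h :: real assume h: "norm h < d"
      consider "h = 0" | "h > 0" | "h < 0" by linarith
      then show "\<exists>b. v (t + h) = ereal b \<and> \<bar>b - a - h \<bullet> D\<bar> \<le> e * norm h"
      proof cases
        case 1 then show ?thesis using f by simp
      next
        case 2 then show ?thesis using d(2)[of h] h by auto
      next
        case 3 then show ?thesis using d(3)[of "- h"] h by auto
      qed
    qed (rule d)
  qed
qed

lemma has_ext_gradient_unique: "has_ext_gradient V x D \<Longrightarrow> has_ext_gradient V x D' \<Longrightarrow> D = D'"
proof -
  assume "has_ext_gradient V x D" "has_ext_gradient V x D'"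
  then have "(\<lambda>h. h \<bullet> D) = (\<lambda>h. h \<bullet> D')"
    unfolding has_ext_gradient_def gderiv_def by (blast intro: has_derivative_unique)
  then have "(D - D') \<bullet> D = (D - D') \<bullet> D'" by metis
  then have "(D - D') \<bullet> (D - D') = 0" by (simp add: inner_diff_right)
  then show "D = D'" by simp
qed

lemma ext_gradient_eq: "has_ext_gradient V x D \<Longrightarrow> ext_gradient V x = D"
  unfolding ext_gradient_def by (auto intro!: the_equality dest: has_ext_gradient_unique)

definition ext_differentiable :: "('a::real_inner \<Rightarrow> ereal) \<Rightarrow> 'a \<Rightarrow> bool" where
  "ext_differentiable V x \<longleftrightarrow> (\<exists>D. has_ext_gradient V x D)"

lemma ext_differentiableD: "ext_differentiable V x \<Longrightarrow> has_ext_gradient V x (ext_gradient V x)"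
  unfolding ext_differentiable_def using ext_gradient_eq by blast

lemma ext_gradient_not_differentiable: "\<not> ext_differentiable V x \<Longrightarrow> ext_gradient V x = 0"
  by (auto simp: ext_differentiable_def ext_gradient_def)

lemma ext_differentiable_finite:
  assumes "ext_differentiable V x" shows "\<bar>V x\<bar> \<noteq> \<infinity>"
  using assms unfolding ext_differentiable_def has_ext_gradient_def by (auto dest: eventually_nhds_x_imp_x)

lemma ext_differentiable_iff_slopes:
  assumes c: "ext_convex v"
  shows "ext_differentiable v t \<longleftrightarrow> \<bar>v t\<bar> \<noteq> \<infinity> \<and> \<bar>right_slope v t\<bar> \<noteq> \<infinity> \<and> left_slope v t = right_slope v t"
proof
  assume d: "ext_differentiable v t"
  then obtain D where D: "has_ext_gradient v t D" by (auto simp: ext_differentiable_def)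
  obtain a where a: "v t = ereal a" using ext_differentiable_finite[OF d] by (cases "v t") auto
  show "\<bar>v t\<bar> \<noteq> \<infinity> \<and> \<bar>right_slope v t\<bar> \<noteq> \<infinity> \<and> left_slope v t = right_slope v t"
    using D unfolding has_ext_gradient_iff_slopes[OF c a] by (simp add: a)
next
  assume *: "\<bar>v t\<bar> \<noteq> \<infinity> \<and> \<bar>right_slope v t\<bar> \<noteq> \<infinity> \<and> left_slope v t = right_slope v t"
  obtain a where a: "v t = ereal a" using * by (cases "v t") auto
  obtain D where "right_slope v t = ereal D" using * by (cases "right_slope v t") auto
  then show "ext_differentiable v t" unfolding ext_differentiable_def using has_ext_gradient_iff_slopes[OF c a, of D] * by auto
qed

lemma ext_gradient_eq_slope:
  assumes c: "ext_convex v"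
  shows "ext_gradient v t = (if ext_differentiable v t then real_of_ereal (right_slope v t) else 0)"
proof (cases "ext_differentiable v t")
  case True
  obtain a where a: "v t = ereal a" using ext_differentiable_finite[OF True] by (cases "v t") auto
  show ?thesis using ext_differentiableD[OF True] has_ext_gradient_iff_slopes[OF c a] True by auto
qed (simp add: ext_gradient_not_differentiable)

text \<open>At an interior point of the domain without derivative, the slopes leave room for a rational
  number strictly between them, which is then the slope of a line that touches the graph at this
  point only. Hence each rational number serves at most one such point. The domain has at most two
  further points, its end points.\<close>

lemma ext_convex_countable_not_differentiable:
  fixes v :: "real \<Rightarrow> ereal"
  assumes c: "ext_convex v"
  shows "countable {t. v t \<noteq> \<infinity> \<and> \<not> ext_differentiable v t}"
proof -
  \<comment> \<open>\<open>A\<close> and \<open>B\<close> contain the right and the left end point of the domain, \<open>T q\<close> the points at which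
    the line of slope \<open>q\<close> supports the graph strictly.\<close>
  define A where "A = {t. v t \<noteq> \<infinity> \<and> (\<forall>s. v s \<noteq> \<infinity> \<longrightarrow> s \<le> t)}"
  define B where "B = {t. v t \<noteq> \<infinity> \<and> (\<forall>s. v s \<noteq> \<infinity> \<longrightarrow> t \<le> s)}"
  define T where "T q = {t. v t \<noteq> \<infinity> \<and> (\<forall>s. s \<noteq> t \<longrightarrow> v t + ereal (q * (s - t)) < v s)}" for q
  have sub: "{t. v t \<noteq> \<infinity> \<and> \<not> ext_differentiable v t} \<subseteq> A \<union> B \<union> (\<Union>q\<in>\<rat>. T q)"
  proof
    fix t assume "t \<in> {t. v t \<noteq> \<infinity> \<and> \<not> ext_differentiable v t}"
    then have t: "v t \<noteq> \<infinity>" and nd: "\<not> ext_differentiable v t" by auto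
    obtain a where a: "v t = ereal a" using t ext_convex_not_MInfty[OF c, of t] by (cases "v t") auto
    show "t \<in> A \<union> B \<union> (\<Union>q\<in>\<rat>. T q)"
    proof (rule ccontr)
      assume n: "t \<notin> A \<union> B \<union> (\<Union>q\<in>\<rat>. T q)"
      then obtain s1 s2 where s: "v s1 \<noteq> \<infinity>" "s1 < t" "v s2 \<noteq> \<infinity>" "t < s2"
        using t unfolding A_def B_def by (auto simp: not_le)
      have R: "right_slope v t \<noteq> \<infinity>"
      proof -
        have "right_quot v t (s2 - t) < \<infinity>" using s a by (cases "v s2") (auto simp: right_quot_def)
        with right_slope_le[OF c a, of "s2 - t"] s show ?thesis by auto
      qed
      have L: "left_slope v t \<noteq> -\<infinity>"
      proof -
        have "left_quot v t (t - s1) > -\<infinity>" using s a by (cases "v s1") (auto simp: left_quot_def)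
        with left_slope_ge[OF c a, of "t - s1"] s show ?thesis by auto
      qed
      have LR: "left_slope v t \<le> right_slope v t"
        unfolding left_slope_def right_slope_def
        by (intro SUP_least INF_greatest left_quot_le_right_quot[OF c a]) auto
      then have "left_slope v t < right_slope v t" using nd R L unfolding ext_differentiable_iff_slopes[OF c]
        by (auto simp: a order.strict_iff_order)
      then obtain q where q: "q \<in> \<rat>" "left_slope v t < ereal q" "ereal q < right_slope v t"
      proof -
        obtain x where x: "left_slope v t < ereal x" "ereal x < right_slope v t"
          using ereal_dense2[OF \<open>left_slope v t < right_slope v t\<close>] by blast
        obtain y where y: "ereal x < ereal y" "ereal y < right_slope v t"
          using ereal_dense2[OF x(2)] by blast
        then obtain q where q: "q \<in> \<rat>" "x < q" "q < y" using Rats_dense_in_real[of x y] by auto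
        have "ereal x < ereal q" "ereal q < ereal y" using q by auto
        then show ?thesis using x y q(1) by (intro that[of q]) (blast intro: order.strict_trans)+
      qed
      have "v t + ereal (q * (s - t)) < v s" if "s \<noteq> t" for s
      proof (cases "v s = \<infinity>")
        case True then show ?thesis by (simp add: a)
      next
        case False
        then obtain b where b: "v s = ereal b" using ext_convex_not_MInfty[OF c, of s] by (cases "v s") auto
        show ?thesis
        proof (cases "s > t")
          case True
          have "ereal q < right_quot v t (s - t)" using q(3) right_slope_le[OF c a, of "s - t"] True by (auto intro: less_le_trans)
          then show ?thesis using True by (simp add: right_quot_def a b field_simps)
        next
          case False
          have "left_quot v t (t - s) < ereal q" using q(2) left_slope_ge[OF c a, of "t - s"] False that by (auto intro: le_less_trans)
          then show ?thesis using False that by (simp add: left_quot_def a b field_simps)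
        qed
      qed
      then have "t \<in> T q" using t by (auto simp: T_def)
      then show False using n q by auto
    qed
  qed
  have sing: "countable S" if "\<And>x y. x \<in> S \<Longrightarrow> y \<in> S \<Longrightarrow> x = y" for S :: "real set"
  proof (cases "S = {}")
    case False
    then obtain x where "x \<in> S" by auto
    then have "S = {x}" using that by auto
    then show ?thesis by simp
  qed simp
  have "countable A" by (rule sing) (auto simp: A_def intro: antisym)
  moreover have "countable B" by (rule sing) (auto simp: B_def intro: antisym)
  moreover have "countable (T q)" for q
  proof (rule sing, rule ccontr)
    fix x y assume xy: "x \<in> T q" "y \<in> T q" "x \<noteq> y"
    then have "v x + ereal (q * (y - x)) < v y" "v y + ereal (q * (x - y)) < v x" by (auto simp: T_def)
    then show False using ext_convex_not_MInfty[OF c, of x] ext_convex_not_MInfty[OF c, of y] xy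
      by (cases "v x"; cases "v y") (auto simp: T_def algebra_simps)
  qed
  ultimately have "countable (A \<union> B \<union> (\<Union>q\<in>\<rat>. T q))" by (auto simp: countable_rat)
  then show ?thesis using sub by (rule countable_subset[rotated])
qed

lemma ext_convex_AE_differentiable:
  fixes v :: "real \<Rightarrow> ereal"
  assumes c: "ext_convex v"
  shows "AE t in lborel. v t \<noteq> \<infinity> \<longrightarrow> ext_differentiable v t"
  using AE_not_in[OF countable_imp_null_set_lborel[OF ext_convex_countable_not_differentiable[OF c]]]
  by eventually_elim auto

lemma measurable_right_slope:
  assumes [measurable]: "v \<in> borel_measurable borel"
  shows "right_slope v \<in> borel_measurable borel" "left_slope v \<in> borel_measurable borel"
  unfolding right_slope_def[abs_def] right_quot_def left_slope_def[abs_def] left_quot_def by measurable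

lemma measurable_ext_gradient_1D:
  fixes v :: "real \<Rightarrow> ereal"
  assumes c: "ext_convex v" and [measurable]: "v \<in> borel_measurable borel"
  shows "ext_gradient v \<in> borel_measurable borel"
proof -
  note [measurable] = measurable_right_slope[OF assms(2)]
  have "ext_gradient v = (\<lambda>t. if \<bar>v t\<bar> \<noteq> \<infinity> \<and> \<bar>right_slope v t\<bar> \<noteq> \<infinity> \<and> left_slope v t = right_slope v t
    then real_of_ereal (right_slope v t) else 0)"
    by (rule ext) (simp add: ext_gradient_eq_slope[OF c] ext_differentiable_iff_slopes[OF c])
  then show ?thesis by simp
qed

section \<open>Even convex functions on the line\<close>

text \<open>The fundamental theorem of calculus for Lipschitz functions. The difference quotients of \<open>g\<close>
  are bounded by the Lipschitz constant and converge almost everywhere to \<open>g'\<close>, while their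
  integrals over \<open>[a, b]\<close> are differences of mean values of the continuous function \<open>g\<close> near \<open>b\<close>
  and near \<open>a\<close>.\<close>

lemma nn_integral_derivative_lipschitz:
  fixes g g' :: "real \<Rightarrow> real"
  assumes lip: "\<And>x y. \<bar>g x - g y\<bar> \<le> L * \<bar>x - y\<bar>" and ab: "a \<le> b"
    and der: "AE t in lborel. a < t \<and> t < b \<longrightarrow> (g has_real_derivative g' t) (at t)"
    and [measurable]: "g' \<in> borel_measurable borel"
    and nonneg: "\<And>t. 0 \<le> g' t"
  shows "(\<integral>\<^sup>+t. ennreal (g' t) * indicator {a..b} t \<partial>lborel) = ennreal (g b - g a)"
proof -
  have L0: "0 \<le> L" using lip[of 0 1] by simp
  have cont: "continuous_on UNIV g"
  proof (rule continuous_onI)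
    fix x e :: real assume "0 < e"
    show "\<exists>d>0. \<forall>x'\<in>UNIV. dist x' x < d \<longrightarrow> dist (g x') (g x) \<le> e"
    proof (intro exI[of _ "e / (L + 1)"] conjI ballI impI)
      fix x' assume "dist x' x < e / (L + 1)"
      then have "(L + 1) * \<bar>x' - x\<bar> < e" using L0 by (simp add: dist_norm field_simps)
      moreover have "\<bar>g x' - g x\<bar> \<le> (L + 1) * \<bar>x' - x\<bar>" using lip[of x' x] by (simp add: distrib_right)
      ultimately show "dist (g x') (g x) \<le> e" by (simp add: dist_norm)
    qed (use L0 \<open>0 < e\<close> in auto)
  qed
  have [measurable]: "g \<in> borel_measurable borel" by (rule borel_measurable_continuous_onI[OF cont])
  \<comment> \<open>The interval is enlarged so that all shifts \<open>x + h k\<close> with \<open>h k \<le> 1\<close> stay inside.\<close>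
  obtain G where G: "\<And>x. x \<in> {a - 1..b + 2} \<Longrightarrow> (G has_vector_derivative g x) (at x within {a - 1..b + 2})"
    using antiderivative_continuous[of "a - 1" "b + 2" g] continuous_on_subset[OF cont] by blast
  have DG: "(G has_real_derivative g x) (at x)" if "a - 1 < x" "x < b + 2" for x
    using G[of x] that at_within_Icc_at[of "a - 1" x "b + 2"]
    by (simp add: has_real_derivative_iff_has_vector_derivative)
  define h where "h k = 1 / real (Suc k)" for k
  have h: "0 < h k" "h k \<le> 1" for k by (auto simp: h_def)
  have hlim: "h \<longlonglongrightarrow> 0" unfolding h_def using LIMSEQ_inverse_real_of_nat by (simp add: inverse_eq_divide)
  define Q where "Q k x = (g (x + h k) - g x) / h k" for k x
  have [measurable]: "Q k \<in> borel_measurable borel" for k unfolding Q_def by measurable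
  have Qint: "(\<integral>x. indicator {a..b} x *\<^sub>R Q k x \<partial>lborel) = (G (b + h k) - G b) / h k - (G (a + h k) - G a) / h k" for k
  proof -
    have "(\<integral>x. indicator {a..b} x *\<^sub>R Q k x \<partial>lborel)
       = (G (b + h k) - G b) / h k - (G (a + h k) - G a) / h k"
    proof (rule integral_FTC_atLeastAtMost[OF ab])
      fix x assume x: "a \<le> x" "x \<le> b"
      have "((\<lambda>x. (G (x + h k) - G x) / h k) has_real_derivative (g (x + h k) * 1 - g x) / h k) (at x)"
        by (intro DERIV_cdivide DERIV_diff DERIV_chain2[of G] DG derivative_eq_intros) (use x h[of k] in auto)
      then show "((\<lambda>x. (G (x + h k) - G x) / h k) has_vector_derivative Q k x) (at x within {a..b})"
        by (simp add: Q_def has_real_derivative_iff_has_vector_derivative has_vector_derivative_at_within)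
    next
      show "continuous_on {a..b} (Q k)" unfolding Q_def
        by (intro continuous_intros continuous_on_compose2[OF cont]) (use h[of k] in auto)
    qed
    then show ?thesis .
  qed
  have Glim: "(\<lambda>k. (G (x + h k) - G x) / h k) \<longlonglongrightarrow> g x" if "a \<le> x" "x \<le> b" for x
  proof -
    have "((\<lambda>y. (G (x + y) - G x) / y) \<longlongrightarrow> g x) (at 0)"
      using DG[of x] that by (simp add: DERIV_def)
    moreover have "filterlim h (at 0) sequentially"
      using hlim h by (auto simp: filterlim_at less_imp_neq[symmetric])
    ultimately show ?thesis by (rule filterlim_compose)
  qed
  have AEQ: "AE x in lborel. (\<lambda>k. indicator {a..b} x *\<^sub>R Q k x) \<longlonglongrightarrow> indicator {a..b} x *\<^sub>R g' x"
    using der AE_lborel_singleton[of a] AE_lborel_singleton[of b]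
  proof eventually_elim
    case (elim x)
    show ?case
    proof (cases "x \<in> {a..b}")
      case True
      then have "((\<lambda>y. (g (x + y) - g x) / y) \<longlongrightarrow> g' x) (at 0)" using elim by (auto simp: DERIV_def)
      moreover have "filterlim h (at 0) sequentially"
        using hlim h by (auto simp: filterlim_at less_imp_neq[symmetric])
      ultimately have "(\<lambda>k. (g (x + h k) - g x) / h k) \<longlonglongrightarrow> g' x" by (rule filterlim_compose)
      then show ?thesis using True by (simp add: Q_def)
    qed simp
  qed
  have Qb: "norm (indicator {a..b} x *\<^sub>R Q k x) \<le> indicator {a..b} x * L" for k x
  proof -
    have "\<bar>g (x + h k) - g x\<bar> \<le> L * h k" using lip[of "x + h k" x] h[of k] by simp
    then have "\<bar>Q k x\<bar> \<le> L" using h[of k] by (simp add: Q_def abs_div field_simps)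
    then show ?thesis by (auto simp: indicator_def)
  qed
  have intw: "integrable lborel (\<lambda>x. indicator {a..b} x * L)" by (intro integrable_mult_left) (simp add: emeasure_lborel_Icc_eq)
  have lim: "(\<lambda>k. \<integral>x. indicator {a..b} x *\<^sub>R Q k x \<partial>lborel) \<longlonglongrightarrow> (\<integral>x. indicator {a..b} x *\<^sub>R g' x \<partial>lborel)"
    by (rule integral_dominated_convergence[OF _ _ intw AEQ]) (use Qb in auto)
  have int: "integrable lborel (\<lambda>x. indicator {a..b} x *\<^sub>R g' x)"
    by (rule integrable_dominated_convergence[OF _ _ intw AEQ]) (use Qb in auto)
  have "(\<integral>x. indicator {a..b} x *\<^sub>R g' x \<partial>lborel) = g b - g a"
  proof (rule LIMSEQ_unique[OF lim])
    show "(\<lambda>k. \<integral>x. indicator {a..b} x *\<^sub>R Q k x \<partial>lborel) \<longlonglongrightarrow> g b - g a"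
      unfolding Qint by (intro tendsto_diff Glim) (use ab in auto)
  qed
  moreover have "(\<integral>\<^sup>+t. ennreal (indicator {a..b} t *\<^sub>R g' t) \<partial>lborel) = ennreal (\<integral>x. indicator {a..b} x *\<^sub>R g' x \<partial>lborel)"
    by (rule nn_integral_eq_integral[OF int]) (simp add: nonneg)
  moreover have "ennreal (indicator {a..b} t *\<^sub>R g' t) = ennreal (g' t) * indicator {a..b} t" for t
    by (simp add: indicator_def)
  ultimately show ?thesis by simp
qed

lemma even_convex_mono:
  fixes v :: "real \<Rightarrow> ereal"
  assumes c: "ext_convex v" and even: "\<And>t. v (- t) = v t" and xy: "\<bar>x\<bar> \<le> \<bar>y\<bar>"
  shows "v x \<le> v y"
proof (cases "v y = \<infinity> \<or> y = 0")
  case True then show ?thesis using xy by auto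
next
  case False
  then obtain a where a: "v y = ereal a" using ext_convex_not_MInfty[OF c, of y] by (cases "v y") auto
  have a': "v (- \<bar>y\<bar>) = ereal a" "v \<bar>y\<bar> = ereal a" using a even[of y] by (auto simp: abs_if)
  have "v x \<le> ereal (a + (x - (- \<bar>y\<bar>)) / (\<bar>y\<bar> - (- \<bar>y\<bar>)) * (a - a))"
    by (rule ext_convex_le_real_1D[OF c]) (use a' xy False in auto)
  then show ?thesis by (simp add: a)
qed

lemma ext_gradient_reflect:
  fixes v :: "real \<Rightarrow> ereal"
  assumes even: "\<And>t. v (- t) = v t"
  shows "ext_gradient v (- t) = - ext_gradient v t"
proof -
  have *: "has_ext_gradient v (- t) (- D)" if D: "has_ext_gradient v t D" for t D
  proof -
    obtain a where a: "v t = ereal a" and approx: "\<And>e. e > 0 \<Longrightarrow> \<exists>d>0. \<forall>h. \<bar>h\<bar> < d \<longrightarrow>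
        (\<exists>b. v (t + h) = ereal b \<and> \<bar>b - a - h * D\<bar> \<le> e * \<bar>h\<bar>)"
      using D unfolding has_ext_gradient_eps by auto
    show ?thesis unfolding has_ext_gradient_eps
    proof (rule exI[of _ a], intro conjI allI impI)
      fix e :: real assume "e > 0"
      from approx[OF this] obtain d where d: "d > 0"
        "\<And>h. \<bar>h\<bar> < d \<Longrightarrow> \<exists>b. v (t + h) = ereal b \<and> \<bar>b - a - h * D\<bar> \<le> e * \<bar>h\<bar>" by blast
      show "\<exists>d>0. \<forall>h. norm h < d \<longrightarrow> (\<exists>b. v (- t + h) = ereal b \<and> \<bar>b - a - h \<bullet> - D\<bar> \<le> e * norm h)"
      proof (rule exI[of _ d], intro conjI allI impI)
        fix h :: real assume "norm h < d"
        then obtain b where b: "v (t + - h) = ereal b" "\<bar>b - a - (- h) * D\<bar> \<le> e * \<bar>- h\<bar>"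
          using d(2)[of "- h"] by auto
        have "v (- t + h) = ereal b" using b(1) even[of "t + - h"] by (simp only: minus_add_distrib minus_minus)
        then show "\<exists>b. v (- t + h) = ereal b \<and> \<bar>b - a - h \<bullet> - D\<bar> \<le> e * norm h"
          using b(2) by simp
      qed (rule d)
    qed (simp add: even a)
  qed
  show ?thesis
  proof (cases "ext_differentiable v t")
    case True
    then show ?thesis using ext_gradient_eq[OF *[OF ext_differentiableD]] by simp
  next
    case False
    moreover have "\<not> ext_differentiable v (- t)" using False *[of "- t"] unfolding ext_differentiable_def by auto
    ultimately show ?thesis by (simp add: ext_gradient_not_differentiable)
  qed
qed

lemma even_convex_gradient_nonneg:
  fixes v :: "real \<Rightarrow> ereal"
  assumes c: "ext_convex v" and even: "\<And>t. v (- t) = v t" and t: "0 \<le> t"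
  shows "0 \<le> ext_gradient v t"
proof (cases "ext_differentiable v t")
  case True
  obtain a where a: "v t = ereal a" using ext_differentiable_finite[OF True] by (cases "v t") auto
  have "ereal (ext_gradient v t) = right_slope v t"
    using ext_differentiableD[OF True] has_ext_gradient_iff_slopes[OF c a] by auto
  also have "\<dots> \<ge> 0" unfolding right_slope_def right_quot_def
  proof (rule INF_greatest)
    fix k :: nat
    have "v t \<le> v (t + 1 / real (Suc k))" by (rule even_convex_mono[OF c even]) (use t in auto)
    then have "0 \<le> v (t + 1 / real (Suc k)) - v t" using a by (simp add: ereal_diff_positive)
    then show "0 \<le> ereal (1 / (1 / real (Suc k))) * (v (t + 1 / real (Suc k)) - v t)"
      by (intro ereal_0_le_mult) auto
  qed
  finally show ?thesis by simp
qed (simp add: ext_gradient_not_differentiable)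

lemma measurable_exp_neg [measurable]: "exp_neg \<in> borel_measurable borel"
  unfolding exp_neg_def[abs_def] by measurable

lemma exp_neg_antimono: "a \<noteq> -\<infinity> \<Longrightarrow> a \<le> b \<Longrightarrow> exp_neg b \<le> exp_neg a"
  by (cases a; cases b) (auto simp: exp_neg_def ennreal_leI)

lemma exp_neg_ereal [simp]: "exp_neg (ereal r) = ennreal (exp (- r))"
  by (simp add: exp_neg_def)

lemma exp_neg_PInf [simp]: "exp_neg \<infinity> = 0"
  by (simp add: exp_neg_def)

text \<open>Up to a point \<open>r\<close> in the interior of the domain a convex function is Lipschitz, hence so is
  \<open>e\<^sup>-\<^sup>v\<close>, whose derivative is \<open>- v' e\<^sup>-\<^sup>v\<close>, of constant sign on either side of 0.\<close>

lemma even_convex_FTC: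
  fixes v :: "real \<Rightarrow> ereal"
  assumes c: "ext_convex v" and [measurable]: "v \<in> borel_measurable borel" and even: "\<And>t. v (- t) = v t"
    and sr: "0 \<le> s" "s \<le> r" "r < r'" "v r' \<noteq> \<infinity>"
  shows "exp_neg (v s) = exp_neg (v r) + (\<integral>\<^sup>+t. ennreal \<bar>ext_gradient v t\<bar> * exp_neg (v t) * indicator {s..r} t \<partial>lborel)"
proof -
  note [measurable] = measurable_ext_gradient_1D[OF c assms(2)]
  define u where "u t = real_of_ereal (v t)" for t
  have v: "v t = ereal (u t)" if "\<bar>t\<bar> \<le> r'" for t
  proof -
    have "v t \<le> v r'" by (rule even_convex_mono[OF c even]) (use that in auto)
    then have "v t \<noteq> \<infinity>" using sr by auto
    then show ?thesis using ext_convex_not_MInfty[OF c, of t] by (cases "v t") (auto simp: u_def)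
  qed
  have mono: "u x \<le> u y" if "\<bar>x\<bar> \<le> \<bar>y\<bar>" "\<bar>y\<bar> \<le> r'" for x y
    using even_convex_mono[OF c even that(1)] v[of x] v[of y] that by simp
  \<comment> \<open>For \<open>x\<close> in \<open>[0, r]\<close> a chord starting at \<open>x\<close> is at most as steep as the one that ends at \<open>r'\<close>;
    there the numerator is at most \<open>u r' - u 0\<close> by monotonicity and the denominator is at least
    \<open>r' - r\<close>.\<close>
  define K where "K = (u r' - u 0) / (r' - r)"
  have K0: "0 \<le> K" unfolding K_def using mono[of 0 r'] sr by (auto intro!: divide_nonneg_pos)
  have lipu: "u y - u x \<le> K * (y - x)" if xy: "0 \<le> x" "x \<le> y" "y \<le> r" for x y
  proof -
    have "v y \<le> ereal (u x + (y - x) / (r' - x) * (u r' - u x))"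
      by (rule ext_convex_le_real_1D[OF c]) (use xy sr v[of x] v[of r'] in auto)
    then have "u y - u x \<le> (y - x) / (r' - x) * (u r' - u x)" using v[of y] xy sr by simp
    also have "\<dots> \<le> (y - x) / (r' - r) * (u r' - u 0)"
      using xy sr mono[of 0 x] mono[of x r'] by (intro mult_mono divide_left_mono mult_pos_pos) auto
    also have "\<dots> = K * (y - x)" by (simp add: K_def)
    finally show ?thesis .
  qed
  \<comment> \<open>Clamping the argument to \<open>[s, r]\<close> gives a function that is Lipschitz on the whole line.\<close>
  define cl where "cl t = max s (min r t)" for t
  have cl: "s \<le> cl t" "cl t \<le> r" for t using sr by (auto simp: cl_def)
  define g where "g t = - exp (- u (cl t))" for t
  define L where "L = exp (- u 0) * K"
  have lip1: "g y - g x \<le> L * (y - x)" "0 \<le> g y - g x" if xy: "x \<le> y" for x y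
  proof -
    have clxy: "cl x \<le> cl y" "cl y - cl x \<le> y - x" using xy sr by (auto simp: cl_def min_def max_def)
    have m: "u (cl x) \<le> u (cl y)" using mono[of "cl x" "cl y"] clxy cl[of x] cl[of y] sr by simp
    then show "0 \<le> g y - g x" by (simp add: g_def)
    have "g y - g x = exp (- u (cl x)) * (1 - exp (- (u (cl y) - u (cl x))))"
      by (simp add: g_def right_diff_distrib exp_add[symmetric])
    also have "\<dots> \<le> exp (- u 0) * (u (cl y) - u (cl x))"
    proof (rule mult_mono)
      show "exp (- u (cl x)) \<le> exp (- u 0)" using mono[of 0 "cl x"] cl[of x] sr by simp
      show "1 - exp (- (u (cl y) - u (cl x))) \<le> u (cl y) - u (cl x)"
        using exp_ge_add_one_self[of "- (u (cl y) - u (cl x))"] by linarith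
    qed (use m in auto)
    also have "\<dots> \<le> exp (- u 0) * (K * (y - x))"
    proof (rule mult_left_mono)
      have "u (cl y) - u (cl x) \<le> K * (cl y - cl x)" using lipu[of "cl x" "cl y"] clxy cl[of x] cl[of y] sr by simp
      also have "\<dots> \<le> K * (y - x)" using clxy K0 by (intro mult_left_mono) auto
      finally show "u (cl y) - u (cl x) \<le> K * (y - x)" .
    qed simp
    finally show "g y - g x \<le> L * (y - x)" by (simp add: L_def mult.assoc)
  qed
  have lip: "\<bar>g x - g y\<bar> \<le> L * \<bar>x - y\<bar>" for x y
    using lip1[of x y] lip1[of y x] by (cases "x \<le> y") auto
  define g' where "g' t = \<bar>ext_gradient v t\<bar> * exp (- u t)" for t
  have der: "AE t in lborel. s < t \<and> t < r \<longrightarrow> (g has_real_derivative g' t) (at t)"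
    using ext_convex_AE_differentiable[OF c]
  proof (eventually_elim, intro impI)
    fix t assume d: "v t \<noteq> \<infinity> \<longrightarrow> ext_differentiable v t" and t: "s < t \<and> t < r"
    have "ext_differentiable v t" using d v[of t] t sr by auto
    from ext_differentiableD[OF this] have "(u has_derivative (\<lambda>h. h \<bullet> ext_gradient v t)) (at t)"
      unfolding has_ext_gradient_def gderiv_def u_def by blast
    then have "(u has_real_derivative ext_gradient v t) (at t)"
      by (simp add: has_field_derivative_def mult_commute_abs)
    then have "((\<lambda>t. - exp (- u t)) has_real_derivative ext_gradient v t * exp (- u t)) (at t)"
      by (auto intro!: derivative_eq_intros)
    moreover have "\<bar>ext_gradient v t\<bar> = ext_gradient v t"
      using even_convex_gradient_nonneg[OF c even, of t] t sr by simp
    moreover have "\<forall>\<^sub>F x in nhds t. - exp (- u x) = g x"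
    proof (rule eventually_nhds_in_open[THEN eventually_mono])
      show "open {s<..<r}" "t \<in> {s<..<r}" using t by auto
    qed (auto simp: g_def cl_def)
    ultimately show "(g has_real_derivative g' t) (at t)"
      unfolding g'_def by (simp add: DERIV_cong_ev)
  qed
  have [measurable]: "u \<in> borel_measurable borel" unfolding u_def[abs_def] by measurable
  have [measurable]: "g' \<in> borel_measurable borel" unfolding g'_def[abs_def] by measurable
  have "(\<integral>\<^sup>+t. ennreal (g' t) * indicator {s..r} t \<partial>lborel) = ennreal (g r - g s)"
    by (rule nn_integral_derivative_lipschitz[OF lip sr(2) der]) (auto simp: g'_def)
  also have "(\<integral>\<^sup>+t. ennreal (g' t) * indicator {s..r} t \<partial>lborel)
     = (\<integral>\<^sup>+t. ennreal \<bar>ext_gradient v t\<bar> * exp_neg (v t) * indicator {s..r} t \<partial>lborel)"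
    by (rule nn_integral_cong) (use v sr in \<open>auto simp: indicator_def g'_def ennreal_mult'\<close>)
  finally have "(\<integral>\<^sup>+t. ennreal \<bar>ext_gradient v t\<bar> * exp_neg (v t) * indicator {s..r} t \<partial>lborel)
     = ennreal (exp (- u s) - exp (- u r))" using sr by (simp add: g_def cl_def)
  moreover have "exp (- u r) \<le> exp (- u s)" using mono[of s r] sr by simp
  ultimately show ?thesis using v[of s] v[of r] sr by (simp add: ennreal_plus[symmetric] del: ennreal_plus)
qed

lemma AE_ex_Ioo:
  assumes "AE t in lborel. P (t::real)" "a < b"
  shows "\<exists>t. a < t \<and> t < b \<and> P t"
proof (rule ccontr)
  assume "\<not> (\<exists>t. a < t \<and> t < b \<and> P t)"
  then have "AE t in lborel. t \<notin> {a<..<b}" using assms(1) by (auto elim!: eventually_mono)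
  then have "{a<..<b} \<in> null_sets lborel" by (simp add: AE_iff_null_sets)
  then show False using assms(2) by (simp add: null_sets_def)
qed

text \<open>The absolute derivative of \<open>e\<^sup>-\<^sup>v\<close>.\<close>

definition line_grad :: "(real \<Rightarrow> ereal) \<Rightarrow> real \<Rightarrow> ennreal" where
  "line_grad v t = ennreal \<bar>ext_gradient v t\<bar> * exp_neg (v t)"

text \<open>Let the upper limit in the fundamental theorem of calculus increase to the end of the
  domain. Equality may fail: \<open>e\<^sup>-\<^sup>v\<close> can drop to 0 by a jump there.\<close>

lemma line_grad_tail_le:
  fixes v :: "real \<Rightarrow> ereal"
  assumes c: "ext_convex v" and [measurable]: "v \<in> borel_measurable borel" and even: "\<And>t. v (- t) = v t"
    and s: "0 \<le> s"
  shows "(\<integral>\<^sup>+t. line_grad v t * indicator {s<..} t \<partial>lborel) \<le> exp_neg (v s)"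
proof -
  note [measurable] = measurable_ext_gradient_1D[OF c assms(2)]
  have [measurable]: "line_grad v \<in> borel_measurable borel" unfolding line_grad_def[abs_def] by measurable
  define b where "b = Sup (ereal ` {t. v t \<noteq> \<infinity>})"
  have b: "ereal t < b \<longleftrightarrow> (\<exists>r'>t. v r' \<noteq> \<infinity>)" for t unfolding b_def less_Sup_iff by auto
  have zero: "line_grad v t = 0" if "\<not> ereal t < b" for t
  proof (cases "ext_differentiable v t")
    case True
    then obtain d where "d > 0" "\<And>y. dist y t < d \<Longrightarrow> \<bar>v y\<bar> \<noteq> \<infinity>"
      unfolding ext_differentiable_def has_ext_gradient_def eventually_nhds_metric by blast
    from this(1) this(2)[of "t + d/2"] have "\<exists>r'>t. v r' \<noteq> \<infinity>"
      by (intro exI[of _ "t + d/2"]) (auto simp: dist_norm)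
    then show ?thesis using that b by simp
  qed (simp add: line_grad_def ext_gradient_not_differentiable)
  show ?thesis
  proof (cases "ereal s < b")
    case False
    have z: "line_grad v t * indicator {s<..} t = 0" for t
    proof (cases "t > s")
      case True
      then have "\<not> ereal t < b" using False by (metis ereal_less_eq(3) less_eq_real_def order.strict_trans1)
      then show ?thesis using zero by simp
    qed (simp add: indicator_def)
    show ?thesis unfolding z by simp
  next
    case True
    obtain X where X: "incseq X" "\<And>i. ereal s < ereal (X i)" "\<And>i. ereal (X i) < b" "(\<lambda>i. ereal (X i)) \<longlonglongrightarrow> b"
    proof (rule ereal_incseq_approx[OF True])
      fix X :: "nat \<Rightarrow> real"
      assume "incseq X" "\<And>i. ereal s < ereal (X i)" "\<And>i. ereal (X i) < b" "(\<lambda>i. ereal (X i)) \<longlonglongrightarrow> b"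
      then show thesis by (rule that)
    qed
    have "(\<integral>\<^sup>+t. line_grad v t * indicator {s<..} t \<partial>lborel)
        = (\<integral>\<^sup>+t. (SUP i. line_grad v t * indicator {s..X i} t) \<partial>lborel)"
    proof (rule nn_integral_cong_AE)
      show "AE t in lborel. line_grad v t * indicator {s<..} t = (SUP i. line_grad v t * indicator {s..X i} t)"
        using AE_lborel_singleton[of s]
      proof eventually_elim
        case (elim t)
        show ?case
        proof (cases "s < t \<and> ereal t < b")
          case False then show ?thesis using elim zero[of t] by (auto simp: indicator_def)
        next
          case True
          have "\<forall>\<^sub>F i in sequentially. ereal t < X i" by (rule order_tendstoD(1)[OF X(4)]) (use True in auto)
          then obtain i where i: "t < X i" by (auto simp: eventually_sequentially)
          have "(SUP i. line_grad v t * indicator {s..X i} t) = line_grad v t"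
          proof (rule antisym)
            show "(SUP i. line_grad v t * indicator {s..X i} t) \<le> line_grad v t"
              by (rule SUP_least) (auto simp: indicator_def)
            have "line_grad v t = line_grad v t * indicator {s..X i} t" using i True by simp
            also have "\<dots> \<le> (SUP i. line_grad v t * indicator {s..X i} t)" by (rule SUP_upper) simp
            finally show "line_grad v t \<le> (SUP i. line_grad v t * indicator {s..X i} t)" .
          qed
          then show ?thesis using True by simp
        qed
      qed
    qed
    also have "\<dots> = (SUP i. \<integral>\<^sup>+t. line_grad v t * indicator {s..X i} t \<partial>lborel)"
    proof (rule nn_integral_monotone_convergence_SUP)
      show "incseq (\<lambda>i t. line_grad v t * indicator {s..X i} t)"
        using X(1) by (auto simp: incseq_def le_fun_def indicator_def intro: order_trans)
    qed measurable
    also have "\<dots> \<le> exp_neg (v s)"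
    proof (rule SUP_least)
      fix i
      obtain r' where r': "r' > X i" "v r' \<noteq> \<infinity>" using X(3)[of i] b by auto
      show "(\<integral>\<^sup>+t. line_grad v t * indicator {s..X i} t \<partial>lborel) \<le> exp_neg (v s)"
        using even_convex_FTC[OF c assms(2) even s _ r'] X(2)[of i] by (simp add: line_grad_def)
    qed
    finally show ?thesis .
  qed
qed

lemma line_grad_even:
  assumes even: "\<And>t. v (- t) = v t"
  shows "line_grad v (- t) = line_grad v t"
  by (simp add: line_grad_def ext_gradient_reflect[where v=v, OF even] even)

lemma nn_integral_even:
  assumes [measurable]: "F \<in> borel_measurable borel" and even: "\<And>t::real. F (- t) = F t"
  shows "(\<integral>\<^sup>+t. F t \<partial>lborel) = 2 * (\<integral>\<^sup>+t. F t * indicator {0<..} t \<partial>lborel)"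
proof -
  have "(\<integral>\<^sup>+t. F t * indicator {..<0} t \<partial>lborel) = (\<integral>\<^sup>+t. F t * indicator {..<0} t \<partial>(distr lborel borel uminus))"
    by (simp add: lborel_distr_uminus)
  also have "\<dots> = (\<integral>\<^sup>+t. F t * indicator {0<..} t \<partial>lborel)"
    by (subst nn_integral_distr) (auto simp: even indicator_def intro!: nn_integral_cong)
  finally have neg: "(\<integral>\<^sup>+t. F t * indicator {..<0} t \<partial>lborel) = (\<integral>\<^sup>+t. F t * indicator {0<..} t \<partial>lborel)" .
  have "(\<integral>\<^sup>+t. F t \<partial>lborel) = (\<integral>\<^sup>+t. F t * indicator {..<0} t + F t * indicator {0<..} t \<partial>lborel)"
    by (rule nn_integral_cong_AE) (use AE_lborel_singleton[of 0] in eventually_elim, auto simp: indicator_def)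
  also have "\<dots> = (\<integral>\<^sup>+t. F t * indicator {..<0} t \<partial>lborel) + (\<integral>\<^sup>+t. F t * indicator {0<..} t \<partial>lborel)"
    by (rule nn_integral_add) auto
  finally show ?thesis by (simp add: neg mult_2)
qed

text \<open>This replaces the integration by parts \<open>\<integral> t v' e\<^sup>-\<^sup>v dt = \<integral> e\<^sup>-\<^sup>v dt\<close>, which fails in the
  presence of jumps. Write \<open>|t|\<close> as the measure of \<open>{0<..<t}\<close>, exchange the integrals and use the
  tail bound.\<close>

lemma line_grad_moment:
  fixes v :: "real \<Rightarrow> ereal"
  assumes c: "ext_convex v" and [measurable]: "v \<in> borel_measurable borel" and even: "\<And>t. v (- t) = v t"
  shows "(\<integral>\<^sup>+t. ennreal \<bar>t\<bar> * line_grad v t \<partial>lborel) \<le> (\<integral>\<^sup>+t. exp_neg (v t) \<partial>lborel)"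
proof -
  note [measurable] = measurable_ext_gradient_1D[OF c assms(2)]
  have [measurable]: "line_grad v \<in> borel_measurable borel" unfolding line_grad_def[abs_def] by measurable
  have "(\<integral>\<^sup>+t. ennreal \<bar>t\<bar> * line_grad v t * indicator {0<..} t \<partial>lborel)
     = (\<integral>\<^sup>+t. (\<integral>\<^sup>+s. line_grad v t * indicator {s<..} t * indicator {0<..} s \<partial>lborel) \<partial>lborel)"
  proof (rule nn_integral_cong)
    fix t :: real
    have "(\<integral>\<^sup>+s. line_grad v t * indicator {s<..} t * indicator {0<..} s \<partial>lborel)
       = (\<integral>\<^sup>+s. line_grad v t * indicator {0<..<t} s \<partial>lborel)"
      by (rule nn_integral_cong) (auto simp: indicator_def)
    also have "\<dots> = line_grad v t * emeasure lborel {0<..<t}" by (rule nn_integral_cmult_indicator) auto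
    also have "\<dots> = ennreal \<bar>t\<bar> * line_grad v t * indicator {0<..} t"
      by (cases "t > 0") (auto simp: mult.commute)
    finally show "ennreal \<bar>t\<bar> * line_grad v t * indicator {0<..} t
      = (\<integral>\<^sup>+s. line_grad v t * indicator {s<..} t * indicator {0<..} s \<partial>lborel)" by simp
  qed
  also have "\<dots> = (\<integral>\<^sup>+s. (\<integral>\<^sup>+t. line_grad v t * indicator {s<..} t * indicator {0<..} s \<partial>lborel) \<partial>lborel)"
  proof (rule lborel_pair.Fubini')
    have "(\<lambda>(s, t). line_grad v t * indicator {p. fst p < snd p} (s, t) * indicator {0<..} s) \<in> borel_measurable (lborel \<Otimes>\<^sub>M lborel)"
      by measurable
    then show "(\<lambda>(s, t). line_grad v t * indicator {s<..} t * indicator {0<..} s) \<in> borel_measurable (lborel \<Otimes>\<^sub>M lborel)"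
      by (simp add: indicator_def)
  qed
  also have "\<dots> \<le> (\<integral>\<^sup>+s. exp_neg (v s) * indicator {0<..} s \<partial>lborel)"
  proof (rule nn_integral_mono)
    fix s :: real
    show "(\<integral>\<^sup>+t. line_grad v t * indicator {s<..} t * indicator {0<..} s \<partial>lborel) \<le> exp_neg (v s) * indicator {0<..} s"
      using line_grad_tail_le[OF c assms(2) even, of s] by (cases "s > 0") auto
  qed
  finally have "(\<integral>\<^sup>+t. ennreal \<bar>t\<bar> * line_grad v t * indicator {0<..} t \<partial>lborel) \<le> (\<integral>\<^sup>+s. exp_neg (v s) * indicator {0<..} s \<partial>lborel)" .
  then show ?thesis
    by (subst (1 2) nn_integral_even) (auto simp: line_grad_even[where v=v, OF even] even intro!: mult_left_mono)
qed

text \<open>If \<open>e\<^sup>-\<^sup>v\<close> agrees almost everywhere with a continuous function, it has no jump at the end of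
  its domain, and then it comes arbitrarily close to 0 inside the domain: at the end of a bounded
  domain by continuity, on an unbounded one because it is integrable and nonincreasing on the
  positive half-line. So its value at \<open>\<bar>s\<bar>\<close> is bounded by its variation on the positive half-line.
  The point 0 is excluded because \<open>v\<close> could be finite there only.\<close>

lemma line_grad_ge:
  fixes v :: "real \<Rightarrow> ereal"
  assumes c: "ext_convex v" and [measurable]: "v \<in> borel_measurable borel" and even: "\<And>t. v (- t) = v t"
    and fin: "(\<integral>\<^sup>+t. exp_neg (v t) \<partial>lborel) < \<infinity>"
    and h: "continuous_on UNIV h" "AE t in lborel. exp_neg (v t) = ennreal (h t)" "\<And>t. 0 \<le> h t"
    and s: "s \<noteq> 0"
  shows "2 * exp_neg (v s) \<le> (\<integral>\<^sup>+t. line_grad v t \<partial>lborel)"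
proof -
  note [measurable] = measurable_ext_gradient_1D[OF c assms(2)]
  have [measurable]: "line_grad v \<in> borel_measurable borel" unfolding line_grad_def[abs_def] by measurable
  define F where "F t = exp_neg (v t)" for t
  have Fmono: "F y \<le> F x" if "\<bar>x\<bar> \<le> \<bar>y\<bar>" for x y
    unfolding F_def by (rule exp_neg_antimono[OF ext_convex_not_MInfty[OF c] even_convex_mono[OF c even that]])
  have main: "F \<bar>s\<bar> \<le> (\<integral>\<^sup>+t. line_grad v t * indicator {0<..} t \<partial>lborel) + ennreal e" if e: "e > 0" for e
  proof (cases "F \<bar>s\<bar> \<le> ennreal e")
    case True then show ?thesis by (metis add.commute add_increasing2 zero_le)
  next
    case False
    \<comment> \<open>A point of the interior of the domain, beyond \<open>\<bar>s\<bar>\<close>, at which \<open>e\<^sup>-\<^sup>v\<close> is at most \<open>e\<close>.\<close>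
    have "\<exists>r. \<bar>s\<bar> \<le> r \<and> (\<exists>r'>r. v r' \<noteq> \<infinity>) \<and> F r \<le> ennreal e"
    proof (rule ccontr)
      assume n: "\<not> ?thesis"
      then have big: "F r > ennreal e" if "0 < r" "\<exists>r'>r. v r' \<noteq> \<infinity>" for r
      proof (cases "\<bar>s\<bar> \<le> r")
        case True then show ?thesis using n that by (metis not_le)
      next
        case F2: False
        then have "F \<bar>s\<bar> \<le> F r" using that by (intro Fmono) auto
        then show ?thesis using False by (auto simp: not_le intro: less_le_trans)
      qed
      show False
      proof (cases "\<forall>r. \<exists>r'>r. v r' \<noteq> \<infinity>")
        case True
        have "ennreal e * \<infinity> = (\<integral>\<^sup>+t. ennreal e * indicator {0::real<..} t \<partial>lborel)"
        proof -
          have "emeasure lborel {0::real<..} = \<infinity>"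
          proof -
            have n: "of_nat n \<le> emeasure lborel {0::real<..}" for n
            proof -
              have "emeasure lborel {0<..<real n} \<le> emeasure lborel {0::real<..}" by (rule emeasure_mono) auto
              then show ?thesis by (simp add: ennreal_of_nat_eq_real_of_nat)
            qed
            show ?thesis
            proof (rule ccontr)
              assume "emeasure lborel {0::real<..} \<noteq> \<infinity>"
              then obtain x where x: "emeasure lborel {0::real<..} = ennreal x" "0 \<le> x"
                by (cases "emeasure lborel {0::real<..}") auto
              obtain k :: nat where "x < real k" using reals_Archimedean2 by blast
              then show False using n[of k] x by (simp add: ennreal_of_nat_eq_real_of_nat)
            qed
          qed
          then show ?thesis using nn_integral_cmult_indicator[of "{0::real<..}" lborel "ennreal e"] by simp
        qed
        also have "\<dots> \<le> (\<integral>\<^sup>+t. F t \<partial>lborel)"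
          by (rule nn_integral_mono) (use big True in \<open>auto simp: indicator_def intro: less_imp_le\<close>)
        also have "\<dots> < \<infinity>" using fin by (simp add: F_def)
        finally show False using e by (simp add: ennreal_mult_top)
      next
        case ex: False
        then have bdd: "bdd_above {t. v t \<noteq> \<infinity>}" by (auto simp: bdd_above_def not_less)
        have vs: "v \<bar>s\<bar> \<noteq> \<infinity>" using False by (auto simp: F_def)
        define b where "b = Sup {t. v t \<noteq> \<infinity>}"
        have b: "t < b \<Longrightarrow> \<exists>r'>t. v r' \<noteq> \<infinity>" for t
          unfolding b_def by (subst (asm) less_cSup_iff) (use bdd vs in auto)
        have b': "v t = \<infinity>" if "b < t" for t
        proof (rule ccontr)
          assume "v t \<noteq> \<infinity>"
          then have "t \<le> b" unfolding b_def by (intro cSup_upper bdd) auto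
          then show False using that by simp
        qed
        have "\<bar>s\<bar> \<le> b" unfolding b_def by (intro cSup_upper bdd) (use vs in auto)
        then have b0: "0 < b" using s by simp
        \<comment> \<open>Otherwise \<open>h\<close> would be more than \<open>e\<close> at points just below the end \<open>b\<close> of the domain and
          0 at points just above it.\<close>
        have "isCont h b" using h(1) by (simp add: continuous_on_eq_continuous_at)
        then obtain d where d: "d > 0" "\<And>t. \<bar>t - b\<bar> < d \<Longrightarrow> \<bar>h t - h b\<bar> < e / 2"
          unfolding continuous_at_eps_delta using e by (metis dist_real_def half_gt_zero)
        obtain t1 where t1: "max 0 (b - d) < t1" "t1 < b" "F t1 = ennreal (h t1)"
          using AE_ex_Ioo[OF h(2), of "max 0 (b - d)" b] b0 d(1) by (auto simp: F_def)
        obtain t2 where t2: "b < t2" "t2 < b + d" "F t2 = ennreal (h t2)"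
          using AE_ex_Ioo[OF h(2), of b "b + d"] b0 d(1) by (auto simp: F_def)
        have "ennreal e < ennreal (h t1)" using big[of t1] b t1 by auto
        then have "e < h t1" using h(3)[of t1] e by (simp add: ennreal_less_iff)
        moreover have "h t2 = 0" using b'[OF t2(1)] t2(3) h(3)[of t2] by (simp add: F_def)
        moreover have "\<bar>h t1 - h b\<bar> < e/2" by (rule d(2)) (use t1 in auto)
        moreover have "\<bar>h t2 - h b\<bar> < e/2" by (rule d(2)) (use t2 in auto)
        ultimately show False by linarith
      qed
    qed
    then obtain r r' where r: "\<bar>s\<bar> \<le> r" "r < r'" "v r' \<noteq> \<infinity>" "F r \<le> ennreal e" by auto
    have "F \<bar>s\<bar> = F r + (\<integral>\<^sup>+t. line_grad v t * indicator {\<bar>s\<bar>..r} t \<partial>lborel)"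
      unfolding F_def line_grad_def by (rule even_convex_FTC[OF c assms(2) even _ r(1-3)]) simp
    also have "\<dots> \<le> ennreal e + (\<integral>\<^sup>+t. line_grad v t * indicator {0<..} t \<partial>lborel)"
      by (intro add_mono r nn_integral_mono) (use s in \<open>auto simp: indicator_def\<close>)
    finally show ?thesis by (simp add: add.commute)
  qed
  have "F s \<le> F \<bar>s\<bar>" by (rule Fmono) simp
  also have "F \<bar>s\<bar> \<le> (\<integral>\<^sup>+t. line_grad v t * indicator {0<..} t \<partial>lborel)"
    by (rule ennreal_le_epsilon) (use main in auto)
  finally have "2 * F s \<le> 2 * (\<integral>\<^sup>+t. line_grad v t * indicator {0<..} t \<partial>lborel)" by (rule mult_left_mono) simp
  then show ?thesis
    by (subst nn_integral_even) (auto simp: line_grad_even[where v=v, OF even] F_def)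
qed

section \<open>Gradients of convex functions in several variables\<close>

text \<open>Jensen's inequality is inherited from finite convex combinations in the epigraph.\<close>

lemma convex_epigraph:
  assumes "ext_convex V" shows "convex {(y, b). V y \<le> ereal b}"
proof (rule convexI)
  fix p q :: "'a \<times> real" and s t :: real
  assume *: "p \<in> {(y, b). V y \<le> ereal b}" "q \<in> {(y, b). V y \<le> ereal b}" "0 \<le> s" "0 \<le> t" "s + t = 1"
  then have s: "s = 1 - t" by simp
  have "V ((1 - t) *\<^sub>R fst p + t *\<^sub>R fst q) \<le> ereal ((1 - t) * snd p + t * snd q)"
    by (rule ext_convex_le_real[OF assms]) (use * in auto)
  then show "s *\<^sub>R p + t *\<^sub>R q \<in> {(y, b). V y \<le> ereal b}"
    by (cases p; cases q) (simp add: s)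
qed

lemma ext_convex_sum_le:
  assumes "ext_convex V" "finite I" "\<And>i. i \<in> I \<Longrightarrow> 0 \<le> c i" "(\<Sum>i\<in>I. c i) = 1" "\<And>i. i \<in> I \<Longrightarrow> V (y i) \<le> ereal (b i)"
  shows "V (\<Sum>i\<in>I. c i *\<^sub>R y i) \<le> ereal (\<Sum>i\<in>I. c i * b i)"
proof -
  have "(\<Sum>i\<in>I. c i *\<^sub>R (y i, b i)) \<in> {(y, b). V y \<le> ereal b}"
    by (rule convex_sum[OF assms(2) convex_epigraph[OF assms(1)]]) (use assms in auto)
  moreover have "(\<Sum>i\<in>I. c i *\<^sub>R (y i, b i)) = (\<Sum>i\<in>I. c i *\<^sub>R y i, \<Sum>i\<in>I. c i * b i)"
    using assms(2) by (induction I rule: finite_induct) (auto simp: zero_prod_def)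
  ultimately show ?thesis by simp
qed

lemma line_affine: "line i y ((1 - t) *\<^sub>R a + t *\<^sub>R b) = (1 - t) *\<^sub>R line i y a + t *\<^sub>R line i y b"
  by (simp add: vec_eq_iff algebra_simps)

lemma ext_convex_line: "ext_convex V \<Longrightarrow> ext_convex (\<lambda>t. V (line i y t))"
  unfolding ext_convex_def line_affine by blast

lemma line_shift: "line i (vec_nth x) (x $ i + t) = x + t *\<^sub>R axis i 1"
  by (simp add: vec_eq_iff axis_def)

lemma has_ext_gradient_lineI:
  fixes V :: "real^'n \<Rightarrow> ereal"
  assumes "has_ext_gradient V x D"
  shows "has_ext_gradient (\<lambda>t. V (line i (vec_nth x) t)) (x $ i) (D $ i)"
proof -
  obtain a where a: "V x = ereal a" and small: "\<And>e. e > 0 \<Longrightarrow> \<exists>d>0. \<forall>h. norm h < d \<longrightarrow>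
     (\<exists>b. V (x + h) = ereal b \<and> \<bar>b - a - h \<bullet> D\<bar> \<le> e * norm h)"
    using assms unfolding has_ext_gradient_eps by blast
  show ?thesis unfolding has_ext_gradient_eps line_shift
  proof (rule exI[of _ a], intro conjI allI impI)
    fix e :: real assume "0 < e"
    from small[OF this] obtain d where d: "d > 0"
        "\<And>h. norm h < d \<Longrightarrow> \<exists>b. V (x + h) = ereal b \<and> \<bar>b - a - h \<bullet> D\<bar> \<le> e * norm h" by blast
    show "\<exists>d>0. \<forall>h. norm h < d \<longrightarrow> (\<exists>b. V (x + h *\<^sub>R axis i 1) = ereal b \<and> \<bar>b - a - h \<bullet> D $ i\<bar> \<le> e * norm h)"
    proof (rule exI[of _ d], intro conjI allI impI)
      fix h :: real assume "norm h < d"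
      then show "\<exists>b. V (x + h *\<^sub>R axis i 1) = ereal b \<and> \<bar>b - a - h \<bullet> D $ i\<bar> \<le> e * norm h"
        using d(2)[of "h *\<^sub>R axis i 1"] by (simp add: inner_axis' norm_axis_1)
    qed (rule d)
  qed (simp add: a)
qed

text \<open>For convex functions partial derivatives suffice. The point \<open>x + h\<close> is the mean of the \<open>n\<close>
  points \<open>x + n h\<^sub>i e\<^sub>i\<close> on the axes through \<open>x\<close>, so Jensen's inequality gives the upper estimate;
  the lower one follows from the upper one at \<open>x - h\<close> because \<open>x\<close> is the midpoint of \<open>x + h\<close> and
  \<open>x - h\<close>.\<close>

lemma has_ext_gradient_from_lines:
  fixes V :: "real^'n \<Rightarrow> ereal"
  assumes c: "ext_convex V" and l: "\<And>i. has_ext_gradient (\<lambda>t. V (line i (vec_nth x) t)) (x $ i) (D $ i)"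
  shows "has_ext_gradient V x D"
proof -
  define n where "n = real CARD('n)"
  have n: "n \<ge> 1" unfolding n_def using zero_less_card_finite[where 'a='n] by linarith
  obtain a where a: "V x = ereal a" using l[of undefined] unfolding has_ext_gradient_eps by auto
  have small: "\<exists>d>0. \<forall>t. \<bar>t\<bar> < d \<longrightarrow> (\<exists>b. V (x + t *\<^sub>R axis i 1) = ereal b \<and> \<bar>b - a - t * D $ i\<bar> \<le> e * \<bar>t\<bar>)"
    if "e > 0" for e i
    using l[of i] that unfolding has_ext_gradient_eps line_shift by (auto simp: a)
  show ?thesis unfolding has_ext_gradient_eps
  proof (rule exI[of _ a], intro conjI allI impI)
    fix e' :: real assume e': "0 < e'"
    \<comment> \<open>The error is divided by \<open>n\<close> because the \<open>l\<^sup>1\<close> norm of \<open>h\<close> is at most \<open>n\<close> times its Euclidean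
      norm.\<close>
    define e where "e = e' / n"
    have e: "e > 0" using e' n by (simp add: e_def)
    obtain d where d: "\<And>i. d i > 0" "\<And>i t. \<bar>t\<bar> < d i \<Longrightarrow> \<exists>b. V (x + t *\<^sub>R axis i 1) = ereal b \<and> \<bar>b - a - t * D $ i\<bar> \<le> e * \<bar>t\<bar>"
      using small[OF e] by metis
    define m where "m = Min (range d)"
    have m: "m > 0" "\<And>i. m \<le> d i" unfolding m_def using d(1) by (auto simp: Min_gr_iff)
    have upper: "V (x + h) \<le> ereal (a + h \<bullet> D + e' * norm h)" if h: "norm h < m / n" for h
    proof -
      have hi: "\<bar>n * h $ i\<bar> < d i" for i
      proof -
        have "\<bar>n * h $ i\<bar> \<le> n * norm h" using n component_le_norm_cart[of h i] by (simp add: abs_mult)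
        also have "\<dots> < m" using h n by (simp add: field_simps)
        finally show ?thesis using m(2)[of i] by simp
      qed
      have "V (\<Sum>i\<in>UNIV. (1 / n) *\<^sub>R (x + (n * h $ i) *\<^sub>R axis i 1)) \<le> ereal (\<Sum>i\<in>UNIV. (1/n) * (a + n * h $ i * D $ i + e * \<bar>n * h $ i\<bar>))"
      proof (rule ext_convex_sum_le[OF c])
        show "V (x + (n * h $ i) *\<^sub>R axis i 1) \<le> ereal (a + n * h $ i * D $ i + e * \<bar>n * h $ i\<bar>)" for i
          using d(2)[OF hi[of i]] by auto
      qed (use n in \<open>auto simp: n_def\<close>)
      also have "(\<Sum>i\<in>UNIV. (1 / n) *\<^sub>R (x + (n * h $ i) *\<^sub>R axis i 1)) = x + h"
      proof -
        have "(\<Sum>i\<in>UNIV. (1 / n) *\<^sub>R (x + (n * h $ i) *\<^sub>R axis i 1)) = (\<Sum>i\<in>(UNIV::'n set). (1 / n) *\<^sub>R x) + (\<Sum>i\<in>UNIV. h $ i *\<^sub>R axis i 1)"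
          using n by (simp add: scaleR_add_right sum.distrib)
        also have "(\<Sum>i\<in>(UNIV::'n set). (1 / n) *\<^sub>R x) = x"
        proof -
          have "(\<Sum>i\<in>(UNIV::'n set). (1 / n) *\<^sub>R x) = (\<Sum>i\<in>(UNIV::'n set). 1 / n) *\<^sub>R x" by (rule scaleR_sum_left[symmetric])
          also have "(\<Sum>i\<in>(UNIV::'n set). 1 / n) = 1" by (simp add: n_def)
          finally show ?thesis by simp
        qed
        also have "(\<Sum>i\<in>UNIV. h $ i *\<^sub>R axis i 1) = h"
          by (simp add: vec_eq_iff axis_def if_distrib cong: if_cong)
        finally show ?thesis .
      qed
      also have "(\<Sum>i\<in>UNIV. (1/n) * (a + n * h $ i * D $ i + e * \<bar>n * h $ i\<bar>)) = a + h \<bullet> D + e * (\<Sum>i\<in>UNIV. \<bar>h $ i\<bar>)"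
      proof -
        have "(\<Sum>i\<in>UNIV. (1/n) * (a + n * h $ i * D $ i + e * \<bar>n * h $ i\<bar>)) = (\<Sum>i\<in>(UNIV::'n set). a / n + h $ i * D $ i + e * \<bar>h $ i\<bar>)"
          using n by (intro sum.cong) (auto simp: field_simps abs_mult)
        also have "\<dots> = a + h \<bullet> D + e * (\<Sum>i\<in>UNIV. \<bar>h $ i\<bar>)"
          using n by (simp add: sum.distrib n_def inner_vec_def sum_distrib_left)
        finally show ?thesis .
      qed
      also have "ereal (a + h \<bullet> D + e * (\<Sum>i\<in>UNIV. \<bar>h $ i\<bar>)) \<le> ereal (a + h \<bullet> D + e' * norm h)"
      proof -
        have "(\<Sum>i\<in>UNIV. \<bar>h $ i\<bar>) \<le> (\<Sum>i\<in>(UNIV::'n set). norm h)" by (intro sum_mono component_le_norm_cart)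
        then have "e * (\<Sum>i\<in>UNIV. \<bar>h $ i\<bar>) \<le> e * (n * norm h)" using e by (simp add: n_def)
        also have "\<dots> = e' * norm h" using n by (simp add: e_def)
        finally show ?thesis by simp
      qed
      finally show ?thesis .
    qed
    show "\<exists>d>0. \<forall>h. norm h < d \<longrightarrow> (\<exists>b. V (x + h) = ereal b \<and> \<bar>b - a - h \<bullet> D\<bar> \<le> e' * norm h)"
    proof (rule exI[of _ "m / n"], intro conjI allI impI)
      fix h :: "real^'n" assume h: "norm h < m / n"
      have u: "V (x + h) \<le> ereal (a + h \<bullet> D + e' * norm h)" using upper[OF h] .
      then obtain b where b: "V (x + h) = ereal b" using ext_convex_not_MInfty[OF c, of "x + h"] by (cases "V (x + h)") auto
      have u2: "V (x + (- h)) \<le> ereal (a + (- h) \<bullet> D + e' * norm (- h))" using upper[of "- h"] h by simp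
      have "V ((1 - 1/2) *\<^sub>R (x + h) + (1/2) *\<^sub>R (x + (- h))) \<le> ereal ((1 - 1/2) * b + (1/2) * (a + (- h) \<bullet> D + e' * norm (- h)))"
        by (rule ext_convex_le_real[OF c _ u2]) (auto simp: b)
      also have "(1 - 1/2) *\<^sub>R (x + h) + (1/2) *\<^sub>R (x + (- h)) = x" by (simp add: vec_eq_iff field_simps)
      finally have "a + h \<bullet> D - e' * norm h \<le> b" by (simp add: a field_simps)
      then show "\<exists>b. V (x + h) = ereal b \<and> \<bar>b - a - h \<bullet> D\<bar> \<le> e' * norm h"
        using u b by (auto simp: abs_le_iff)
    qed (use m n in auto)
  qed (rule a)
qed

text \<open>Unlike a component of the gradient, this is defined through the restriction of \<open>V\<close> to a
  single line, even at points where other partial derivatives do not exist.\<close>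

definition partial_gradient :: "(real^'n \<Rightarrow> ereal) \<Rightarrow> 'n \<Rightarrow> real^'n \<Rightarrow> real" where
  "partial_gradient V i x = ext_gradient (\<lambda>t. V (line i (vec_nth x) t)) (x $ i)"

lemma ext_differentiable_iff_lines:
  fixes V :: "real^'n \<Rightarrow> ereal"
  assumes c: "ext_convex V"
  shows "ext_differentiable V x \<longleftrightarrow> (\<forall>i. ext_differentiable (\<lambda>t. V (line i (vec_nth x) t)) (x $ i))"
proof
  assume "\<forall>i. ext_differentiable (\<lambda>t. V (line i (vec_nth x) t)) (x $ i)"
  then have "has_ext_gradient V x (\<chi> i. partial_gradient V i x)"
    by (intro has_ext_gradient_from_lines[OF c]) (auto simp: partial_gradient_def intro: ext_differentiableD)
  then show "ext_differentiable V x" by (auto simp: ext_differentiable_def)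
qed (auto simp: ext_differentiable_def intro: has_ext_gradient_lineI)

lemma ext_gradient_nth:
  fixes V :: "real^'n \<Rightarrow> ereal"
  assumes d: "ext_differentiable V x"
  shows "ext_gradient V x $ i = partial_gradient V i x"
  using ext_gradient_eq[OF has_ext_gradient_lineI[OF ext_differentiableD[OF d], of i]] by (simp add: partial_gradient_def)

lemma measurable_line_slopes:
  fixes V :: "real^'n \<Rightarrow> ereal"
  assumes [measurable]: "V \<in> borel_measurable borel"
  shows "(\<lambda>x. right_slope (\<lambda>t. V (line i (vec_nth x) t)) (x $ i)) \<in> borel_measurable borel"
    and "(\<lambda>x. left_slope (\<lambda>t. V (line i (vec_nth x) t)) (x $ i)) \<in> borel_measurable borel"
proof -
  have [measurable]: "(\<lambda>x. x + c) \<in> borel_measurable borel" "(\<lambda>x. x - c) \<in> borel_measurable borel" for c :: "real^'n"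
    by measurable
  have 1: "line i (vec_nth x) (x $ i - s) = x - s *\<^sub>R axis i 1" for x and s :: real
    using line_shift[of i x "- s"] by simp
  show "(\<lambda>x. right_slope (\<lambda>t. V (line i (vec_nth x) t)) (x $ i)) \<in> borel_measurable borel"
    unfolding right_slope_def right_quot_def line_shift line_self by measurable
  show "(\<lambda>x. left_slope (\<lambda>t. V (line i (vec_nth x) t)) (x $ i)) \<in> borel_measurable borel"
    unfolding left_slope_def left_quot_def 1 line_self by measurable
qed

lemma measurable_line_differentiable:
  fixes V :: "real^'n \<Rightarrow> ereal"
  assumes c: "ext_convex V" and V[measurable]: "V \<in> borel_measurable borel"
  shows "Measurable.pred borel (\<lambda>x. ext_differentiable (\<lambda>t. V (line i (vec_nth x) t)) (x $ i))"
proof -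
  note [measurable] = measurable_line_slopes[OF V]
  show ?thesis unfolding ext_differentiable_iff_slopes[OF ext_convex_line[OF c]] line_self by measurable
qed

lemma measurable_partial_gradient:
  fixes V :: "real^'n \<Rightarrow> ereal"
  assumes c: "ext_convex V" and V[measurable]: "V \<in> borel_measurable borel"
  shows "partial_gradient V i \<in> borel_measurable borel"
proof -
  note [measurable] = measurable_line_slopes[OF V] measurable_line_differentiable[OF c V]
  show ?thesis unfolding partial_gradient_def[abs_def] ext_gradient_eq_slope[OF ext_convex_line[OF c]] by measurable
qed

lemma measurable_ext_differentiable:
  fixes V :: "real^'n \<Rightarrow> ereal"
  assumes c: "ext_convex V" and V[measurable]: "V \<in> borel_measurable borel"
  shows "Measurable.pred borel (ext_differentiable V)"
proof -
  note [measurable] = measurable_line_differentiable[OF c V]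
  have "ext_differentiable V = (\<lambda>x. \<forall>i\<in>UNIV. ext_differentiable (\<lambda>t. V (line i (vec_nth x) t)) (x $ i))"
    using ext_differentiable_iff_lines[OF c] by auto
  then show ?thesis by simp
qed

lemma measurable_ext_gradient:
  fixes V :: "real^'n \<Rightarrow> ereal"
  assumes c: "ext_convex V" and V[measurable]: "V \<in> borel_measurable borel"
  shows "ext_gradient V \<in> borel_measurable borel"
proof (rule measurable_vecI)
  fix i
  note [measurable] = measurable_ext_differentiable[OF c V] measurable_partial_gradient[OF c V]
  have "(\<lambda>x. ext_gradient V x $ i) = (\<lambda>x. if ext_differentiable V x then partial_gradient V i x else 0)"
    by (auto simp: ext_gradient_nth ext_gradient_not_differentiable)
  then show "(\<lambda>x. ext_gradient V x $ i) \<in> borel_measurable borel" by simp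
qed

text \<open>On each line parallel to an axis the exceptional set is countable; Tonelli's theorem makes
  each partial derivative exist almost everywhere on the domain.\<close>

lemma ext_convex_AE_ext_differentiable:
  fixes V :: "real^'n \<Rightarrow> ereal"
  assumes c: "ext_convex V" and V[measurable]: "V \<in> borel_measurable borel"
  shows "AE x in lborel. V x \<noteq> \<infinity> \<longrightarrow> ext_differentiable V x"
proof -
  note [measurable] = measurable_line_differentiable[OF c V]
  have "AE x in lborel. V x \<noteq> \<infinity> \<longrightarrow> ext_differentiable (\<lambda>t. V (line i (vec_nth x) t)) (x $ i)" for i
  proof (rule AE_lineI[where i=i])
    show "AE y in \<Pi>\<^sub>M j\<in>UNIV - {i}. lborel. AE t in lborel. V (line i y t) \<noteq> \<infinity> \<longrightarrow>
       ext_differentiable (\<lambda>ta. V (line i (vec_nth (line i y t)) ta)) (line i y t $ i)"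
      using ext_convex_AE_differentiable[OF ext_convex_line[OF c]] by simp
  qed measurable
  then have "AE x in lborel. \<forall>i. V x \<noteq> \<infinity> \<longrightarrow> ext_differentiable (\<lambda>t. V (line i (vec_nth x) t)) (x $ i)"
    unfolding AE_all_countable by blast
  then show ?thesis by eventually_elim (simp add: ext_differentiable_iff_lines[OF c])
qed

section \<open>Semicontinuity, growth and second moments\<close>

lemma lsc_open:
  assumes "lower_semicontinuous V" shows "open {x. a < V x}"
proof (subst open_subopen, safe)
  fix x assume a: "a < V x"
  then have "a < Liminf (at x) V" using assms by (auto simp: lower_semicontinuous_def intro: less_le_trans)
  then have "\<forall>\<^sub>F y in at x. a < V y" by (rule less_LiminfD)
  then have "\<forall>\<^sub>F y in nhds x. a < V y" using a by (auto simp: eventually_at_filter elim!: eventually_mono)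
  then show "\<exists>T. open T \<and> x \<in> T \<and> T \<subseteq> {x. a < V x}" by (auto simp: eventually_nhds)
qed

lemma lsc_measurable:
  fixes V :: "'a::topological_space \<Rightarrow> ereal"
  assumes "lower_semicontinuous V" shows "V \<in> borel_measurable borel"
proof (rule borel_measurableI_greater)
  fix a show "{x \<in> space borel. a < V x} \<in> sets borel" using lsc_open[OF assms, of a] by simp
qed

lemma nn_integral_lborel_scale:
  fixes F :: "'a::euclidean_space \<Rightarrow> ennreal"
  assumes [measurable]: "F \<in> borel_measurable borel" and c: "c \<noteq> 0"
  shows "(\<integral>\<^sup>+x. F x \<partial>lborel) = ennreal (\<bar>c\<bar> ^ DIM('a)) * (\<integral>\<^sup>+x. F (t + c *\<^sub>R x) \<partial>lborel)"
  by (subst lborel_affine[OF c, of t])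
     (auto simp: nn_integral_density nn_integral_distr nn_integral_cmult)

lemma AE_lborel_affine:
  fixes t :: "'a::euclidean_space"
  assumes c: "c \<noteq> 0" and P: "AE x in lborel. P x"
  shows "AE x in lborel. P (t + c *\<^sub>R x)"
proof -
  have "AE x in density (distr lborel borel (\<lambda>x. t + c *\<^sub>R x)) (\<lambda>_. ennreal (\<bar>c\<bar>^DIM('a))). P x"
    using P by (subst (asm) lborel_affine[OF c, of t])
  then have "AE x in distr lborel borel (\<lambda>x. t + c *\<^sub>R x). P x"
    using c by (subst (asm) AE_density) auto
  then show ?thesis by (rule AE_distrD[rotated]) simp
qed

text \<open>The lower bound \<open>K\<close> allows a choice of \<open>k\<close> above any given value of \<open>V\<close>.\<close>

lemma sublevel_positive:
  fixes V :: "'a::euclidean_space \<Rightarrow> ereal"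
  assumes [measurable]: "V \<in> borel_measurable borel" and pos: "(\<integral>\<^sup>+x. exp_neg (V x) \<partial>lborel) \<noteq> 0"
  obtains k :: nat where "emeasure lborel {x \<in> cball 0 (real k). V x \<le> ereal (real k)} > 0" "k \<ge> K"
proof (rule ccontr)
  assume n: "\<not> thesis"
  have "emeasure lborel {x \<in> cball 0 (real k). V x \<le> ereal (real k)} = 0" for k :: nat
  proof -
    have "emeasure lborel {x \<in> cball 0 (real k). V x \<le> ereal (real k)}
       \<le> emeasure lborel {x \<in> cball 0 (real (max k K)). V x \<le> ereal (real (max k K))}"
    proof (rule emeasure_mono, safe)
      fix x assume "V x \<le> ereal (real k)"
      then show "V x \<le> ereal (real (max k K))" by (rule order_trans) simp
    qed auto
    also have "\<dots> = 0" using n that[of "max k K"] by (auto simp: not_less zero_less_iff_neq_zero)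
    finally show ?thesis by simp
  qed
  then have "{x \<in> cball 0 (real k). V x \<le> ereal (real k)} \<in> null_sets lborel" for k :: nat
    by (intro null_setsI) auto
  then have "(\<Union>k. {x \<in> cball 0 (real k). V x \<le> ereal (real k)}) \<in> null_sets lborel" by auto
  then have "AE x in lborel. x \<notin> (\<Union>k. {x \<in> cball 0 (real k). V x \<le> ereal (real k)})" by (rule AE_not_in)
  then have "AE x in lborel. exp_neg (V x) = 0"
  proof eventually_elim
    case (elim x)
    have "V x = \<infinity>"
    proof (rule ccontr)
      assume "V x \<noteq> \<infinity>"
      then obtain r where r: "V x \<le> ereal r" by (cases "V x") auto
      obtain k :: nat where k: "max r (norm x) < real k" using reals_Archimedean2 by blast
      then have "V x \<le> ereal (real k)" using r by (intro order_trans[OF r]) auto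
      then show False using elim k by auto
    qed
    then show ?case by simp
  qed
  then have "(\<integral>\<^sup>+x. exp_neg (V x) \<partial>lborel) = (\<integral>\<^sup>+(x::'a). 0 \<partial>lborel)" by (rule nn_integral_cong_AE)
  then show False using pos by simp
qed

text \<open>Invariance of a measure determines its potential almost everywhere; this lemma upgrades such
  identities to all points, including boundary points of the domain. If \<open>V x < W x\<close>, then \<open>W > a\<close>
  near \<open>x\<close> for some \<open>a > V x\<close>. A bounded set of positive measure on which \<open>V\<close> is bounded,
  contracted strongly towards \<open>x\<close>, still has positive measure, lies near \<open>x\<close>, and by convexity \<open>V
  < a\<close> there, although \<open>V = W\<close> at almost all of its points.\<close>

lemma convex_AE_eq_imp_le:
  fixes V W :: "'a::euclidean_space \<Rightarrow> ereal"
  assumes c: "ext_convex V" and [measurable]: "V \<in> borel_measurable borel" and pos: "(\<integral>\<^sup>+x. exp_neg (V x) \<partial>lborel) \<noteq> 0"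
    and W: "\<And>a. open {x. a < W x}" and eq: "AE x in lborel. V x = W x"
  shows "W x \<le> V x"
proof (rule ccontr)
  assume "\<not> W x \<le> V x"
  then obtain a where a: "V x < ereal a" "ereal a < W x" using ereal_dense2[of "V x" "W x"] by (auto simp: not_le)
  then obtain b where b: "V x = ereal b" using ext_convex_not_MInfty[OF c, of x] by (cases "V x") auto
  have ba: "b < a" using a b by simp
  obtain k :: nat where k: "emeasure lborel {x \<in> cball 0 (real k). V x \<le> ereal (real k)} > 0"
    using sublevel_positive[OF assms(2) pos, of 0] by auto
  obtain d where d: "d > 0" "\<And>y. dist y x < d \<Longrightarrow> ereal a < W y"
    using W[of "ereal a"] a(2) unfolding open_dist by blast
  \<comment> \<open>\<open>M\<close> bounds both the distance from \<open>x\<close> to the sublevel set and the increase of \<open>V\<close> towards it,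
    so \<open>s\<close> makes both small.\<close>
  define M where "M = real k + norm x + \<bar>real k - b\<bar> + 1"
  define s where "s = min (1/2) (min (d / (2 * M)) ((a - b) / (2 * M)))"
  have M: "M > 0" unfolding M_def using norm_ge_zero[of x] by linarith
  have s: "0 < s" "s \<le> 1/2" "s \<le> d / (2 * M)" "s \<le> (a - b) / (2 * M)" using M d ba by (auto simp: s_def)
  have sM: "s * M \<le> d / 2" "s * M \<le> (a - b) / 2" using s M by (auto simp: field_simps)
  have "AE e in lborel. V ((1 - s) *\<^sub>R x + s *\<^sub>R e) = W ((1 - s) *\<^sub>R x + s *\<^sub>R e)"
    by (rule AE_lborel_affine[OF _ eq]) (use s in simp)
  then have "\<exists>e. e \<in> {x \<in> cball 0 (real k). V x \<le> ereal (real k)} \<and> V ((1 - s) *\<^sub>R x + s *\<^sub>R e) = W ((1 - s) *\<^sub>R x + s *\<^sub>R e)"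
  proof -
    assume AE: "AE e in lborel. V ((1 - s) *\<^sub>R x + s *\<^sub>R e) = W ((1 - s) *\<^sub>R x + s *\<^sub>R e)"
    show ?thesis
    proof (rule ccontr)
      assume "\<not> ?thesis"
      then have "AE e in lborel. e \<notin> {x \<in> cball 0 (real k). V x \<le> ereal (real k)}" using AE by (auto elim!: eventually_mono)
      then have "{x \<in> cball 0 (real k). V x \<le> ereal (real k)} \<in> null_sets lborel" by (subst (asm) AE_iff_null_sets[symmetric]) auto
      then show False using k by auto
    qed
  qed
  then obtain e where e: "norm e \<le> real k" "V e \<le> ereal (real k)" "V ((1 - s) *\<^sub>R x + s *\<^sub>R e) = W ((1 - s) *\<^sub>R x + s *\<^sub>R e)"
    by auto
  have "V ((1 - s) *\<^sub>R x + s *\<^sub>R e) \<le> ereal ((1 - s) * b + s * real k)"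
    by (rule ext_convex_le_real[OF c _ e(2)]) (use s b in auto)
  also have "(1 - s) * b + s * real k = b + s * (real k - b)" by (simp add: algebra_simps)
  also have "\<dots> \<le> b + s * M"
  proof -
    have "real k - b \<le> M" unfolding M_def using norm_ge_zero[of x] by linarith
    then show ?thesis using s(1) by (intro add_left_mono mult_left_mono) auto
  qed
  also have "\<dots> < a" using sM(2) ba by (simp add: field_simps)
  finally have 1: "W ((1 - s) *\<^sub>R x + s *\<^sub>R e) < ereal a" using e(3) by (simp add: less_le_trans)
  have "dist ((1 - s) *\<^sub>R x + s *\<^sub>R e) x = norm (s *\<^sub>R (e - x))" by (simp add: dist_norm algebra_simps)
  also have "\<dots> = s * norm (e - x)" using s by simp
  also have "\<dots> \<le> s * M" using s(1) norm_triangle_ineq4[of e x] e(1) unfolding M_def by (intro mult_left_mono) auto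
  also have "\<dots> < d" using sM d by simp
  finally show False using d(2) 1 by (meson less_asym)
qed

text \<open>If a sublevel set contained a very distant point \<open>x\<close>, it would by convexity contain the
  contractions towards \<open>x\<close> of a fixed bounded subset of positive measure. Many of these are
  disjoint and not much smaller than the original, which contradicts the finite measure of the
  sublevel set.\<close>

lemma sublevel_bounded:
  fixes V :: "'a::euclidean_space \<Rightarrow> ereal"
  assumes c: "ext_convex V" and [measurable]: "V \<in> borel_measurable borel"
    and fin: "(\<integral>\<^sup>+x. exp_neg (V x) \<partial>lborel) \<noteq> \<infinity>"
    and k: "emeasure lborel {x \<in> cball 0 (real k). V x \<le> ereal (real k)} > 0" (is "emeasure lborel ?E > 0")
  shows "\<exists>R. \<forall>x. V x \<le> ereal (real k) \<longrightarrow> norm x \<le> R"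
proof -
  define S where "S = {x. V x \<le> ereal (real k)}"
  have [measurable]: "S \<in> sets borel" unfolding S_def by measurable
  have [measurable]: "?E \<in> sets borel" by measurable
  have "ennreal (exp (- real k)) * emeasure lborel S = (\<integral>\<^sup>+x. ennreal (exp (- real k)) * indicator S x \<partial>lborel)"
    by (rule nn_integral_cmult_indicator[symmetric]) simp
  also have "\<dots> \<le> (\<integral>\<^sup>+x. exp_neg (V x) \<partial>lborel)"
  proof (rule nn_integral_mono)
    fix x show "ennreal (exp (- real k)) * indicator S x \<le> exp_neg (V x)"
    proof (cases "x \<in> S")
      case True
      then have "exp_neg (ereal (real k)) \<le> exp_neg (V x)"
        by (intro exp_neg_antimono ext_convex_not_MInfty[OF c]) (simp add: S_def)
      then show ?thesis using True by simp
    qed simp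
  qed
  finally have "ennreal (exp (- real k)) * emeasure lborel S \<noteq> \<infinity>" using fin by (auto simp: top_unique)
  then have Sfin: "emeasure lborel S \<noteq> \<infinity>" by (auto simp: ennreal_mult_eq_top_iff)
  then obtain r where r: "emeasure lborel S = ennreal r" "0 \<le> r" by (cases "emeasure lborel S") auto
  have "emeasure lborel ?E \<le> emeasure lborel S" by (rule emeasure_mono) (auto simp: S_def)
  then have "emeasure lborel ?E \<noteq> \<infinity>" using Sfin by (auto simp: top_unique)
  then obtain m where m: "emeasure lborel ?E = ennreal m" "0 \<le> m" by (cases "emeasure lborel ?E") auto
  have m0: "0 < m" using k m by simp
  \<comment> \<open>Contractions by a factor of at least 1/2 have measure at least \<open>q\<close>, so at most \<open>r / q\<close> of
    them fit disjointly into a set of measure \<open>r\<close>.\<close>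
  define q where "q = (1/2)^DIM('a) * m"
  have q0: "0 < q" using m0 by (simp add: q_def)
  obtain N :: nat where N: "r / q < real N" using reals_Archimedean2 by blast
  have N0: "0 < real N" using N r q0 by (meson divide_nonneg_pos le_less_trans)
  show ?thesis
  proof (intro exI[of _ "4 * real N * (real k + 1)"] allI impI, rule ccontr)
    fix x assume x: "V x \<le> ereal (real k)" and "\<not> norm x \<le> 4 * real N * (real k + 1)"
    then have xn: "norm x > 4 * real N * (real k + 1)" by simp
    \<comment> \<open>The weights lie in \<open>[0, 1/2]\<close> and differ by at least \<open>1/(2 N)\<close>; the centres of the
      contractions are then more than their size apart once \<open>|x| > 4 N k\<close>.\<close>
    define s where "s j = real j / (2 * real N)" for j :: nat
    have s: "0 \<le> s j" "s j \<le> 1/2" if "j < N" for j using that N0 by (auto simp: s_def field_simps)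
    define A where "A j = {y. (1 / (1 - s j)) *\<^sub>R (y - s j *\<^sub>R x) \<in> ?E}" for j
    have [measurable]: "A j \<in> sets borel" for j
    proof -
      have "(\<lambda>y. (1 / (1 - s j)) *\<^sub>R (y - s j *\<^sub>R x)) -` ?E \<inter> space borel \<in> sets borel"
        by (rule measurable_sets[of _ borel borel]) auto
      then show ?thesis by (simp add: A_def vimage_def)
    qed
    have Arep: "\<exists>e. e \<in> ?E \<and> y = (1 - s j) *\<^sub>R e + s j *\<^sub>R x" if "y \<in> A j" "j < N" for y j
    proof (intro exI conjI)
      show "(1 / (1 - s j)) *\<^sub>R (y - s j *\<^sub>R x) \<in> ?E" using that by (simp add: A_def)
      have "1 - s j \<noteq> 0" using s[OF that(2)] by auto
      then show "y = (1 - s j) *\<^sub>R ((1 / (1 - s j)) *\<^sub>R (y - s j *\<^sub>R x)) + s j *\<^sub>R x" by simp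
    qed
    have AS: "A j \<subseteq> S" if jN: "j < N" for j
    proof
      fix y assume "y \<in> A j"
      then obtain e where e: "e \<in> ?E" "y = (1 - s j) *\<^sub>R e + s j *\<^sub>R x" using Arep[OF \<open>y \<in> A j\<close> jN] by blast
      have "V ((1 - s j) *\<^sub>R e + s j *\<^sub>R x) \<le> ereal ((1 - s j) * real k + s j * real k)"
        by (rule ext_convex_le_real[OF c _ x]) (use e s[OF jN] in auto)
      also have "(1 - s j) * real k + s j * real k = real k" by (simp add: algebra_simps)
      finally show "y \<in> S" using e by (simp add: S_def)
    qed
    have Am: "ennreal q \<le> emeasure lborel (A j)" if "j < N" for j
    proof -
      have c0: "1 - s j \<noteq> 0" "1/2 \<le> 1 - s j" using s[OF that] by auto
      have "emeasure lborel (A j) = (\<integral>\<^sup>+y. indicator (A j) y \<partial>lborel)" by simp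
      also have "\<dots> = ennreal (\<bar>1 - s j\<bar> ^ DIM('a)) * (\<integral>\<^sup>+e. indicator (A j) (s j *\<^sub>R x + (1 - s j) *\<^sub>R e) \<partial>lborel)"
        by (rule nn_integral_lborel_scale[OF _ c0(1)]) measurable
      also have "(\<lambda>e. indicator (A j) (s j *\<^sub>R x + (1 - s j) *\<^sub>R e) :: ennreal) = indicator ?E"
        using c0(1) by (auto simp: A_def indicator_def fun_eq_iff)
      also have "(\<integral>\<^sup>+e. indicator ?E e \<partial>lborel) = ennreal m" using m by simp
      also have "ennreal (\<bar>1 - s j\<bar> ^ DIM('a)) * ennreal m = ennreal (\<bar>1 - s j\<bar> ^ DIM('a) * m)"
        using m by (simp add: ennreal_mult)
      also have "\<dots> \<ge> ennreal q" unfolding q_def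
        using c0 m by (intro ennreal_leI mult_right_mono power_mono) auto
      finally show ?thesis .
    qed
    have disj: "disjoint_family_on A {..<N}"
      unfolding disjoint_family_on_def
    proof (intro ballI impI, rule ccontr)
      fix i j assume ij: "i \<in> {..<N}" "j \<in> {..<N}" "i \<noteq> j" "A i \<inter> A j \<noteq> {}"
      then obtain y where y: "y \<in> A i" "y \<in> A j" by auto
      obtain e where e: "e \<in> ?E" "y = (1 - s i) *\<^sub>R e + s i *\<^sub>R x" using Arep[OF y(1)] ij by blast
      obtain f where f: "f \<in> ?E" "y = (1 - s j) *\<^sub>R f + s j *\<^sub>R x" using Arep[OF y(2)] ij by blast
      have "(s i - s j) *\<^sub>R x = (1 - s j) *\<^sub>R f - (1 - s i) *\<^sub>R e" using e f by (simp add: algebra_simps)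
      then have "\<bar>s i - s j\<bar> * norm x = norm ((1 - s j) *\<^sub>R f - (1 - s i) *\<^sub>R e)" by (metis norm_scaleR)
      also have "\<dots> \<le> \<bar>1 - s j\<bar> * norm f + \<bar>1 - s i\<bar> * norm e" by (metis norm_triangle_ineq4 norm_scaleR)
      also have "\<dots> \<le> 1 * real k + 1 * real k"
        using e f s[of i] s[of j] ij by (intro add_mono mult_mono) auto
      finally have 1: "\<bar>s i - s j\<bar> * norm x \<le> 2 * real k" by simp
      have "1 / (2 * real N) \<le> \<bar>s i - s j\<bar>"
      proof -
        have "1 \<le> \<bar>real i - real j\<bar>" using ij by linarith
        then have "1 / (2 * real N) \<le> \<bar>real i - real j\<bar> / (2 * real N)" using N0 by (intro divide_right_mono) auto
        also have "\<dots> = \<bar>s i - s j\<bar>" using N0 by (simp add: s_def diff_divide_distrib[symmetric] abs_divide)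
        finally show ?thesis .
      qed
      then have "1 / (2 * real N) * norm x \<le> 2 * real k" using 1 by (meson mult_right_mono norm_ge_zero order_trans)
      then have "norm x \<le> 4 * real N * real k" using N0 by (simp add: field_simps)
      also have "\<dots> \<le> 4 * real N * (real k + 1)" using N0 by simp
      finally show False using xn by simp
    qed
    have "ennreal (real N * q) = (\<Sum>j<N. ennreal q)" using q0 by (simp add: ennreal_mult ennreal_of_nat_eq_real_of_nat)
    also have "\<dots> \<le> (\<Sum>j<N. emeasure lborel (A j))" by (rule sum_mono) (use Am in auto)
    also have "\<dots> = emeasure lborel (\<Union>j<N. A j)" by (rule sum_emeasure) (use disj in auto)
    also have "\<dots> \<le> emeasure lborel S" by (rule emeasure_mono) (use AS in auto)
    also have "\<dots> = ennreal r" by (rule r)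
    finally have "real N * q \<le> r" using r by simp
    then show False using N q0 by (simp add: field_simps)
  qed
qed

text \<open>Outside a ball \<open>V\<close> exceeds its minimum by a fixed amount, and convexity along rays from the
  minimum turns this into growth proportional to the distance.\<close>

lemma convex_linear_growth:
  fixes V :: "'a::euclidean_space \<Rightarrow> ereal"
  assumes c: "ext_convex V" and [measurable]: "V \<in> borel_measurable borel"
    and int: "(\<integral>\<^sup>+x. exp_neg (V x) \<partial>lborel) \<noteq> 0" "(\<integral>\<^sup>+x. exp_neg (V x) \<partial>lborel) \<noteq> \<infinity>"
    and min: "\<And>x. V 0 \<le> V x"
  shows "\<exists>a b v0. a > 0 \<and> V 0 = ereal v0 \<and> (\<forall>x. ereal (a * norm x - b) \<le> V x)"
proof -
  have "V 0 \<noteq> \<infinity>"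
  proof
    assume "V 0 = \<infinity>"
    then have "V x = \<infinity>" for x using min[of x] by simp
    then show False using int(1) by simp
  qed
  then obtain v0 where v0: "V 0 = ereal v0" using ext_convex_not_MInfty[OF c, of 0] by (cases "V 0") auto
  obtain K :: nat where K: "v0 < real K" using reals_Archimedean2 by blast
  obtain k :: nat where k: "emeasure lborel {x \<in> cball 0 (real k). V x \<le> ereal (real k)} > 0" "k \<ge> K"
    using sublevel_positive[OF assms(2) int(1)] .
  obtain R where R: "\<And>x. V x \<le> ereal (real k) \<Longrightarrow> norm x \<le> R" using sublevel_bounded[OF c assms(2) int(2) k(1)] by blast
  have vk: "v0 < real k" using K k by simp
  have R0: "0 \<le> R" using R[of 0] v0 vk by simp
  define a where "a = (real k - v0) / (R + 1)"
  have a: "a > 0" unfolding a_def using vk R0 by simp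
  have "ereal (a * norm x - (real k - v0 - v0)) \<le> V x" for x
  proof (cases "norm x \<le> R + 1 \<or> V x = \<infinity>")
    case True
    have "V x \<noteq> \<infinity> \<Longrightarrow> a * norm x \<le> a * (R + 1)" using True a by (intro mult_left_mono) auto
    then have "V x \<noteq> \<infinity> \<Longrightarrow> a * norm x - (real k - v0 - v0) \<le> v0" using R0 by (simp add: a_def)
    then show ?thesis using min[of x] v0 by (cases "V x = \<infinity>") (auto intro: order_trans[of _ "ereal v0"])
  next
    case False
    then obtain w where w: "V x = ereal w" using ext_convex_not_MInfty[OF c, of x] by (cases "V x") auto
    define t where "t = (R + 1) / norm x"
    have xR: "R + 1 < norm x" using False by simp
    then have "0 < norm x" using R0 by linarith
    then have t: "0 < t" "t < 1" using xR R0 by (auto simp: t_def)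
    have "norm (t *\<^sub>R x) = R + 1" using False R0 by (auto simp: t_def)
    then have "\<not> V (t *\<^sub>R x) \<le> ereal (real k)" using R[of "t *\<^sub>R x"] by auto
    moreover have "V ((1 - t) *\<^sub>R 0 + t *\<^sub>R x) \<le> ereal ((1 - t) * v0 + t * w)"
      by (rule ext_convex_le_real[OF c]) (use t v0 w in auto)
    then have "V (t *\<^sub>R x) \<le> ereal ((1 - t) * v0 + t * w)" by simp
    ultimately have "\<not> ereal ((1 - t) * v0 + t * w) \<le> ereal (real k)" by (meson order_trans)
    then have "real k < (1 - t) * v0 + t * w" by simp
    then have "real k - v0 < t * (w - v0)" by (simp add: algebra_simps)
    then have "(real k - v0) / t < w - v0" using t by (simp add: field_simps)
    moreover have "(real k - v0) / t = a * norm x" using False R0 by (simp add: t_def a_def)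
    ultimately show ?thesis using w vk by simp
  qed
  then show ?thesis using a v0 by blast
qed

text \<open>Half of the exponent pays for the factor \<open>|x|\<^sup>2\<close>: by the linear growth, \<open>|x|\<^sup>2 exp (- V(x)/2)\<close>
  is bounded. The other half is integrable, since \<open>V(x)/2 \<ge> V(x/2) - V(0)/2\<close> by convexity.\<close>

lemma log_concave_second_moment:
  fixes V :: "'a::euclidean_space \<Rightarrow> ereal"
  assumes c: "ext_convex V" and [measurable]: "V \<in> borel_measurable borel"
    and int: "(\<integral>\<^sup>+x. exp_neg (V x) \<partial>lborel) \<noteq> 0" "(\<integral>\<^sup>+x. exp_neg (V x) \<partial>lborel) \<noteq> \<infinity>"
    and min: "\<And>x. V 0 \<le> V x"
  shows "(\<integral>\<^sup>+x. ennreal ((norm x)\<^sup>2) * exp_neg (V x) \<partial>lborel) < \<infinity>"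
proof -
  obtain a b v0 where a: "a > 0" and v0: "V 0 = ereal v0" and g: "\<And>x. ereal (a * norm x - b) \<le> V x"
    using convex_linear_growth[OF c assms(2) int min] by auto
  define K where "K = 8 / a\<^sup>2 * exp (b / 2) * exp (v0 / 2)"
  have K0: "0 \<le> K" by (simp add: K_def)
  have pt: "ennreal ((norm x)\<^sup>2) * exp_neg (V x) \<le> ennreal K * exp_neg (V (0 + (1/2) *\<^sub>R x))" for x
  proof (cases "V x = \<infinity>")
    case False
    then obtain w where w: "V x = ereal w" using ext_convex_not_MInfty[OF c, of x] by (cases "V x") auto
    have gw: "a * norm x - b \<le> w" using g[of x] w by simp
    have "V ((1 - 1/2) *\<^sub>R 0 + (1/2) *\<^sub>R x) \<le> ereal ((1 - 1/2) * v0 + (1/2) * w)"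
      by (rule ext_convex_le_real[OF c]) (use v0 w in auto)
    then have h: "V (0 + (1/2) *\<^sub>R x) \<le> ereal (v0 / 2 + w / 2)" by simp
    \<comment> \<open>The quadratic term of the exponential series.\<close>
    have "(a * norm x / 2)\<^sup>2 / 2 \<le> exp (a * norm x / 2)"
      using exp_lower_Taylor_quadratic[of "a * norm x / 2"] a by (smt (verit) mult_nonneg_nonneg norm_ge_zero divide_nonneg_nonneg)
    then have "(norm x)\<^sup>2 \<le> 8 / a\<^sup>2 * exp (a * norm x / 2)" using a by (simp add: field_simps power2_eq_square)
    also have "\<dots> \<le> 8 / a\<^sup>2 * exp (b / 2 + w / 2)" using gw a by (intro mult_left_mono) auto
    finally have "(norm x)\<^sup>2 * exp (- w) \<le> 8 / a\<^sup>2 * exp (b / 2 + w / 2) * exp (- w)" by (rule mult_right_mono) simp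
    also have "\<dots> = K * exp (- (v0 / 2 + w / 2))" by (simp add: K_def exp_add[symmetric] mult.assoc)
    finally have "ennreal ((norm x)\<^sup>2) * exp_neg (V x) \<le> ennreal K * exp_neg (ereal (v0 / 2 + w / 2))"
      using K0 by (simp add: w ennreal_mult[symmetric] ennreal_leI)
    also have "\<dots> \<le> ennreal K * exp_neg (V (0 + (1/2) *\<^sub>R x))"
      by (intro mult_left_mono exp_neg_antimono ext_convex_not_MInfty[OF c] h) simp
    finally show ?thesis .
  qed simp
  have "(\<integral>\<^sup>+x. ennreal ((norm x)\<^sup>2) * exp_neg (V x) \<partial>lborel) \<le> (\<integral>\<^sup>+x. ennreal K * exp_neg (V (0 + (1/2) *\<^sub>R x)) \<partial>lborel)"
    by (rule nn_integral_mono) (rule pt)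
  also have "\<dots> = ennreal K * (\<integral>\<^sup>+x. exp_neg (V (0 + (1/2) *\<^sub>R x)) \<partial>lborel)"
    by (rule nn_integral_cmult) measurable
  also have "\<dots> < \<infinity>"
  proof -
    have "(\<integral>\<^sup>+x. exp_neg (V x) \<partial>lborel) = ennreal (\<bar>1/2\<bar> ^ DIM('a)) * (\<integral>\<^sup>+x. exp_neg (V (0 + (1/2) *\<^sub>R x)) \<partial>lborel)"
      by (rule nn_integral_lborel_scale) auto
    then have "(\<integral>\<^sup>+x. exp_neg (V (0 + (1/2) *\<^sub>R x)) \<partial>lborel) \<noteq> \<infinity>" using int(2) by (auto simp: ennreal_mult_eq_top_iff)
    then show ?thesis by (simp add: ennreal_mult_less_top less_top)
  qed
  finally show ?thesis .
qed

section \<open>Sign flips and transport to the cube\<close>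

text \<open>The group of sign changes acts on \<open>\<real>\<^sup>n\<close>; it is indexed by the vertices of the cube, on which
  it acts simply transitively.\<close>

definition flip :: "real^'n \<Rightarrow> real^'n \<Rightarrow> real^'n" where
  "flip \<epsilon> x = (\<chi> i. \<epsilon> $ i * x $ i)"

lemma flip_nth [simp]: "flip \<epsilon> x $ i = \<epsilon> $ i * x $ i"
  by (simp add: flip_def)

lemma cube_sq: "\<epsilon> \<in> cube \<Longrightarrow> \<epsilon> $ i * \<epsilon> $ i = 1"
  by (auto simp: cube_def) (metis mult_1 mult_minus_left mult_minus_right minus_minus)

lemma cube_abs: "\<epsilon> \<in> cube \<Longrightarrow> \<bar>\<epsilon> $ i\<bar> = 1"
  by (auto simp: cube_def) (metis abs_1 abs_minus_cancel)

lemma flip_flip: "\<epsilon> \<in> cube \<Longrightarrow> flip \<epsilon> (flip \<epsilon> x) = x"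
  by (simp add: vec_eq_iff mult.assoc[symmetric] cube_sq)

lemma measurable_flip [measurable]: "flip \<epsilon> \<in> borel \<rightarrow>\<^sub>M borel"
  by (rule measurable_vecI) simp

lemma continuous_flip: "continuous_on UNIV (flip \<epsilon>)"
  unfolding flip_def by (intro continuous_intros)

lemma inner_vec_sum: "(x :: real^'n) \<bullet> y = (\<Sum>i\<in>UNIV. x $ i * y $ i)"
  by (simp add: inner_vec_def)

lemma norm_vec_sq: "(norm (x :: real^'n))\<^sup>2 = (\<Sum>i\<in>UNIV. (x $ i)\<^sup>2)"
  unfolding power2_norm_eq_inner inner_vec_sum by (simp add: power2_eq_square)

lemma norm_flip: "\<epsilon> \<in> cube \<Longrightarrow> norm (flip \<epsilon> x) = norm x"
proof -
  assume "\<epsilon> \<in> cube"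
  then have "(norm (flip \<epsilon> x))\<^sup>2 = (norm x)\<^sup>2"
    unfolding norm_vec_sq by (simp add: power_mult_distrib) (simp add: power2_eq_square cube_sq)
  then show ?thesis by simp
qed

lemma finite_cube: "finite (cube :: (real^'n) set)"
proof (rule finite_subset)
  show "(cube :: (real^'n) set) \<subseteq> vec_lambda ` (\<Pi>\<^sub>E i\<in>UNIV. {-1, 1})"
  proof
    fix x :: "real^'n" assume "x \<in> cube"
    then have "vec_nth x \<in> (\<Pi>\<^sub>E i\<in>UNIV. {-1, 1})" by (auto simp: cube_def)
    then show "x \<in> vec_lambda ` (\<Pi>\<^sub>E i\<in>UNIV. {-1, 1})" by (metis image_eqI vec_nth_inverse)
  qed
qed (intro finite_imageI finite_PiE; simp)

lemma one_in_cube: "(\<chi> i. 1) \<in> cube"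
  by (simp add: cube_def)

lemma cube_nonempty: "cube \<noteq> {}"
  using one_in_cube by blast

lemma lborel_flip:
  assumes e: "\<epsilon> \<in> (cube :: (real^'n) set)"
  shows "distr lborel borel (flip \<epsilon>) = lborel"
proof -
  have T: "0 + (\<Sum>j\<in>Basis. ((\<epsilon> \<bullet> j) * (x \<bullet> j)) *\<^sub>R j) = flip \<epsilon> x" for x
  proof -
    have "flip \<epsilon> x \<bullet> j = (\<epsilon> \<bullet> j) * (x \<bullet> j)" if "j \<in> Basis" for j
      using that by (auto simp: Basis_vec_def inner_axis)
    then have "(\<Sum>j\<in>Basis. ((\<epsilon> \<bullet> j) * (x \<bullet> j)) *\<^sub>R j) = (\<Sum>j\<in>Basis. (flip \<epsilon> x \<bullet> j) *\<^sub>R j)"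
      by (intro sum.cong) auto
    then show ?thesis by (simp only: euclidean_representation add_0)
  qed
  have nz: "\<epsilon> \<bullet> j \<noteq> 0" "\<bar>\<epsilon> \<bullet> j\<bar> = 1" if "j \<in> Basis" for j
  proof -
    show "\<bar>\<epsilon> \<bullet> j\<bar> = 1" using that cube_abs[OF e] by (auto simp: Basis_vec_def inner_axis)
    then show "\<epsilon> \<bullet> j \<noteq> 0" by auto
  qed
  have "(lborel :: (real^'n) measure) = density (distr lborel borel (\<lambda>x. 0 + (\<Sum>j\<in>Basis. ((\<epsilon> \<bullet> j) * (x \<bullet> j)) *\<^sub>R j))) (\<lambda>_. (\<Prod>j\<in>Basis. \<bar>\<epsilon> \<bullet> j\<bar>))"
    by (rule lborel_affine_euclidean) (rule nz)
  also have "\<dots> = density (distr lborel borel (flip \<epsilon>)) (\<lambda>_. 1)"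
    unfolding T using nz by simp
  finally show ?thesis by (simp add: density_1)
qed

lemma exp_neg_inj: "a \<noteq> -\<infinity> \<Longrightarrow> b \<noteq> -\<infinity> \<Longrightarrow> exp_neg a = exp_neg b \<Longrightarrow> a = b"
  by (cases a; cases b) (auto simp: exp_neg_def)

lemma distr_flip_exp_neg_measure:
  fixes V :: "real^'n \<Rightarrow> ereal"
  assumes [measurable]: "V \<in> borel_measurable borel" and e: "\<epsilon> \<in> cube"
  shows "distr (exp_neg_measure V) borel (flip \<epsilon>) = exp_neg_measure (\<lambda>x. V (flip \<epsilon> x))"
proof -
  have "exp_neg_measure (\<lambda>x. V (flip \<epsilon> x)) = density (distr lborel borel (flip \<epsilon>)) (\<lambda>x. exp_neg (V (flip \<epsilon> x)))"
    by (simp add: exp_neg_measure_def lborel_flip[OF e])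
  also have "\<dots> = distr (density lborel (\<lambda>x. exp_neg (V (flip \<epsilon> (flip \<epsilon> x))))) borel (flip \<epsilon>)"
    by (rule density_distr) measurable
  finally show ?thesis by (simp add: flip_flip[OF e] exp_neg_measure_def)
qed

text \<open>Invariance of the measure gives invariance of \<open>V\<close> almost everywhere, and convexity together
  with lower semicontinuity extends it to all points. Pointwise invariance is needed on lines of
  measure zero, in particular for the gradient.\<close>

lemma unconditional_imp_flip_invariant:
  fixes V :: "real^'n \<Rightarrow> ereal"
  assumes c: "ext_convex V" and lsc: "lower_semicontinuous V"
    and u: "unconditional (exp_neg_measure V)" and p: "prob_space (exp_neg_measure V)"
    and e: "\<epsilon> \<in> cube"
  shows "V (flip \<epsilon> x) = V x"
proof -
  have V[measurable]: "V \<in> borel_measurable borel" by (rule lsc_measurable[OF lsc])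
  have int: "(\<integral>\<^sup>+x. exp_neg (V x) \<partial>lborel) = 1"
    using prob_space.emeasure_space_1[OF p] by (simp add: exp_neg_measure_def emeasure_density)
  have "density lborel (\<lambda>x. exp_neg (V (flip \<epsilon> x))) = density lborel (\<lambda>x. exp_neg (V x))"
    using u e distr_flip_exp_neg_measure[OF V e] unfolding unconditional_def flip_def[symmetric] exp_neg_measure_def by auto
  then have "AE x in lborel. exp_neg (V (flip \<epsilon> x)) = exp_neg (V x)"
    by (subst (asm) sigma_finite_measure.density_unique_iff[OF sigma_finite_lborel]) auto
  then have AE: "AE x in lborel. V x = V (flip \<epsilon> x)"
    by eventually_elim (auto intro!: exp_neg_inj ext_convex_not_MInfty[OF c])
  have o: "open {x. a < V (flip \<epsilon> x)}" for a
    using open_vimage[OF lsc_open[OF lsc, of a] continuous_flip[of \<epsilon>]] by (simp add: vimage_def)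
  have le: "V (flip \<epsilon> x) \<le> V x" for x
    by (rule convex_AE_eq_imp_le[OF c V _ o AE]) (simp add: int)
  show ?thesis using le[of x] le[of "flip \<epsilon> x"] by (simp add: flip_flip[OF e])
qed

lemma has_ext_gradient_flip:
  fixes V :: "real^'n \<Rightarrow> ereal"
  assumes inv: "\<And>x. V (flip \<epsilon> x) = V x" and e: "\<epsilon> \<in> cube" and D: "has_ext_gradient V x D"
  shows "has_ext_gradient V (flip \<epsilon> x) (flip \<epsilon> D)"
proof -
  have 1: "V (flip \<epsilon> x + h) = V (x + flip \<epsilon> h)" for h
  proof -
    have "flip \<epsilon> x + h = flip \<epsilon> (x + flip \<epsilon> h)"
      by (simp add: vec_eq_iff distrib_left mult.assoc[symmetric] cube_sq[OF e])
    then show ?thesis by (simp add: inv)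
  qed
  have 2: "h \<bullet> flip \<epsilon> D = flip \<epsilon> h \<bullet> D" for h by (simp add: inner_vec_sum mult_ac)
  show ?thesis
    using D unfolding has_ext_gradient_eps 1 2 inv by (metis norm_flip[OF e])
qed

lemma ext_gradient_flip:
  fixes V :: "real^'n \<Rightarrow> ereal"
  assumes inv: "\<And>x. V (flip \<epsilon> x) = V x" and e: "\<epsilon> \<in> cube"
  shows "ext_gradient V (flip \<epsilon> x) = flip \<epsilon> (ext_gradient V x)"
proof (cases "ext_differentiable V x")
  case True
  then show ?thesis using ext_gradient_eq[OF has_ext_gradient_flip[where V=V and \<epsilon>=\<epsilon>, OF inv e ext_differentiableD]] by simp
next
  case False
  moreover have "\<not> ext_differentiable V (flip \<epsilon> x)"
    using False has_ext_gradient_flip[where V=V and \<epsilon>=\<epsilon>, OF inv e, of "flip \<epsilon> x"] unfolding ext_differentiable_def by (auto simp: flip_flip[OF e])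
  ultimately show ?thesis by (simp add: ext_gradient_not_differentiable vec_eq_iff)
qed

lemma unconditional_moment_measure:
  fixes V :: "real^'n \<Rightarrow> ereal"
  assumes c: "ext_convex V" and V[measurable]: "V \<in> borel_measurable borel"
    and inv: "\<And>\<epsilon> x. \<epsilon> \<in> cube \<Longrightarrow> V (flip \<epsilon> x) = V x"
  shows "unconditional (moment_measure V)"
  unfolding unconditional_def flip_def[symmetric]
proof
  fix \<epsilon> :: "real^'n" assume e: "\<epsilon> \<in> cube"
  note [measurable] = measurable_ext_gradient[OF c V]
  have [measurable_cong]: "sets (exp_neg_measure V) = sets borel" by (simp add: exp_neg_measure_def)
  have "distr (moment_measure V) borel (flip \<epsilon>) = distr (exp_neg_measure V) borel (\<lambda>x. flip \<epsilon> (ext_gradient V x))"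
    unfolding moment_measure_def by (subst distr_distr) (auto simp: o_def)
  also have "\<dots> = distr (exp_neg_measure V) borel (\<lambda>x. ext_gradient V (flip \<epsilon> x))"
    by (simp add: ext_gradient_flip[where V=V and \<epsilon>=\<epsilon>, OF inv[OF e] e])
  also have "\<dots> = distr (distr (exp_neg_measure V) borel (flip \<epsilon>)) borel (ext_gradient V)"
    by (subst distr_distr) (auto simp: o_def)
  also have "\<dots> = moment_measure V"
    by (simp add: distr_flip_exp_neg_measure[OF V e] inv[OF e] moment_measure_def)
  finally show "distr (moment_measure V) borel (flip \<epsilon>) = moment_measure V" .
qed

lemma space_uniform_cube [simp]: "space uniform_cube = UNIV" "sets uniform_cube = sets borel"
  by (simp_all add: uniform_cube_def)

lemma measurable_cube_id: "(\<lambda>x. x) \<in> uniform_count_measure cube \<rightarrow>\<^sub>M borel"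
  by (simp add: uniform_count_measure_def)

lemma nn_integral_uniform_cube:
  fixes F :: "real^'n \<Rightarrow> ennreal"
  assumes [measurable]: "F \<in> borel_measurable borel"
  shows "(\<integral>\<^sup>+x. F x \<partial>uniform_cube) = ennreal (1 / real (card (cube :: (real^'n) set))) * (\<Sum>\<epsilon>\<in>cube. F \<epsilon>)"
proof -
  have "(\<integral>\<^sup>+x. F x \<partial>uniform_cube) = (\<integral>\<^sup>+x. F x \<partial>uniform_count_measure cube)"
    unfolding uniform_cube_def by (rule nn_integral_distr[OF measurable_cube_id]) simp
  also have "\<dots> = (\<Sum>\<epsilon>\<in>cube. ennreal (1 / real (card (cube :: (real^'n) set))) * F \<epsilon>)"
    unfolding uniform_count_measure_def by (rule nn_integral_point_measure_finite[OF finite_cube])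
  finally show ?thesis by (simp add: sum_distrib_left)
qed

lemma prob_space_uniform_cube: "prob_space (uniform_cube :: (real^'n) measure)"
  unfolding uniform_cube_def
  by (rule prob_space.prob_space_distr[OF prob_space_uniform_count_measure[OF finite_cube cube_nonempty] measurable_cube_id])

lemma AE_uniform_cube: "AE x in uniform_cube. x \<in> (cube :: (real^'n) set)"
proof -
  have [measurable]: "(cube :: (real^'n) set) \<in> sets borel" by (intro borel_closed finite_imp_closed finite_cube)
  have "AE x in uniform_count_measure (cube :: (real^'n) set). x \<in> cube" by (rule AE_I2) (simp add: uniform_count_measure_def space_point_measure)
  then show ?thesis unfolding uniform_cube_def by (subst AE_distr_iff[OF measurable_cube_id]) auto
qed

text \<open>The squared distance from \<open>y\<close> to a nearest vertex of the cube.\<close>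

definition cube_cost :: "real^'n \<Rightarrow> real" where
  "cube_cost y = (\<Sum>i\<in>UNIV. (\<bar>y $ i\<bar> - 1)\<^sup>2)"

lemma measurable_cube_cost [measurable]: "cube_cost \<in> borel_measurable borel"
  unfolding cube_cost_def[abs_def] by measurable

definition abs_vec :: "real^'n \<Rightarrow> real^'n" where
  "abs_vec y = (\<chi> i. \<bar>y $ i\<bar>)"

text \<open>Replacing \<open>y\<close> by \<open>|y|\<close> permutes its orbit under sign changes.\<close>

lemma sum_cube_flip_abs:
  fixes F :: "real^'n \<Rightarrow> ennreal"
  shows "(\<Sum>\<epsilon>\<in>cube. F (flip \<epsilon> (abs_vec y))) = (\<Sum>\<epsilon>\<in>cube. F (flip \<epsilon> y))"
proof -
  define s :: "real^'n" where "s = (\<chi> i. if y $ i \<ge> 0 then 1 else -1)"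
  have s: "s \<in> cube" by (simp add: s_def cube_def)
  have abs: "abs_vec y = flip s y" by (simp add: abs_vec_def s_def vec_eq_iff)
  have c: "flip \<epsilon> s \<in> cube" if "\<epsilon> \<in> cube" for \<epsilon>
  proof -
    have "flip \<epsilon> s $ i \<in> {-1, 1}" for i
    proof -
      have "\<epsilon> $ i \<in> {-1, 1}" "s $ i \<in> {-1, 1}" using that s by (simp_all add: cube_def)
      then show ?thesis by auto
    qed
    then show ?thesis by (simp add: cube_def)
  qed
  have inv: "flip (flip \<epsilon> s) s = \<epsilon>" for \<epsilon> by (simp add: vec_eq_iff mult.assoc cube_sq[OF s])
  show ?thesis
    by (rule sum.reindex_bij_witness[where i="\<lambda>\<epsilon>. flip \<epsilon> s" and j="\<lambda>\<epsilon>. flip \<epsilon> s"])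
       (auto simp: c inv abs intro!: arg_cong[where f=F] simp: vec_eq_iff)
qed

text \<open>Every coupling costs at least the distance to the cube, pointwise. This is attained by the
  joint law of \<open>(\<epsilon> |y|, \<epsilon>)\<close>, where \<open>\<epsilon>\<close> is uniform on the cube and independent of \<open>y\<close>: its first
  marginal is \<open>\<nu>\<close> because \<open>\<nu>\<close> is unconditional, and \<open>\<epsilon> |y|\<close> has \<open>\<epsilon>\<close> as a nearest vertex.\<close>

lemma wasserstein2_sq_uniform_cube:
  fixes \<nu> :: "(real^'n) measure"
  assumes p: "prob_space \<nu>" and s[simp, measurable_cong]: "sets \<nu> = sets borel" and u: "unconditional \<nu>"
  shows "wasserstein2_sq \<nu> uniform_cube = (\<integral>\<^sup>+y. ennreal (cube_cost y) \<partial>\<nu>)"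
proof (rule antisym)
  have [simp]: "space \<nu> = UNIV" using sets_eq_imp_space_eq[OF s] by simp
  have sc[measurable_cong]: "sets (uniform_cube :: (real^'n) measure) = sets borel" by simp
  interpret P: pair_prob_space \<nu> "uniform_cube :: (real^'n) measure"
    by (intro pair_prob_space.intro pair_sigma_finite.intro prob_space_imp_sigma_finite p prob_space_uniform_cube)
  have m1[measurable]: "(\<lambda>p. flip (snd p) (abs_vec (fst p))) \<in> \<nu> \<Otimes>\<^sub>M uniform_cube \<rightarrow>\<^sub>M borel"
    by (rule measurable_vecI) (simp add: abs_vec_def)
  \<comment> \<open>The optimal coupling.\<close>
  define T where "T p = (flip (snd p) (abs_vec (fst p)), snd p)" for p :: "(real^'n) \<times> (real^'n)"
  have T[measurable]: "T \<in> \<nu> \<Otimes>\<^sub>M uniform_cube \<rightarrow>\<^sub>M borel"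
    unfolding T_def borel_prod[symmetric] by measurable
  have fm: "fst \<in> (borel :: ((real^'n) \<times> (real^'n)) measure) \<rightarrow>\<^sub>M borel" "snd \<in> (borel :: ((real^'n) \<times> (real^'n)) measure) \<rightarrow>\<^sub>M borel"
    by (simp_all add: borel_prod[symmetric])
  define \<pi> where "\<pi> = distr (\<nu> \<Otimes>\<^sub>M uniform_cube) borel T"
  have c1: "distr \<pi> borel fst = \<nu>"
  proof (rule measure_eqI)
    fix A assume "A \<in> sets (distr \<pi> borel fst)"
    then have [measurable]: "A \<in> sets borel" by simp
    have "distr \<pi> borel fst = distr (\<nu> \<Otimes>\<^sub>M uniform_cube) borel (\<lambda>p. flip (snd p) (abs_vec (fst p)))"
      unfolding \<pi>_def by (subst distr_distr[OF fm(1) T]) (simp add: T_def o_def)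
    then have "emeasure (distr \<pi> borel fst) A = (\<integral>\<^sup>+p. indicator A (flip (snd p) (abs_vec (fst p))) \<partial>(\<nu> \<Otimes>\<^sub>M uniform_cube))"
      by (simp add: nn_integral_indicator[symmetric] nn_integral_distr del: nn_integral_indicator)
    also have "\<dots> = (\<integral>\<^sup>+y. (\<integral>\<^sup>+\<epsilon>. indicator A (flip \<epsilon> (abs_vec y)) \<partial>uniform_cube) \<partial>\<nu>)"
      by (subst P.M2.nn_integral_fst[symmetric]) auto
    also have "\<dots> = (\<integral>\<^sup>+y. ennreal (1 / real (card (cube :: (real^'n) set))) * (\<Sum>\<epsilon>\<in>cube. indicator A (flip \<epsilon> y)) \<partial>\<nu>)"
    proof (rule nn_integral_cong)
      fix y :: "real^'n"
      have [measurable]: "(\<lambda>\<epsilon>. flip \<epsilon> (abs_vec y)) \<in> borel \<rightarrow>\<^sub>M borel" by (rule measurable_vecI) simp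
      have "(\<integral>\<^sup>+\<epsilon>. indicator A (flip \<epsilon> (abs_vec y)) \<partial>uniform_cube)
         = ennreal (1 / real (card (cube :: (real^'n) set))) * (\<Sum>\<epsilon>\<in>cube. indicator A (flip \<epsilon> (abs_vec y)))"
        by (rule nn_integral_uniform_cube) measurable
      then show "(\<integral>\<^sup>+\<epsilon>. indicator A (flip \<epsilon> (abs_vec y)) \<partial>uniform_cube)
         = ennreal (1 / real (card (cube :: (real^'n) set))) * (\<Sum>\<epsilon>\<in>cube. indicator A (flip \<epsilon> y))"
        by (simp add: sum_cube_flip_abs)
    qed
    also have "\<dots> = ennreal (1 / real (card (cube :: (real^'n) set))) * (\<Sum>\<epsilon>\<in>cube. \<integral>\<^sup>+y. indicator A (flip \<epsilon> y) \<partial>\<nu>)"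
      by (simp add: nn_integral_cmult nn_integral_sum)
    also have "(\<Sum>\<epsilon>\<in>cube. \<integral>\<^sup>+y. indicator A (flip \<epsilon> y) \<partial>\<nu>) = (\<Sum>\<epsilon>\<in>(cube :: (real^'n) set). emeasure \<nu> A)"
    proof (rule sum.cong[OF refl])
      fix \<epsilon> :: "real^'n" assume "\<epsilon> \<in> cube"
      then have d: "distr \<nu> borel (flip \<epsilon>) = \<nu>" using u unfolding unconditional_def flip_def[symmetric] by blast
      have "(\<integral>\<^sup>+y. indicator A (flip \<epsilon> y) \<partial>\<nu>) = (\<integral>\<^sup>+y. indicator A y \<partial>distr \<nu> borel (flip \<epsilon>))"
        by (subst nn_integral_distr) auto
      then show "(\<integral>\<^sup>+y. indicator A (flip \<epsilon> y) \<partial>\<nu>) = emeasure \<nu> A" by (simp add: d)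
    qed
    also have "ennreal (1 / real (card (cube :: (real^'n) set))) * (\<Sum>\<epsilon>\<in>(cube :: (real^'n) set). emeasure \<nu> A) = emeasure \<nu> A"
    proof -
      have "card (cube :: (real^'n) set) \<noteq> 0" by (simp add: card_eq_0_iff finite_cube cube_nonempty)
      then have "ennreal (1 / real (card (cube :: (real^'n) set))) * of_nat (card (cube :: (real^'n) set)) = 1"
        by (simp add: ennreal_of_nat_eq_real_of_nat ennreal_mult'[symmetric])
      then show ?thesis by (simp add: mult.assoc[symmetric])
    qed
    finally show "emeasure (distr \<pi> borel fst) A = emeasure \<nu> A" .
  qed simp
  have c2: "distr \<pi> borel snd = uniform_cube"
  proof -
    have "distr \<pi> borel snd = distr (\<nu> \<Otimes>\<^sub>M uniform_cube) borel snd"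
      unfolding \<pi>_def by (subst distr_distr[OF fm(2) T]) (simp add: T_def o_def)
    also have "\<dots> = uniform_cube"
    proof (rule measure_eqI)
      fix A assume "A \<in> sets (distr (\<nu> \<Otimes>\<^sub>M (uniform_cube :: (real^'n) measure)) borel snd)"
      then have [measurable]: "A \<in> sets borel" by simp
      have "emeasure (distr (\<nu> \<Otimes>\<^sub>M uniform_cube) borel snd) A = emeasure (\<nu> \<Otimes>\<^sub>M uniform_cube) (UNIV \<times> A)"
        by (subst emeasure_distr) (auto simp: space_pair_measure vimage_snd)
      also have "\<dots> = emeasure \<nu> UNIV * emeasure uniform_cube A"
        by (rule P.M2.emeasure_pair_measure_Times) auto
      finally show "emeasure (distr (\<nu> \<Otimes>\<^sub>M uniform_cube) borel snd) A = emeasure uniform_cube A"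
        using P.M1.emeasure_space_1 by simp
    qed simp
    finally show ?thesis .
  qed
  have "\<pi> \<in> couplings \<nu> uniform_cube"
    unfolding couplings_def using c1 c2 P.prob_space_distr[OF T] by (simp add: \<pi>_def)
  then have "wasserstein2_sq \<nu> uniform_cube \<le> (\<integral>\<^sup>+(x, y). ennreal ((norm (x - y))\<^sup>2) \<partial>\<pi>)"
    unfolding wasserstein2_sq_def by (rule INF_lower)
  also have "\<dots> = (\<integral>\<^sup>+p. ennreal ((norm (flip (snd p) (abs_vec (fst p)) - snd p))\<^sup>2) \<partial>(\<nu> \<Otimes>\<^sub>M uniform_cube))"
  proof -
    note [measurable] = fm
    have "(\<lambda>p. case p of (x, y) \<Rightarrow> ennreal ((norm (x - y))\<^sup>2)) \<in> borel_measurable (borel :: ((real^'n) \<times> (real^'n)) measure)"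
      unfolding split_beta' by measurable
    then have "(\<lambda>p. case p of (x, y) \<Rightarrow> ennreal ((norm (x - y))\<^sup>2)) \<in> borel_measurable (distr (\<nu> \<Otimes>\<^sub>M uniform_cube) borel T)"
      by simp
    from nn_integral_distr[OF T this] show ?thesis unfolding \<pi>_def by (simp add: T_def)
  qed
  also have "\<dots> = (\<integral>\<^sup>+y. (\<integral>\<^sup>+\<epsilon>. ennreal ((norm (flip \<epsilon> (abs_vec y) - \<epsilon>))\<^sup>2) \<partial>uniform_cube) \<partial>\<nu>)"
    by (subst P.M2.nn_integral_fst[symmetric]) auto
  also have "\<dots> = (\<integral>\<^sup>+y. (\<integral>\<^sup>+(\<epsilon>::real^'n). ennreal (cube_cost y) \<partial>uniform_cube) \<partial>\<nu>)"
  proof (rule nn_integral_cong, rule nn_integral_cong_AE)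
    fix y :: "real^'n"
    show "AE \<epsilon> in uniform_cube. ennreal ((norm (flip \<epsilon> (abs_vec y) - \<epsilon>))\<^sup>2) = ennreal (cube_cost y)"
      using AE_uniform_cube
    proof eventually_elim
      case (elim \<epsilon>)
      have "(\<epsilon> $ i * \<bar>y $ i\<bar> - \<epsilon> $ i)\<^sup>2 = (\<bar>y $ i\<bar> - 1)\<^sup>2" for i
      proof -
        have "(\<epsilon> $ i * \<bar>y $ i\<bar> - \<epsilon> $ i)\<^sup>2 = (\<epsilon> $ i * \<epsilon> $ i) * (\<bar>y $ i\<bar> - 1)\<^sup>2" by (simp add: power2_eq_square algebra_simps)
        then show ?thesis by (simp add: cube_sq[OF elim])
      qed
      then show ?case by (simp add: norm_vec_sq abs_vec_def cube_cost_def)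
    qed
  qed
  also have "\<dots> = (\<integral>\<^sup>+y. ennreal (cube_cost y) \<partial>\<nu>)"
    using P.M2.emeasure_space_1 by simp
  finally show "wasserstein2_sq \<nu> uniform_cube \<le> (\<integral>\<^sup>+y. ennreal (cube_cost y) \<partial>\<nu>)" .
next
  show "(\<integral>\<^sup>+y. ennreal (cube_cost y) \<partial>\<nu>) \<le> wasserstein2_sq \<nu> uniform_cube"
    unfolding wasserstein2_sq_def
  proof (rule INF_greatest)
    fix \<pi> assume "\<pi> \<in> couplings \<nu> (uniform_cube :: (real^'n) measure)"
    then have sp[measurable_cong]: "sets \<pi> = sets borel" and d1: "distr \<pi> borel fst = \<nu>" and d2: "distr \<pi> borel snd = uniform_cube"
      by (auto simp: couplings_def)
    have f[measurable]: "fst \<in> \<pi> \<rightarrow>\<^sub>M (borel :: (real^'n) measure)" "snd \<in> \<pi> \<rightarrow>\<^sub>M (borel :: (real^'n) measure)"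
      unfolding measurable_cong_sets[OF sp refl] by (simp_all add: borel_prod[symmetric])
    have "AE y in distr \<pi> borel snd. y \<in> cube" unfolding d2 by (rule AE_uniform_cube)
    then have AE: "AE p in \<pi>. snd p \<in> cube" by (rule AE_distrD[OF f(2)])
    have "(\<integral>\<^sup>+y. ennreal (cube_cost y) \<partial>\<nu>) = (\<integral>\<^sup>+p. ennreal (cube_cost (fst p)) \<partial>\<pi>)"
      unfolding d1[symmetric] by (subst nn_integral_distr) auto
    also have "\<dots> \<le> (\<integral>\<^sup>+p. (case p of (x, y) \<Rightarrow> ennreal ((norm (x - y))\<^sup>2)) \<partial>\<pi>)"
    proof (rule nn_integral_mono_AE)
      show "AE p in \<pi>. ennreal (cube_cost (fst p)) \<le> (case p of (x, y) \<Rightarrow> ennreal ((norm (x - y))\<^sup>2))"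
        using AE
      proof eventually_elim
        case (elim p)
        have "(\<bar>fst p $ i\<bar> - 1)\<^sup>2 \<le> (fst p $ i - snd p $ i)\<^sup>2" for i
        proof -
          have "\<bar>\<bar>fst p $ i\<bar> - \<bar>snd p $ i\<bar>\<bar> \<le> \<bar>fst p $ i - snd p $ i\<bar>" by (rule abs_triangle_ineq3)
          then show ?thesis by (simp add: cube_abs[OF elim] abs_le_square_iff)
        qed
        then show ?case by (auto simp: norm_vec_sq cube_cost_def split_beta' intro!: ennreal_leI sum_mono)
      qed
    qed
    finally show "(\<integral>\<^sup>+y. ennreal (cube_cost y) \<partial>\<nu>) \<le> (\<integral>\<^sup>+p. (case p of (x, y) \<Rightarrow> ennreal ((norm (x - y))\<^sup>2)) \<partial>\<pi>)" .
  qed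
qed

section \<open>Fisher information of log-concave measures\<close>

definition gauss_density :: "real^'n \<Rightarrow> real" where
  "gauss_density x = (2 * pi) powr (- real CARD('n) / 2) * exp (- (norm x)\<^sup>2 / 2)"

lemma gauss_density_pos: "0 < gauss_density x"
  by (simp add: gauss_density_def)

lemma measurable_gauss_density [measurable]: "gauss_density \<in> borel_measurable borel"
  unfolding gauss_density_def[abs_def] by measurable

lemma gauss_eq: "(gauss :: (real^'n) measure) = density lborel (\<lambda>x. ennreal (gauss_density x))"
  by (simp add: gauss_def gauss_density_def)

lemma sets_gauss [simp, measurable_cong]: "sets gauss = sets borel"
  by (simp add: gauss_def)

lemma space_gauss [simp]: "space gauss = UNIV"
  by (simp add: gauss_def)

lemma gauss_density_line: "gauss_density (line i (vec_nth x) t) = gauss_density (line i (vec_nth x) 0) * exp (- t\<^sup>2 / 2)"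
proof -
  have "(norm (line i (vec_nth x) t))\<^sup>2 = (norm (line i (vec_nth x) 0))\<^sup>2 + t\<^sup>2" for t
    unfolding norm_vec_sq by (simp add: sum.remove[of UNIV i])
  from this[of t] show ?thesis
    unfolding gauss_density_def by (simp only: mult.assoc exp_add[symmetric]) (simp add: add_divide_distrib diff_divide_distrib)
qed

text \<open>A property of the line through a point holds at almost every point as soon as it holds for
  almost every line. It will be applied to continuity of a restriction, a property whose
  measurability is not evident.\<close>

lemma AE_line_const:
  assumes "AE y in \<Pi>\<^sub>M j\<in>UNIV - {i}. (lborel :: real measure). P (line i y)"
  shows "AE x in lborel. P (line i (vec_nth x))"
proof -
  have "AE x in \<Pi>\<^sub>M j\<in>insert i (UNIV - {i}). (lborel :: real measure). P (line i (restrict x (UNIV - {i})))"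
    by (rule AE_PiM_restrict) (use assms in auto)
  moreover have "line i (restrict x (UNIV - {i})) = line i x" for x by (auto simp: line_def vec_eq_iff fun_eq_iff)
  ultimately show ?thesis unfolding insert_Diff_UNIV AE_vec_iff by (simp add: vec_lambda_inverse)
qed

lemma abs_continuous_imp_continuous:
  assumes "\<And>a b. abs_continuous_on_segment a b f"
  shows "continuous_on UNIV f"
proof (rule continuous_at_imp_continuous_on, rule ballI)
  fix x :: real
  show "isCont f x" unfolding continuous_at_eps_delta
  proof (intro allI impI)
    fix e :: real assume "e > 0"
    from assms[of "x - 1" "x + 1", unfolded abs_continuous_on_segment_def, THEN spec, THEN mp, OF this]
    obtain d where d0: "d > 0" and D: "\<forall>D :: (real \<times> real) set. finite D \<and> (\<forall>(u, v)\<in>D. x - 1 \<le> u \<and> u \<le> v \<and> v \<le> x + 1) \<and>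
        disjoint_family_on (\<lambda>(u, v). {u<..<v}) D \<and> (\<Sum>(u, v)\<in>D. v - u) < d \<longrightarrow> (\<Sum>(u, v)\<in>D. \<bar>f v - f u\<bar>) < e"
      by (elim exE conjE)
    have single: "\<bar>f v - f u\<bar> < e" if "x - 1 \<le> u" "u \<le> v" "v \<le> x + 1" "v - u < d" for u v
      using D[THEN spec, of "{(u, v)}"] that by (simp add: disjoint_family_on_def)
    show "\<exists>d>0. \<forall>x'. dist x' x < d \<longrightarrow> dist (f x') (f x) < e"
    proof (rule exI[of _ "min d 1"], intro conjI allI impI)
      fix y assume "dist y x < min d 1"
      then have y: "\<bar>y - x\<bar> < d" "\<bar>y - x\<bar> < 1" by (auto simp: dist_norm)
      show "dist (f y) (f x) < e"
      proof (cases "x \<le> y")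
        case True then show ?thesis using single[of x y] y by (auto simp: dist_norm)
      next
        case False then show ?thesis using single[of y x] y by (auto simp: dist_norm abs_minus_commute)
      qed
    qed (use d0 in auto)
  qed
qed

text \<open>Identifies a version of a density with the exponential formula at every point of an
  interval, so that both have the same derivative.\<close>

lemma continuous_AE_eq_imp_eq:
  fixes f g :: "real \<Rightarrow> real"
  assumes f: "continuous_on {a<..<b} f" and g: "continuous_on {a<..<b} g"
    and eq: "AE t in lborel. a < t \<and> t < b \<longrightarrow> f t = g t" and t: "a < t" "t < b"
  shows "f t = g t"
proof (rule ccontr)
  assume n: "f t \<noteq> g t"
  have "continuous_on {a<..<b} (\<lambda>t. f t - g t)" by (intro continuous_intros f g)
  then have "isCont (\<lambda>t. f t - g t) t" using t by (simp add: continuous_on_eq_continuous_at)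
  then obtain d where d: "d > 0" "\<And>s. dist s t < d \<Longrightarrow> dist (f s - g s) (f t - g t) < \<bar>f t - g t\<bar>"
    unfolding continuous_at_eps_delta using n by (meson right_minus_eq zero_less_abs_iff)
  obtain s where s: "t < s" "s < min b (t + d)" "a < s \<and> s < b \<longrightarrow> f s = g s"
    using AE_ex_Ioo[OF eq, of t "min b (t + d)"] t d(1) by auto
  then have "f s = g s" using t by auto
  then show False using d(2)[of s] s by (auto simp: dist_norm)
qed

text \<open>Near a point of differentiability \<open>v\<close> is finite, and a finite convex function on an open
  interval is continuous.\<close>

lemma ext_differentiable_convex_continuous:
  fixes v :: "real \<Rightarrow> ereal"
  assumes c: "ext_convex v" and d: "ext_differentiable v s"
  shows "\<exists>a b u. a < s \<and> s < b \<and> (\<forall>t. a < t \<and> t < b \<longrightarrow> v t = ereal (u t)) \<and> continuous_on {a<..<b} u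
    \<and> (u has_real_derivative ext_gradient v s) (at s)"
proof -
  have fin: "\<forall>\<^sub>F y in nhds s. \<bar>v y\<bar> \<noteq> \<infinity>"
    and der: "((\<lambda>y. real_of_ereal (v y)) has_derivative (\<lambda>h. h \<bullet> ext_gradient v s)) (at s)"
    using ext_differentiableD[OF d] unfolding has_ext_gradient_def gderiv_def by blast+
  then obtain e where e: "e > 0" "\<And>y. dist y s < e \<Longrightarrow> \<bar>v y\<bar> \<noteq> \<infinity>" unfolding eventually_nhds_metric by blast
  define u where "u y = real_of_ereal (v y)" for y
  have v: "v t = ereal (u t)" if "s - e < t" "t < s + e" for t
    using e(2)[of t] that by (cases "v t") (auto simp: u_def dist_norm abs_less_iff)
  have "convex_on {s - e<..<s + e} u"
  proof (rule convex_onI)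
    fix t x y :: real assume t: "0 < t" "t < 1" and xy: "x \<in> {s - e<..<s + e}" "y \<in> {s - e<..<s + e}"
    have "(1 - t) *\<^sub>R x + t *\<^sub>R y \<in> {s - e<..<s + e}"
      using convexD_alt[OF convex_real_interval(8) xy, of t] t by simp
    moreover have "v ((1 - t) *\<^sub>R x + t *\<^sub>R y) \<le> ereal ((1 - t) * u x + t * u y)"
      by (rule ext_convex_le_real[OF c]) (use xy t v in auto)
    ultimately show "u ((1 - t) *\<^sub>R x + t *\<^sub>R y) \<le> (1 - t) * u x + t * u y" using v by simp
  qed (rule convex_real_interval(8))
  then have "continuous_on {s - e<..<s + e} u" by (rule convex_on_continuous[rotated]) simp
  moreover have "(u has_real_derivative ext_gradient v s) (at s)"
    using der unfolding u_def by (simp add: has_field_derivative_def mult_commute_abs)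
  ultimately show ?thesis using e(1) v by (intro exI[of _ "s - e"] exI[of _ "s + e"] exI[of _ u]) auto
qed

text \<open>A version \<open>h\<close> of the density with respect to the Gaussian measure that competes in the
  infimum defining the Fisher information.\<close>

locale fisher_version =
  fixes V :: "real^'n \<Rightarrow> ereal" and h :: "real^'n \<Rightarrow> real"
  assumes c: "ext_convex V" and V[measurable]: "V \<in> borel_measurable borel"
    and fin: "(\<integral>\<^sup>+x. exp_neg (V x) \<partial>lborel) < \<infinity>"
    and h[measurable]: "h \<in> borel_measurable borel" and h0: "\<And>x. 0 \<le> h x"
    and dens: "exp_neg_measure V = density gauss (\<lambda>x. ennreal (h x))"
    and ac: "abs_continuous_on_lines (\<lambda>x. sqrt (h x))"
begin

lemma AE_density: "AE x in lborel. exp_neg (V x) = ennreal (h x * gauss_density x)"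
proof -
  have "density lborel (\<lambda>x. exp_neg (V x)) = density lborel (\<lambda>x. ennreal (gauss_density x) * ennreal (h x))"
    using dens unfolding exp_neg_measure_def gauss_eq by (simp add: density_density_eq)
  then have "AE x in lborel. exp_neg (V x) = ennreal (gauss_density x) * ennreal (h x)"
    by (subst (asm) sigma_finite_measure.density_unique_iff[OF sigma_finite_lborel]) auto
  then show ?thesis
    by eventually_elim (subst ennreal_mult[OF h0 less_imp_le[OF gauss_density_pos]], simp add: mult.commute)
qed

lemma AE_continuous: "AE y in \<Pi>\<^sub>M j\<in>UNIV - {i}. (lborel :: real measure). continuous_on UNIV (\<lambda>t. sqrt (h (line i y t)))"
proof -
  have "AE y in \<Pi>\<^sub>M j\<in>UNIV - {i}. (lborel :: real measure). \<forall>a b. abs_continuous_on_segment a b (\<lambda>t. sqrt (h (line i y t)))"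
    using ac unfolding abs_continuous_on_lines_def line_def by blast
  then show ?thesis by eventually_elim (rule abs_continuous_imp_continuous, blast)
qed

text \<open>On almost every line \<open>\<surd>h\<close> and \<open>exp ((- V + |x|\<^sup>2/2)/2)\<close> are both continuous near a point
  where \<open>V\<close> is differentiable, and they agree almost everywhere up to a constant factor; so they
  are proportional there and the partial derivative of \<open>\<surd>h\<close> is \<open>\<surd>h (x\<^sub>i - \<partial>\<^sub>iV)/2\<close>.\<close>

lemma partial_deriv_sqrt:
  "AE x in lborel. exp_neg (V x) \<noteq> 0 \<longrightarrow> 4 * (partial_deriv i (\<lambda>z. sqrt (h z)) x)\<^sup>2 = (x $ i - ext_gradient V x $ i)\<^sup>2 * h x"
proof -
  have 1: "AE x in lborel. continuous_on UNIV (\<lambda>t. sqrt (h (line i (vec_nth x) t)))"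
    by (rule AE_line_const[OF AE_continuous])
  have 2: "AE x in lborel. AE t in lborel. exp_neg (V (line i (vec_nth x) t)) = ennreal (h (line i (vec_nth x) t) * gauss_density (line i (vec_nth x) t))"
    by (rule AE_line_const[OF AE_lineD[OF AE_density]])
  show ?thesis using 1 2 ext_convex_AE_ext_differentiable[OF c V]
  proof (eventually_elim, intro impI)
    fix x
    assume cont: "continuous_on UNIV (\<lambda>t. sqrt (h (line i (vec_nth x) t)))"
      and AE: "AE t in lborel. exp_neg (V (line i (vec_nth x) t)) = ennreal (h (line i (vec_nth x) t) * gauss_density (line i (vec_nth x) t))"
      and d: "V x \<noteq> \<infinity> \<longrightarrow> ext_differentiable V x" and nz: "exp_neg (V x) \<noteq> 0"
    let ?v = "\<lambda>t. V (line i (vec_nth x) t)"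
    let ?\<phi> = "\<lambda>t. sqrt (h (line i (vec_nth x) t))"
    define p where "p = ext_gradient V x $ i"
    have dx: "ext_differentiable V x" using d nz by auto
    then have dv: "ext_differentiable ?v (x $ i)" using ext_differentiable_iff_lines[OF c] by blast
    have p: "ext_gradient ?v (x $ i) = p" using ext_gradient_nth[OF dx, of i] by (simp add: p_def partial_gradient_def)
    obtain a b u where ab: "a < x $ i" "x $ i < b" and u': "\<forall>t. a < t \<and> t < b \<longrightarrow> ?v t = ereal (u t)"
      and uc: "continuous_on {a<..<b} u" and ud: "(u has_real_derivative p) (at (x $ i))"
      using ext_differentiable_convex_continuous[OF ext_convex_line[OF c] dv] unfolding p by auto
    have u: "?v t = ereal (u t)" if "a < t" "t < b" for t using u' that by blast
    define K where "K = gauss_density (line i (vec_nth x) 0)"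
    have K: "K > 0" unfolding K_def by (rule gauss_density_pos)
    have gdl: "gauss_density (line i (vec_nth x) t) = K * exp (- t\<^sup>2 / 2)" for t unfolding K_def by (rule gauss_density_line)
    \<comment> \<open>Along the line the Gaussian density is \<open>K exp (- t\<^sup>2 / 2)\<close>, so this is the square root of
      the quotient of \<open>e\<^sup>-\<^sup>u\<close> by it.\<close>
    define \<psi> where "\<psi> t = exp (- u t / 2 + t\<^sup>2 / 4) / sqrt K" for t
    have eqAE: "AE t in lborel. a < t \<and> t < b \<longrightarrow> ?\<phi> t = \<psi> t"
      using AE
    proof (eventually_elim, intro impI)
      fix t assume e: "exp_neg (?v t) = ennreal (h (line i (vec_nth x) t) * gauss_density (line i (vec_nth x) t))" and t: "a < t \<and> t < b"
      have "exp (- u t) = h (line i (vec_nth x) t) * (K * exp (- t\<^sup>2 / 2))"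
        using e u t h0 K by (simp add: gdl)
      then have "h (line i (vec_nth x) t) = exp (- u t) * exp (t\<^sup>2 / 2) / K"
        using K by (simp add: field_simps exp_minus)
      also have "\<dots> = (\<psi> t)\<^sup>2"
        using K by (simp add: \<psi>_def power_divide exp_double[symmetric] exp_add[symmetric] algebra_simps)
      finally show "?\<phi> t = \<psi> t" using K by (simp add: \<psi>_def)
    qed
    have eq: "?\<phi> t = \<psi> t" if "a < t" "t < b" for t
    proof (rule continuous_AE_eq_imp_eq[OF _ _ eqAE that])
      show "continuous_on {a<..<b} ?\<phi>" using cont by (rule continuous_on_subset) simp
      show "continuous_on {a<..<b} \<psi>" unfolding \<psi>_def by (intro continuous_intros uc) (use K in auto)
    qed
    have "(\<psi> has_real_derivative exp (- u (x $ i) / 2 + (x $ i)\<^sup>2 / 4) * (- p / 2 + 2 * (x $ i) / 4) / sqrt K) (at (x $ i))"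
      unfolding \<psi>_def by (rule DERIV_cdivide) (auto intro!: derivative_eq_intros ud)
    also have "exp (- u (x $ i) / 2 + (x $ i)\<^sup>2 / 4) * (- p / 2 + 2 * (x $ i) / 4) / sqrt K = \<psi> (x $ i) * ((x $ i - p) / 2)"
      by (simp add: \<psi>_def field_simps)
    finally have der: "(\<psi> has_real_derivative \<psi> (x $ i) * ((x $ i - p) / 2)) (at (x $ i))" .
    have ev: "\<forall>\<^sub>F t in nhds (x $ i). ?\<phi> t = \<psi> t"
    proof (rule eventually_nhds_in_open[THEN eventually_mono])
      show "open {a<..<b}" "x $ i \<in> {a<..<b}" using ab by auto
    qed (use eq in auto)
    have "(?\<phi> has_real_derivative \<psi> (x $ i) * ((x $ i - p) / 2)) (at (x $ i))"
      by (rule DERIV_cong_ev[OF refl ev refl, THEN iffD2, OF der])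
    then have "(?\<phi> has_real_derivative \<psi> (x $ i) * ((x $ i - p) / 2)) (at (0 + x $ i))"
      unfolding add_0 .
    then have "((\<lambda>t. ?\<phi> (t + x $ i)) has_real_derivative \<psi> (x $ i) * ((x $ i - p) / 2)) (at 0)"
      by (rule DERIV_shift[THEN iffD1])
    then have "((\<lambda>t. ?\<phi> (x $ i + t)) has_real_derivative \<psi> (x $ i) * ((x $ i - p) / 2)) (at 0)"
      by (simp only: add.commute)
    then have "partial_deriv i (\<lambda>z. sqrt (h z)) x = \<psi> (x $ i) * ((x $ i - p) / 2)"
      unfolding partial_deriv_def line_shift by (rule DERIV_imp_deriv)
    moreover have "\<psi> (x $ i) = sqrt (h x)" using eq[OF ab] by simp
    ultimately show "4 * (partial_deriv i (\<lambda>z. sqrt (h z)) x)\<^sup>2 = (x $ i - ext_gradient V x $ i)\<^sup>2 * h x"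
      using h0[of x] by (simp add: p_def power_mult_distrib power_divide del: times_divide_eq_right)
  qed
qed

text \<open>Only an inequality, because the right-hand side also integrates over the set where the
  density vanishes.\<close>

lemma fisher_integral_ge:
  "(\<integral>\<^sup>+x. ennreal (\<Sum>i\<in>UNIV. (x $ i - ext_gradient V x $ i)\<^sup>2) \<partial>exp_neg_measure V)
   \<le> 4 * (\<integral>\<^sup>+x. ennreal (\<Sum>i\<in>UNIV. (partial_deriv i (\<lambda>z. sqrt (h z)) x)\<^sup>2) \<partial>gauss)"
proof -
  note [measurable] = measurable_ext_gradient[OF c V]
  define S where "S x = (\<Sum>i\<in>UNIV. (x $ i - ext_gradient V x $ i)\<^sup>2)" for x
  have [measurable]: "S \<in> borel_measurable borel" unfolding S_def[abs_def] by measurable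
  have S0: "0 \<le> S x" for x by (auto simp: S_def intro: sum_nonneg)
  have "AE x in lborel. \<forall>i. exp_neg (V x) \<noteq> 0 \<longrightarrow> 4 * (partial_deriv i (\<lambda>z. sqrt (h z)) x)\<^sup>2 = (x $ i - ext_gradient V x $ i)\<^sup>2 * h x"
    unfolding AE_all_countable using partial_deriv_sqrt by blast
  then have AE: "AE x in lborel. S x * h x / 4 \<le> (\<Sum>i\<in>UNIV. (partial_deriv i (\<lambda>z. sqrt (h z)) x)\<^sup>2)"
    using AE_density
  proof eventually_elim
    case (elim x)
    show ?case
    proof (cases "exp_neg (V x) = 0")
      case True
      then have "h x * gauss_density x \<le> 0" using elim(2) by (simp add: ennreal_eq_0_iff)
      then have "h x = 0" using gauss_density_pos[of x] h0[of x] by (auto simp: mult_le_0_iff)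
      then show ?thesis by (simp add: sum_nonneg)
    next
      case False
      have "S x * h x = (\<Sum>i\<in>UNIV. 4 * (partial_deriv i (\<lambda>z. sqrt (h z)) x)\<^sup>2)"
        unfolding S_def sum_distrib_right by (rule sum.cong[OF refl]) (use elim(1) False in metis)
      also have "\<dots> = 4 * (\<Sum>i\<in>UNIV. (partial_deriv i (\<lambda>z. sqrt (h z)) x)\<^sup>2)" by (rule sum_distrib_left[symmetric])
      finally show ?thesis by simp
    qed
  qed
  have "(\<integral>\<^sup>+x. ennreal (S x) \<partial>exp_neg_measure V) = (\<integral>\<^sup>+x. ennreal (h x) * ennreal (S x) \<partial>gauss)"
    unfolding dens by (rule nn_integral_density) auto
  also have "\<dots> = (\<integral>\<^sup>+x. 4 * ennreal (S x * h x / 4) \<partial>gauss)"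
    using h0 S0 by (intro nn_integral_cong) (simp add: ennreal_mult'[symmetric] mult.commute flip: ennreal_numeral)
  also have "\<dots> = 4 * (\<integral>\<^sup>+x. ennreal (S x * h x / 4) \<partial>gauss)" by (rule nn_integral_cmult) measurable
  also have "\<dots> \<le> 4 * (\<integral>\<^sup>+x. ennreal (\<Sum>i\<in>UNIV. (partial_deriv i (\<lambda>z. sqrt (h z)) x)\<^sup>2) \<partial>gauss)"
  proof (intro mult_left_mono nn_integral_mono_AE)
    show "AE x in gauss. ennreal (S x * h x / 4) \<le> ennreal (\<Sum>i\<in>UNIV. (partial_deriv i (\<lambda>z. sqrt (h z)) x)\<^sup>2)"
      unfolding gauss_eq using AE by (subst Nonnegative_Lebesgue_Integration.AE_density) (auto elim!: eventually_mono intro: ennreal_leI)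
  qed simp
  finally show ?thesis by (simp add: S_def)
qed

end

section \<open>Entropy, transport and Fisher information of unconditional potentials\<close>

lemma sigma_finite_gauss: "sigma_finite_measure (gauss :: (real^'n) measure)"
  unfolding gauss_eq by (subst sigma_finite_measure.sigma_finite_iff_density_finite[OF sigma_finite_lborel]) auto

text \<open>Logarithm of the density of \<open>e\<^sup>-\<^sup>V dx\<close> with respect to the standard Gaussian measure, where
  \<open>V\<close> is finite.\<close>

definition log_density :: "(real^'n \<Rightarrow> ereal) \<Rightarrow> real^'n \<Rightarrow> real" where
  "log_density V x = - real_of_ereal (V x) + (norm x)\<^sup>2 / 2 + real CARD('n) / 2 * ln (2 * pi)"

lemma sets_exp_neg_measure [simp, measurable_cong]: "sets (exp_neg_measure V) = sets borel"
  by (simp add: exp_neg_measure_def)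

lemma space_exp_neg_measure [simp]: "space (exp_neg_measure V) = UNIV"
  by (simp add: exp_neg_measure_def)

lemma AE_exp_neg_measure:
  assumes "V \<in> borel_measurable borel"
  shows "(AE x in exp_neg_measure V. P x) \<longleftrightarrow> (AE x in lborel. V x \<noteq> \<infinity> \<longrightarrow> P x)"
proof -
  have "0 < exp_neg v \<longleftrightarrow> v \<noteq> \<infinity>" for v by (simp add: exp_neg_def)
  then show ?thesis unfolding exp_neg_measure_def using assms by (subst Nonnegative_Lebesgue_Integration.AE_density) auto
qed

lemma nn_integral_exp_neg_measure:
  assumes [measurable]: "V \<in> borel_measurable borel" "F \<in> borel_measurable borel"
  shows "(\<integral>\<^sup>+x. F x \<partial>exp_neg_measure V) = (\<integral>\<^sup>+x. exp_neg (V x) * F x \<partial>lborel)"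
  unfolding exp_neg_measure_def by (rule nn_integral_density) auto

lemma exp_neg_measure_eq_density_gauss:
  assumes [measurable]: "V \<in> borel_measurable borel"
  shows "exp_neg_measure V = density gauss (\<lambda>x. exp_neg (V x) * ennreal (1 / gauss_density x))"
proof -
  have "ennreal (gauss_density x) * (exp_neg (V x) * ennreal (1 / gauss_density x)) = exp_neg (V x)" for x
  proof -
    have "ennreal (gauss_density x) * (exp_neg (V x) * ennreal (1 / gauss_density x)) = exp_neg (V x) * (ennreal (gauss_density x) * ennreal (1 / gauss_density x))"
      by (simp add: mult_ac)
    also have "ennreal (gauss_density x) * ennreal (1 / gauss_density x) = 1"
      using gauss_density_pos[of x] by (simp add: ennreal_mult[symmetric])
    finally show ?thesis by simp
  qed
  then show ?thesis unfolding exp_neg_measure_def gauss_eq by (subst density_density_eq) auto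
qed

text \<open>The Radon-Nikodym derivative chosen in the definition of the entropy equals the explicit
  density almost everywhere, and only its integrals enter.\<close>

lemma rel_entropy_exp_neg_measure:
  fixes V :: "real^'n \<Rightarrow> ereal"
  assumes [measurable]: "V \<in> borel_measurable borel" and nm: "\<And>x. V x \<noteq> -\<infinity>"
  shows "rel_entropy (exp_neg_measure V) = enn2ereal (\<integral>\<^sup>+x. ennreal (log_density V x) \<partial>exp_neg_measure V)
     - enn2ereal (\<integral>\<^sup>+x. ennreal (- log_density V x) \<partial>exp_neg_measure V)"
proof -
  define hh where "hh x = exp_neg (V x) * ennreal (1 / gauss_density x)" for x
  have [measurable]: "hh \<in> borel_measurable borel" unfolding hh_def[abs_def] by measurable
  have eq: "density gauss hh = exp_neg_measure V"
    using exp_neg_measure_eq_density_gauss[OF assms(1)] by (simp add: hh_def[abs_def])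
  have ac: "absolutely_continuous gauss (exp_neg_measure V)"
    unfolding eq[symmetric] by (rule absolutely_continuousI_density) simp
  have "AE x in gauss. hh x = RN_deriv gauss (exp_neg_measure V) x"
    by (rule sigma_finite_measure.RN_deriv_unique[OF sigma_finite_gauss _ eq]) simp
  then have "AE x in lborel. hh x = RN_deriv gauss (exp_neg_measure V) x"
    unfolding gauss_eq[where 'n='n] by (subst (asm) Nonnegative_Lebesgue_Integration.AE_density) (auto simp: gauss_density_pos)
  then have AE: "AE x in exp_neg_measure V. ln (enn2real (RN_deriv gauss (exp_neg_measure V) x)) = log_density V x"
    unfolding AE_exp_neg_measure[OF assms(1)]
  proof (eventually_elim, intro impI)
    fix x assume RN: "hh x = RN_deriv gauss (exp_neg_measure V) x" and fin: "V x \<noteq> \<infinity>"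
    obtain u where u: "V x = ereal u" using fin nm[of x] by (cases "V x") auto
    have "hh x = ennreal (exp (- u) / gauss_density x)"
      using gauss_density_pos[of x] by (simp add: hh_def u ennreal_mult[symmetric])
    then have "ln (enn2real (RN_deriv gauss (exp_neg_measure V) x)) = ln (exp (- u) / gauss_density x)"
      using gauss_density_pos[of x] by (simp add: RN[symmetric])
    also have "\<dots> = - u - ln (gauss_density x)" using gauss_density_pos[of x] by (simp add: ln_div)
    also have "ln (gauss_density x) = - real CARD('n) / 2 * ln (2 * pi) - (norm x)\<^sup>2 / 2"
      unfolding gauss_density_def by (subst ln_mult) (auto simp: ln_powr)
    finally show "ln (enn2real (RN_deriv gauss (exp_neg_measure V) x)) = log_density V x"
      by (simp add: log_density_def u)
  qed
  have 1: "(\<integral>\<^sup>+x. ennreal (ln (enn2real (RN_deriv gauss (exp_neg_measure V) x))) \<partial>exp_neg_measure V)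
      = (\<integral>\<^sup>+x. ennreal (log_density V x) \<partial>exp_neg_measure V)"
    by (rule nn_integral_cong_AE) (use AE in eventually_elim, simp)
  have 2: "(\<integral>\<^sup>+x. ennreal (- ln (enn2real (RN_deriv gauss (exp_neg_measure V) x))) \<partial>exp_neg_measure V)
      = (\<integral>\<^sup>+x. ennreal (- log_density V x) \<partial>exp_neg_measure V)"
    by (rule nn_integral_cong_AE) (use AE in eventually_elim, simp)
  show ?thesis unfolding rel_entropy_def using ac by (simp add: Let_def 1 2)
qed

lemma ereal_diff_integral:
  assumes "integrable M f"
  shows "enn2ereal (\<integral>\<^sup>+x. ennreal (f x) \<partial>M) - enn2ereal (\<integral>\<^sup>+x. ennreal (- f x) \<partial>M) = ereal (integral\<^sup>L M f)"
proof -
  obtain a b where "(\<integral>\<^sup>+x. ennreal (f x) \<partial>M) = ennreal a" "0 \<le> a" "(\<integral>\<^sup>+x. ennreal (- f x) \<partial>M) = ennreal b" "0 \<le> b"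
    "integral\<^sup>L M f = a - b"
  proof -
    from integrableE[OF assms] obtain r q where "0 \<le> r" "0 \<le> q" "(\<integral>\<^sup>+x. ennreal (f x) \<partial>M) = ennreal r"
      "(\<integral>\<^sup>+x. ennreal (- f x) \<partial>M) = ennreal q" "f \<in> borel_measurable M" "integral\<^sup>L M f = r - q" by auto
    then show thesis by (intro that) auto
  qed
  then show ?thesis by simp
qed

lemma measurable_vec_nth_PiM: "vec_nth \<in> (borel :: (real^'n) measure) \<rightarrow>\<^sub>M (\<Pi>\<^sub>M i\<in>UNIV. lborel)"
  by (rule measurable_PiM_single') (auto simp: space_PiM)

text \<open>The invariance of \<open>V\<close> is required at every point, as provided by
  \<open>unconditional_imp_flip_invariant\<close>.\<close>

locale unconditional_potential =
  fixes V :: "real^'n \<Rightarrow> ereal"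
  assumes c: "ext_convex V" and V[measurable]: "V \<in> borel_measurable borel"
    and prob: "prob_space (exp_neg_measure V)"
    and inv: "\<And>\<epsilon> x. \<epsilon> \<in> cube \<Longrightarrow> V (flip \<epsilon> x) = V x"
begin

abbreviation "\<eta> \<equiv> exp_neg_measure V"
abbreviation "g \<equiv> ext_gradient V"

sublocale \<eta>: prob_space \<eta> by (rule prob)

lemma measure_UNIV: "measure \<eta> UNIV = 1"
  using \<eta>.prob_space by simp

lemma measurable_g [measurable]: "g \<in> borel_measurable borel"
  by (rule measurable_ext_gradient[OF c V])

lemma int1: "(\<integral>\<^sup>+x. exp_neg (V x) \<partial>lborel) = 1"
  using \<eta>.emeasure_space_1 by (simp add: exp_neg_measure_def emeasure_density)

text \<open>The origin is the midpoint of \<open>x\<close> and \<open>- x\<close>.\<close>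

lemma min0: "V 0 \<le> V x"
proof (cases "V x = \<infinity>")
  case False
  then obtain r where r: "V x = ereal r" using ext_convex_not_MInfty[OF c, of x] by (cases "V x") auto
  have "(\<chi> i. -1) \<in> (cube :: (real^'n) set)" by (simp add: cube_def)
  from inv[OF this, of x] have "V (- x) = ereal r" by (simp add: r flip_def vec_eq_iff uminus_vec_def)
  then have "V ((1 - 1/2) *\<^sub>R x + (1/2) *\<^sub>R (- x)) \<le> ereal ((1 - 1/2) * r + (1/2) * r)"
    by (intro ext_convex_le_real[OF c]) (auto simp: r)
  then show ?thesis by (simp add: r)
qed simp

lemma even_line: "V (line i y (- t)) = V (line i y t)"
proof -
  have "(\<chi> j. if j = i then -1 else 1) \<in> (cube :: (real^'n) set)" by (simp add: cube_def)
  from inv[OF this, of "line i y t"] show ?thesis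
    by (rule trans[rotated]) (auto intro!: arg_cong[where f=V] simp: vec_eq_iff)
qed

lemma second_moment: "(\<integral>\<^sup>+x. ennreal ((norm x)\<^sup>2) \<partial>\<eta>) < \<infinity>"
  using log_concave_second_moment[OF c V _ _ min0] int1
  by (simp add: nn_integral_exp_neg_measure mult.commute)

text \<open>The absolute partial derivative of the density. It is defined by the derivative along the
  line, not by a component of the gradient, so that it is the one-dimensional \<open>line_grad\<close> on every
  line.\<close>

definition slope_mass :: "'n \<Rightarrow> real^'n \<Rightarrow> ennreal" where
  "slope_mass i x = ennreal \<bar>partial_gradient V i x\<bar> * exp_neg (V x)"

lemma measurable_slope_mass [measurable]: "slope_mass i \<in> borel_measurable borel"
proof -
  note [measurable] = measurable_partial_gradient[OF c V, of i]
  show ?thesis unfolding slope_mass_def[abs_def] by measurable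
qed

lemma slope_mass_line: "slope_mass i (line i y t) = line_grad (\<lambda>s. V (line i y s)) t"
  by (simp add: slope_mass_def partial_gradient_def line_grad_def)

lemma AE_slope_mass: "AE x in lborel. exp_neg (V x) * ennreal \<bar>g x $ i\<bar> = slope_mass i x"
  using ext_convex_AE_ext_differentiable[OF c V]
proof eventually_elim
  case (elim x)
  then show ?case by (cases "V x = \<infinity>") (auto simp: slope_mass_def ext_gradient_nth mult.commute)
qed

lemma integral_slope_mass: "(\<integral>\<^sup>+x. ennreal \<bar>g x $ i\<bar> \<partial>\<eta>) = (\<integral>\<^sup>+x. slope_mass i x \<partial>lborel)"
  by (subst nn_integral_exp_neg_measure) (auto intro!: nn_integral_cong_AE AE_slope_mass)

lemma integral_position_gradient: "(\<integral>\<^sup>+x. ennreal \<bar>x $ i * g x $ i\<bar> \<partial>\<eta>) \<le> 1"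
proof -
  have "(\<integral>\<^sup>+x. ennreal \<bar>x $ i * g x $ i\<bar> \<partial>\<eta>) = (\<integral>\<^sup>+x. ennreal \<bar>x $ i\<bar> * slope_mass i x \<partial>lborel)"
  proof (subst nn_integral_exp_neg_measure)
    show "(\<integral>\<^sup>+x. exp_neg (V x) * ennreal \<bar>x $ i * g x $ i\<bar> \<partial>lborel) = (\<integral>\<^sup>+x. ennreal \<bar>x $ i\<bar> * slope_mass i x \<partial>lborel)"
    proof (rule nn_integral_cong_AE)
      show "AE x in lborel. exp_neg (V x) * ennreal \<bar>x $ i * g x $ i\<bar> = ennreal \<bar>x $ i\<bar> * slope_mass i x"
        using AE_slope_mass[of i]
      proof eventually_elim
        case (elim x)
        have "exp_neg (V x) * ennreal \<bar>x $ i * g x $ i\<bar> = ennreal \<bar>x $ i\<bar> * (exp_neg (V x) * ennreal \<bar>g x $ i\<bar>)"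
          by (simp add: abs_mult ennreal_mult mult_ac)
        then show ?case by (simp only: elim)
      qed
    qed
  qed auto
  also have "\<dots> = (\<integral>\<^sup>+y. (\<integral>\<^sup>+t. ennreal \<bar>t\<bar> * line_grad (\<lambda>s. V (line i y s)) t \<partial>lborel) \<partial>(\<Pi>\<^sub>M j\<in>UNIV - {i}. lborel))"
    by (subst nn_integral_line[where i=i]) (auto simp: slope_mass_line)
  also have "\<dots> \<le> (\<integral>\<^sup>+y. (\<integral>\<^sup>+t. exp_neg (V (line i y t)) \<partial>lborel) \<partial>(\<Pi>\<^sub>M j\<in>UNIV - {i}. lborel))"
    by (intro nn_integral_mono line_grad_moment ext_convex_line[OF c] even_line) measurable
  also have "\<dots> = 1"
    by (subst nn_integral_line[symmetric]) (auto simp: int1)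
  finally show ?thesis .
qed

text \<open>The triangular entropy bound, transferred from the product space of functions to \<open>real^'n\<close>.\<close>

lemma triangular_bound:
  assumes le: "\<And>i. AE x in lborel. 2 * exp_neg (V x) \<le> (\<integral>\<^sup>+t. slope_mass i (line i (vec_nth x) t) \<partial>lborel)"
  shows "\<exists>G. G \<in> borel_measurable borel \<and> (\<forall>x. 0 \<le> G x) \<and>
    (\<integral>\<^sup>+x. ennreal (G x) \<partial>\<eta>) \<le> (\<Sum>i\<in>UNIV. \<integral>\<^sup>+x. ennreal \<bar>g x $ i\<bar> \<partial>\<eta>) \<and>
    (AE x in \<eta>. - real_of_ereal (V x) + real CARD('n) * (1 + ln 2) \<le> G x)"
proof -
  let ?f = "\<lambda>y. exp_neg (V (vec_lambda y))" and ?D = "\<lambda>i y. slope_mass i (vec_lambda y)"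
  have "\<exists>G. G \<in> borel_measurable (\<Pi>\<^sub>M j\<in>UNIV. (lborel :: real measure)) \<and> (\<forall>x. 0 \<le> G x)
     \<and> (\<integral>\<^sup>+x. ?f x * ennreal (G x) \<partial>(\<Pi>\<^sub>M j\<in>UNIV. lborel)) \<le> (\<Sum>i\<in>UNIV. \<integral>\<^sup>+x. ?D i x \<partial>(\<Pi>\<^sub>M j\<in>UNIV. lborel))
     \<and> (AE x in \<Pi>\<^sub>M j\<in>UNIV. lborel. ?f x \<noteq> 0 \<longrightarrow> ln (enn2real (?f x)) + real (card (UNIV :: 'n set)) * (1 + ln 2) \<le> G x)"
  proof (rule triangular_entropy_bound)
    show "(\<integral>\<^sup>+y. ?f y \<partial>(\<Pi>\<^sub>M j\<in>UNIV. lborel)) = 1"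
      using int1 by (subst (asm) nn_integral_vec) auto
    show "AE y in \<Pi>\<^sub>M j\<in>UNIV. lborel. 2 * ?f y \<le> (\<integral>\<^sup>+t. ?D i (y(i := t)) \<partial>lborel)" for i
      using le[of i] unfolding AE_vec_iff line_eq by (simp add: vec_lambda_inverse)
  qed auto
  then obtain G where G[measurable]: "G \<in> borel_measurable (\<Pi>\<^sub>M j\<in>UNIV. (lborel :: real measure))" and G0: "\<And>x. 0 \<le> G x"
    and Gint: "(\<integral>\<^sup>+x. ?f x * ennreal (G x) \<partial>(\<Pi>\<^sub>M j\<in>UNIV. lborel)) \<le> (\<Sum>i\<in>UNIV. \<integral>\<^sup>+x. ?D i x \<partial>(\<Pi>\<^sub>M j\<in>UNIV. lborel))"
    and GAE: "AE x in \<Pi>\<^sub>M j\<in>UNIV. lborel. ?f x \<noteq> 0 \<longrightarrow> ln (enn2real (?f x)) + real CARD('n) * (1 + ln 2) \<le> G x"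
    by blast
  have [measurable]: "(\<lambda>x. G (vec_nth x)) \<in> borel_measurable borel"
    by (rule measurable_compose[OF measurable_vec_nth_PiM G])
  have i1: "(\<integral>\<^sup>+x. ennreal (G (vec_nth x)) \<partial>\<eta>) = (\<integral>\<^sup>+x. ?f x * ennreal (G x) \<partial>(\<Pi>\<^sub>M j\<in>UNIV. lborel))"
    by (subst nn_integral_exp_neg_measure) (auto simp: nn_integral_vec vec_lambda_inverse)
  have i2: "(\<integral>\<^sup>+x. ?D i x \<partial>(\<Pi>\<^sub>M j\<in>UNIV. lborel)) = (\<integral>\<^sup>+x. ennreal \<bar>g x $ i\<bar> \<partial>\<eta>)" for i
    unfolding integral_slope_mass by (rule nn_integral_vec[symmetric]) measurable
  have "AE x in lborel. exp_neg (V x) \<noteq> 0 \<longrightarrow> ln (enn2real (exp_neg (V x))) + real CARD('n) * (1 + ln 2) \<le> G (vec_nth x)"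
    unfolding AE_vec_iff using GAE by (simp add: vec_lambda_inverse)
  then have "AE x in \<eta>. - real_of_ereal (V x) + real CARD('n) * (1 + ln 2) \<le> G (vec_nth x)"
    unfolding AE_exp_neg_measure[OF V]
  proof eventually_elim
    case (elim x)
    then show ?case by (auto simp: exp_neg_def)
  qed
  then show ?thesis using G0 Gint i1 i2 by (intro exI[of _ "\<lambda>x. G (vec_nth x)"]) auto
qed

text \<open>The density of \<open>\<eta>\<close> with respect to Lebesgue measure is almost everywhere \<open>h\<close> times the
  Gaussian density, and this product is continuous on almost every line since \<open>\<surd>h\<close> is absolutely
  continuous there.\<close>

lemma no_boundary_jump:
  assumes h: "h \<in> borel_measurable borel" "\<And>x. 0 \<le> h x" "\<eta> = density gauss (\<lambda>x. ennreal (h x))"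
    "abs_continuous_on_lines (\<lambda>x. sqrt (h x))"
  shows "AE x in lborel. 2 * exp_neg (V x) \<le> (\<integral>\<^sup>+t. slope_mass i (line i (vec_nth x) t) \<partial>lborel)"
proof -
  interpret F: fisher_version V h
    by unfold_locales (use c V h int1 in auto)
  have m: "Measurable.pred borel (\<lambda>x. 2 * exp_neg (V x) \<le> (\<integral>\<^sup>+t. slope_mass i (line i (vec_nth x) t) \<partial>lborel))"
    by measurable
  have fin: "AE y in \<Pi>\<^sub>M j\<in>UNIV - {i}. (lborel :: real measure). (\<integral>\<^sup>+t. exp_neg (V (line i y t)) \<partial>lborel) \<noteq> \<infinity>"
  proof (rule nn_integral_noteq_infinite)
    show "(\<integral>\<^sup>+y. (\<integral>\<^sup>+t. exp_neg (V (line i y t)) \<partial>lborel) \<partial>(\<Pi>\<^sub>M j\<in>UNIV - {i}. lborel)) \<noteq> \<infinity>"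
      by (subst nn_integral_line[symmetric]) (auto simp: int1)
  qed measurable
  show ?thesis
  proof (rule AE_lineI[where i=i])
    show "{x. 2 * exp_neg (V x) \<le> (\<integral>\<^sup>+t. slope_mass i (line i (vec_nth x) t) \<partial>lborel)} \<in> sets borel"
      using m by (simp add: pred_def)
    show "AE y in \<Pi>\<^sub>M j\<in>UNIV - {i}. (lborel :: real measure). AE t in lborel.
       2 * exp_neg (V (line i y t)) \<le> (\<integral>\<^sup>+ta. slope_mass i (line i (vec_nth (line i y t)) ta) \<partial>lborel)"
      using F.AE_continuous[of i] AE_lineD[OF F.AE_density, of i] fin
    proof eventually_elim
      case (elim y)
      define k where "k t = h (line i y t) * gauss_density (line i y t)" for t
      have gdc: "continuous_on UNIV (\<lambda>t. gauss_density (line i y t))"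
      proof -
        have "continuous_on UNIV (line i y)" unfolding line_def
        proof (rule continuous_on_vec_lambda)
          fix j show "continuous_on UNIV (\<lambda>t. if j = i then t else y j)" by (cases "j = i") auto
        qed
        then show ?thesis unfolding gauss_density_def by (intro continuous_intros) auto
      qed
      have "continuous_on UNIV (\<lambda>t. (sqrt (h (line i y t)))\<^sup>2 * gauss_density (line i y t))"
        by (intro continuous_intros elim(1) gdc)
      then have k: "continuous_on UNIV k" using h(2) by (simp add: k_def[abs_def])
      have main: "2 * exp_neg (V (line i y t)) \<le> (\<integral>\<^sup>+s. line_grad (\<lambda>s. V (line i y s)) s \<partial>lborel)" if "t \<noteq> 0" for t
      proof (rule line_grad_ge[OF ext_convex_line[OF c] _ even_line _ k _ _ that])
        show "(\<integral>\<^sup>+t. exp_neg (V (line i y t)) \<partial>lborel) < \<infinity>" using elim(3) by (simp add: less_top)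
        show "AE t in lborel. exp_neg (V (line i y t)) = ennreal (k t)" using elim(2) by (simp add: k_def)
        show "0 \<le> k t" for t using h(2) gauss_density_pos[of "line i y t"] by (simp add: k_def)
      qed measurable
      show ?case unfolding line_line slope_mass_line
        by (rule AE_mp[OF AE_lborel_singleton[of 0] AE_I2]) (use main in blast)
    qed
  qed
qed

end

text \<open>A second moment of \<open>\<nabla>V\<close> under \<open>\<eta>\<close> is a second moment of the moment measure.\<close>

locale unconditional_P2 = unconditional_potential V for V :: "real^'n \<Rightarrow> ereal" +
  assumes P2: "(\<integral>\<^sup>+x. ennreal ((norm (g x))\<^sup>2) \<partial>\<eta>) < \<infinity>"
begin

lemma integrable_position_sq: "integrable \<eta> (\<lambda>x. (norm x)\<^sup>2)"
  by (rule integrableI_bounded) (use second_moment in auto)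

lemma integrable_gradient_sq: "integrable \<eta> (\<lambda>x. (norm (g x))\<^sup>2)"
  by (rule integrableI_bounded) (use P2 in auto)

lemma integrable_gradient_abs: "integrable \<eta> (\<lambda>x. \<bar>g x $ i\<bar>)"
proof (rule Bochner_Integration.integrable_bound)
  show "integrable \<eta> (\<lambda>x. 1 + (norm (g x))\<^sup>2)" by (intro Bochner_Integration.integrable_add integrable_gradient_sq) simp
  show "AE x in \<eta>. norm \<bar>g x $ i\<bar> \<le> norm (1 + (norm (g x))\<^sup>2)"
  proof (rule AE_I2)
    fix x
    have "\<bar>g x $ i\<bar> \<le> norm (g x)" by (rule component_le_norm_cart)
    also have "norm (g x) \<le> 1 + (norm (g x))\<^sup>2"
    proof -
      have "2 * norm (g x) \<le> 1 + (norm (g x))\<^sup>2"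
        using zero_le_power2[of "norm (g x) - 1"] by (simp add: power2_diff)
      then show ?thesis using norm_ge_zero[of "g x"] by linarith
    qed
    finally show "norm \<bar>g x $ i\<bar> \<le> norm (1 + (norm (g x))\<^sup>2)" by simp
  qed
qed measurable

lemma integrable_position_gradient: "integrable \<eta> (\<lambda>x. x $ i * g x $ i)"
proof (rule integrableI_bounded)
  show "(\<integral>\<^sup>+x. ennreal (norm (x $ i * g x $ i)) \<partial>\<eta>) < \<infinity>"
    using integral_position_gradient[of i] by (auto intro: le_less_trans)
qed measurable

lemma integral_position_gradient_le: "(\<integral>x. x $ i * g x $ i \<partial>\<eta>) \<le> 1"
proof -
  have "ennreal (\<integral>x. \<bar>x $ i * g x $ i\<bar> \<partial>\<eta>) = (\<integral>\<^sup>+x. ennreal \<bar>x $ i * g x $ i\<bar> \<partial>\<eta>)"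
    by (rule nn_integral_eq_integral[symmetric]) (use integrable_position_gradient in auto)
  then have "ennreal (\<integral>x. \<bar>x $ i * g x $ i\<bar> \<partial>\<eta>) \<le> 1" using integral_position_gradient by simp
  then have "(\<integral>x. \<bar>x $ i * g x $ i\<bar> \<partial>\<eta>) \<le> 1" by simp
  moreover have "(\<integral>x. x $ i * g x $ i \<partial>\<eta>) \<le> (\<integral>x. \<bar>x $ i * g x $ i\<bar> \<partial>\<eta>)"
    by (rule integral_mono) (use integrable_position_gradient in auto)
  ultimately show ?thesis by simp
qed

text \<open>The three numbers in terms of which entropy, transport cost and Fisher information are
  expressed.\<close>

definition position_sq_mean :: real where "position_sq_mean = (\<integral>x. (norm x)\<^sup>2 \<partial>\<eta>)"
definition gradient_abs_mean :: real where "gradient_abs_mean = (\<Sum>i\<in>UNIV. \<integral>x. \<bar>g x $ i\<bar> \<partial>\<eta>)"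
definition gradient_sq_mean :: real where "gradient_sq_mean = (\<integral>x. (norm (g x))\<^sup>2 \<partial>\<eta>)"

text \<open>Expand \<open>\<Sum>\<^sub>i (|\<partial>\<^sub>iV| - 1)\<^sup>2\<close>. Nonnegativity is recorded because \<open>ennreal\<close> truncates negative
  numbers.\<close>

lemma wasserstein_eq: "wasserstein2_sq (moment_measure V) uniform_cube = ennreal (gradient_sq_mean - 2 * gradient_abs_mean + real CARD('n))"
  and wasserstein_nonneg: "0 \<le> gradient_sq_mean - 2 * gradient_abs_mean + real CARD('n)"
proof -
  have cc: "cube_cost (g x) = (norm (g x))\<^sup>2 - 2 * (\<Sum>i\<in>UNIV. \<bar>g x $ i\<bar>) + real CARD('n)" for x
    unfolding cube_cost_def norm_vec_sq by (simp add: power2_diff sum.distrib sum_subtractf sum_distrib_left)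
  have int: "integrable \<eta> (\<lambda>x. (norm (g x))\<^sup>2 - 2 * (\<Sum>i\<in>UNIV. \<bar>g x $ i\<bar>) + real CARD('n))"
    by (intro Bochner_Integration.integrable_add Bochner_Integration.integrable_diff integrable_mult_right
        Bochner_Integration.integrable_sum integrable_gradient_sq integrable_gradient_abs) simp
  have val: "(\<integral>x. cube_cost (g x) \<partial>\<eta>) = gradient_sq_mean - 2 * gradient_abs_mean + real CARD('n)"
    unfolding cc gradient_abs_mean_def gradient_sq_mean_def using integrable_gradient_sq integrable_gradient_abs measure_UNIV by simp
  have cc0: "0 \<le> cube_cost y" for y :: "real^'n" unfolding cube_cost_def by (intro sum_nonneg) auto
  show "0 \<le> gradient_sq_mean - 2 * gradient_abs_mean + real CARD('n)" unfolding val[symmetric] by (intro integral_nonneg_AE) (simp add: cc0)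
  have u: "unconditional (moment_measure V)" by (rule unconditional_moment_measure[OF c V inv])
  have p: "prob_space (moment_measure V)" unfolding moment_measure_def by (rule \<eta>.prob_space_distr) simp
  have "wasserstein2_sq (moment_measure V) uniform_cube = (\<integral>\<^sup>+y. ennreal (cube_cost y) \<partial>moment_measure V)"
    by (rule wasserstein2_sq_uniform_cube[OF p _ u]) (simp add: moment_measure_def)
  also have "\<dots> = (\<integral>\<^sup>+x. ennreal (cube_cost (g x)) \<partial>\<eta>)"
    unfolding moment_measure_def by (subst nn_integral_distr) auto
  also have "\<dots> = ennreal (\<integral>x. cube_cost (g x) \<partial>\<eta>)"
  proof (rule nn_integral_eq_integral)
    show "integrable \<eta> (\<lambda>x. cube_cost (g x))" unfolding cc by (rule int)
    show "AE x in \<eta>. 0 \<le> cube_cost (g x)" by (intro AE_I2 cc0)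
  qed
  finally show "wasserstein2_sq (moment_measure V) uniform_cube = ennreal (gradient_sq_mean - 2 * gradient_abs_mean + real CARD('n))"
    by (simp add: val)
qed

lemma gradient_shift_integral:
  "(\<integral>\<^sup>+x. ennreal (\<Sum>i\<in>UNIV. (x $ i - g x $ i)\<^sup>2) \<partial>\<eta>) = ennreal (position_sq_mean - 2 * (\<Sum>i\<in>UNIV. \<integral>x. x $ i * g x $ i \<partial>\<eta>) + gradient_sq_mean)"
  and gradient_shift_nonneg: "0 \<le> position_sq_mean - 2 * (\<Sum>i\<in>UNIV. \<integral>x. x $ i * g x $ i \<partial>\<eta>) + gradient_sq_mean"
proof -
  have S: "(\<Sum>i\<in>UNIV. (x $ i - g x $ i)\<^sup>2) = (norm x)\<^sup>2 - 2 * (\<Sum>i\<in>UNIV. x $ i * g x $ i) + (norm (g x))\<^sup>2" for x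
    unfolding norm_vec_sq by (simp add: power2_diff sum.distrib sum_subtractf sum_distrib_left algebra_simps)
  have int: "integrable \<eta> (\<lambda>x. (norm x)\<^sup>2 - 2 * (\<Sum>i\<in>UNIV. x $ i * g x $ i) + (norm (g x))\<^sup>2)"
    by (intro Bochner_Integration.integrable_add Bochner_Integration.integrable_diff integrable_mult_right
        Bochner_Integration.integrable_sum integrable_gradient_sq integrable_position_sq integrable_position_gradient)
  have val: "(\<integral>x. (\<Sum>i\<in>UNIV. (x $ i - g x $ i)\<^sup>2) \<partial>\<eta>) = position_sq_mean - 2 * (\<Sum>i\<in>UNIV. \<integral>x. x $ i * g x $ i \<partial>\<eta>) + gradient_sq_mean"
    unfolding S position_sq_mean_def gradient_sq_mean_def using int integrable_gradient_sq integrable_position_sq integrable_position_gradient by simp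
  show "0 \<le> position_sq_mean - 2 * (\<Sum>i\<in>UNIV. \<integral>x. x $ i * g x $ i \<partial>\<eta>) + gradient_sq_mean"
    unfolding val[symmetric] by (intro integral_nonneg_AE AE_I2 sum_nonneg) simp
  have "(\<integral>\<^sup>+x. ennreal (\<Sum>i\<in>UNIV. (x $ i - g x $ i)\<^sup>2) \<partial>\<eta>) = ennreal (\<integral>x. (\<Sum>i\<in>UNIV. (x $ i - g x $ i)\<^sup>2) \<partial>\<eta>)"
  proof (rule nn_integral_eq_integral)
    show "integrable \<eta> (\<lambda>x. \<Sum>i\<in>UNIV. (x $ i - g x $ i)\<^sup>2)" unfolding S by (rule int)
    show "AE x in \<eta>. 0 \<le> (\<Sum>i\<in>UNIV. (x $ i - g x $ i)\<^sup>2)" by (intro AE_I2 sum_nonneg) simp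
  qed
  then show "(\<integral>\<^sup>+x. ennreal (\<Sum>i\<in>UNIV. (x $ i - g x $ i)\<^sup>2) \<partial>\<eta>) = ennreal (position_sq_mean - 2 * (\<Sum>i\<in>UNIV. \<integral>x. x $ i * g x $ i \<partial>\<eta>) + gradient_sq_mean)"
    by (simp add: val)
qed

lemma measurable_log_density [measurable]: "log_density V \<in> borel_measurable borel"
  unfolding log_density_def[abs_def] by measurable

text \<open>An integrable majorant of the logarithm of the density bounds the entropy, even when the
  negative part has infinite integral, in which case the entropy is \<open>-\<infinity>\<close>.\<close>

lemma rel_entropy_le:
  assumes U: "integrable \<eta> U" and le: "AE x in \<eta>. log_density V x \<le> U x"
  shows "rel_entropy \<eta> \<le> ereal (\<integral>x. U x \<partial>\<eta>)"
proof -
  have rel: "rel_entropy \<eta> = enn2ereal (\<integral>\<^sup>+x. ennreal (log_density V x) \<partial>\<eta>)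
     - enn2ereal (\<integral>\<^sup>+x. ennreal (- log_density V x) \<partial>\<eta>)"
    by (rule rel_entropy_exp_neg_measure[OF V ext_convex_not_MInfty[OF c]])
  have "(\<integral>\<^sup>+x. ennreal (log_density V x) \<partial>\<eta>) \<le> (\<integral>\<^sup>+x. ennreal (norm (U x)) \<partial>\<eta>)"
    by (rule nn_integral_mono_AE) (use le in eventually_elim, auto intro!: ennreal_leI)
  also have "\<dots> < \<infinity>" using U by (simp add: integrable_iff_bounded)
  finally have pos: "(\<integral>\<^sup>+x. ennreal (log_density V x) \<partial>\<eta>) \<noteq> \<infinity>" by simp
  show ?thesis
  proof (cases "(\<integral>\<^sup>+x. ennreal (- log_density V x) \<partial>\<eta>) = \<infinity>")
    case True
    obtain a where "(\<integral>\<^sup>+x. ennreal (log_density V x) \<partial>\<eta>) = ennreal a" "0 \<le> a" using pos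
      by (cases "\<integral>\<^sup>+x. ennreal (log_density V x) \<partial>\<eta>") auto
    then show ?thesis unfolding rel True by simp
  next
    case False
    have int: "integrable \<eta> (log_density V)"
      unfolding real_integrable_def using pos False by simp
    have "rel_entropy \<eta> = ereal (\<integral>x. log_density V x \<partial>\<eta>)" unfolding rel by (rule ereal_diff_integral[OF int])
    also have "\<dots> \<le> ereal (\<integral>x. U x \<partial>\<eta>)" using integral_mono_AE[OF int U le] by simp
    finally show ?thesis .
  qed
qed

lemma rel_entropy_less_top: "rel_entropy \<eta> < \<infinity>"
proof -
  obtain v0 where v0: "V 0 = ereal v0"
    using convex_linear_growth[OF c V _ _ min0] int1 by auto
  have "rel_entropy \<eta> \<le> ereal (\<integral>x. - v0 + (norm x)\<^sup>2 / 2 + real CARD('n) / 2 * ln (2 * pi) \<partial>\<eta>)"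
  proof (rule rel_entropy_le)
    show "integrable \<eta> (\<lambda>x. - v0 + (norm x)\<^sup>2 / 2 + real CARD('n) / 2 * ln (2 * pi))"
      by (intro Bochner_Integration.integrable_add integrable_divide integrable_position_sq) auto
    show "AE x in \<eta>. log_density V x \<le> - v0 + (norm x)\<^sup>2 / 2 + real CARD('n) / 2 * ln (2 * pi)"
      unfolding AE_exp_neg_measure[OF V]
    proof (rule AE_I2, rule impI)
      fix x assume "V x \<noteq> \<infinity>"
      then obtain u where u: "V x = ereal u" using ext_convex_not_MInfty[OF c, of x] by (cases "V x") auto
      then have "v0 \<le> u" using min0[of x] v0 by simp
      then show "log_density V x \<le> - v0 + (norm x)\<^sup>2 / 2 + real CARD('n) / 2 * ln (2 * pi)"
        by (simp add: log_density_def u)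
    qed
  qed
  then show ?thesis by (rule le_less_trans) simp
qed

lemma rel_entropy_le_gradient:
  assumes le: "\<And>i. AE x in lborel. 2 * exp_neg (V x) \<le> (\<integral>\<^sup>+t. slope_mass i (line i (vec_nth x) t) \<partial>lborel)"
  shows "rel_entropy \<eta> \<le> ereal (gradient_abs_mean - real CARD('n) * (1 + ln 2) + position_sq_mean / 2 + real CARD('n) / 2 * ln (2 * pi))"
proof -
  obtain G where G[measurable]: "G \<in> borel_measurable borel" and G0: "\<And>x. 0 \<le> G x"
    and Gint: "(\<integral>\<^sup>+x. ennreal (G x) \<partial>\<eta>) \<le> (\<Sum>i\<in>UNIV. \<integral>\<^sup>+x. ennreal \<bar>g x $ i\<bar> \<partial>\<eta>)"
    and GAE: "AE x in \<eta>. - real_of_ereal (V x) + real CARD('n) * (1 + ln 2) \<le> G x"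
    using triangular_bound[OF le] by blast
  have "(\<Sum>i\<in>UNIV. \<integral>\<^sup>+x. ennreal \<bar>g x $ i\<bar> \<partial>\<eta>) = (\<Sum>i\<in>UNIV. ennreal (\<integral>x. \<bar>g x $ i\<bar> \<partial>\<eta>))"
    by (intro sum.cong refl nn_integral_eq_integral integrable_gradient_abs) auto
  also have "\<dots> = ennreal gradient_abs_mean" unfolding gradient_abs_mean_def by (rule sum_ennreal) simp
  finally have Gle: "(\<integral>\<^sup>+x. ennreal (G x) \<partial>\<eta>) \<le> ennreal gradient_abs_mean" using Gint by simp
  have Gi: "integrable \<eta> G"
    by (rule integrableI_bounded) (use Gle G0 in \<open>auto intro: le_less_trans\<close>)
  have N10: "0 \<le> gradient_abs_mean" unfolding gradient_abs_mean_def by (intro sum_nonneg) simp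
  have "ennreal (\<integral>x. G x \<partial>\<eta>) \<le> ennreal gradient_abs_mean" using Gle nn_integral_eq_integral[OF Gi] G0 by simp
  then have GN: "(\<integral>x. G x \<partial>\<eta>) \<le> gradient_abs_mean" using N10 by simp
  let ?U = "\<lambda>x. G x - real CARD('n) * (1 + ln 2) + (norm x)\<^sup>2 / 2 + real CARD('n) / 2 * ln (2 * pi)"
  have Ui: "integrable \<eta> ?U"
    by (intro Bochner_Integration.integrable_add Bochner_Integration.integrable_diff integrable_divide integrable_position_sq Gi) auto
  have "rel_entropy \<eta> \<le> ereal (\<integral>x. ?U x \<partial>\<eta>)"
  proof (rule rel_entropy_le[OF Ui])
    show "AE x in \<eta>. log_density V x \<le> ?U x" using GAE by eventually_elim (simp add: log_density_def)
  qed
  also have "(\<integral>x. ?U x \<partial>\<eta>) = (\<integral>x. G x \<partial>\<eta>) - real CARD('n) * (1 + ln 2) + position_sq_mean / 2 + real CARD('n) / 2 * ln (2 * pi)"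
    unfolding position_sq_mean_def using Gi integrable_position_sq \<eta>.prob_space by simp
  also have "ereal \<dots> \<le> ereal (gradient_abs_mean - real CARD('n) * (1 + ln 2) + position_sq_mean / 2 + real CARD('n) / 2 * ln (2 * pi))"
    using GN by simp
  finally show ?thesis .
qed

lemma fisher_information_ge:
  "ennreal (position_sq_mean - 2 * real CARD('n) + gradient_sq_mean) \<le> fisher_information \<eta>"
  unfolding fisher_information_def
proof (rule INF_greatest, clarify)
  fix h :: "real^'n \<Rightarrow> real"
  assume h: "h \<in> borel_measurable borel" "\<forall>x. 0 \<le> h x" "\<eta> = density gauss (\<lambda>x. ennreal (h x))"
    "abs_continuous_on_lines (\<lambda>x. sqrt (h x))"
  interpret F: fisher_version V h
    by unfold_locales (use c V h int1 in auto)
  have "(\<Sum>i\<in>(UNIV :: 'n set). \<integral>x. x $ i * g x $ i \<partial>\<eta>) \<le> (\<Sum>i\<in>(UNIV :: 'n set). 1)"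
    by (rule sum_mono) (rule integral_position_gradient_le)
  then have "ennreal (position_sq_mean - 2 * real CARD('n) + gradient_sq_mean) \<le> ennreal (position_sq_mean - 2 * (\<Sum>i\<in>UNIV. \<integral>x. x $ i * g x $ i \<partial>\<eta>) + gradient_sq_mean)"
    by (intro ennreal_leI) simp
  also have "\<dots> = (\<integral>\<^sup>+x. ennreal (\<Sum>i\<in>UNIV. (x $ i - g x $ i)\<^sup>2) \<partial>\<eta>)" by (rule gradient_shift_integral[symmetric])
  also have "\<dots> \<le> 4 * (\<integral>\<^sup>+x. ennreal (\<Sum>i\<in>UNIV. (partial_deriv i (\<lambda>z. sqrt (h z)) x)\<^sup>2) \<partial>gauss)"
    by (rule F.fisher_integral_ge)
  finally show "ennreal (position_sq_mean - 2 * real CARD('n) + gradient_sq_mean) \<le> 4 * (\<integral>\<^sup>+x. ennreal (\<Sum>i\<in>UNIV. (partial_deriv i (\<lambda>z. sqrt (h z)) x)\<^sup>2) \<partial>gauss)" .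
qed

text \<open>Combines \<open>rel_entropy_le_gradient\<close>, \<open>wasserstein_eq\<close> and \<open>fisher_information_ge\<close>. Finite
  Fisher information is what provides the regular version of the density required by
  \<open>no_boundary_jump\<close>.\<close>

lemma entropy_transport_fisher:
  "rel_entropy \<eta> + ereal (1/2) * enn2ereal (wasserstein2_sq (moment_measure V) uniform_cube)
     \<le> ereal (real CARD('n) / 2 * ln (pi * exp 1 / 2)) + ereal (1/2) * enn2ereal (fisher_information \<eta>)"
proof (cases "fisher_information \<eta> = \<infinity>")
  case True then show ?thesis by simp
next
  case False
  let ?P = "\<lambda>h. h \<in> borel_measurable borel \<and> (\<forall>x. 0 \<le> h x) \<and> \<eta> = density gauss (\<lambda>x. ennreal (h x)) \<and>
                  abs_continuous_on_lines (\<lambda>x. sqrt (h x))"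
  have "Collect ?P \<noteq> {}"
  proof
    assume e: "Collect ?P = {}"
    have "fisher_information \<eta> = \<infinity>" unfolding fisher_information_def e by simp
    then show False using False by simp
  qed
  then obtain h where h: "h \<in> borel_measurable borel" "\<And>x. 0 \<le> h x" "\<eta> = density gauss (\<lambda>x. ennreal (h x))"
    "abs_continuous_on_lines (\<lambda>x. sqrt (h x))" by blast
  define n where "n = real CARD('n)"
  obtain r where r: "fisher_information \<eta> = ennreal r" "0 \<le> r" using False by (cases "fisher_information \<eta>") auto
  have rge: "position_sq_mean - 2 * n + gradient_sq_mean \<le> r" using fisher_information_ge r by (auto simp: n_def ennreal_le_iff2)
  have H: "rel_entropy \<eta> \<le> ereal (gradient_abs_mean - n * (1 + ln 2) + position_sq_mean / 2 + n / 2 * ln (2 * pi))"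
    unfolding n_def by (rule rel_entropy_le_gradient[OF no_boundary_jump[OF h]])
  have ln: "ln (pi * exp 1 / 2) = ln pi + 1 - ln 2" "ln (2 * pi) = ln 2 + ln pi"
    by (simp_all add: ln_mult ln_div)
  have "gradient_abs_mean - n * (1 + ln 2) + position_sq_mean / 2 + n / 2 * ln (2 * pi) + 1/2 * (gradient_sq_mean - 2 * gradient_abs_mean + n) \<le> n / 2 * ln (pi * exp 1 / 2) + 1/2 * r"
    using rge unfolding ln by (simp add: algebra_simps add_divide_distrib)
  then have le: "ereal (gradient_abs_mean - n * (1 + ln 2) + position_sq_mean / 2 + n / 2 * ln (2 * pi)) + ereal (1/2 * (gradient_sq_mean - 2 * gradient_abs_mean + n)) \<le> ereal (n / 2 * ln (pi * exp 1 / 2)) + ereal (1/2 * r)"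
    by (simp only: plus_ereal.simps ereal_less_eq)
  have W: "ereal (1/2) * enn2ereal (wasserstein2_sq (moment_measure V) uniform_cube) = ereal (1/2 * (gradient_sq_mean - 2 * gradient_abs_mean + n))"
    unfolding wasserstein_eq enn2ereal_ennreal[OF wasserstein_nonneg] n_def by (simp only: times_ereal.simps)
  have I: "ereal (1/2) * enn2ereal (fisher_information \<eta>) = ereal (1/2 * r)"
    unfolding r(1) enn2ereal_ennreal[OF r(2)] by (simp only: times_ereal.simps)
  show ?thesis unfolding W I n_def[symmetric]
    by (rule order_trans[OF add_right_mono[OF H] le])
qed

text \<open>Subtracting the entropy from both sides needs only that it is not \<open>\<infinity>\<close>.\<close>

lemma deficit_ge:
  "ereal (1/2) * enn2ereal (wasserstein2_sq (moment_measure V) uniform_cube) - ereal (real CARD('n) / 2 * ln (pi * exp 1 / 2))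
     \<le> deficit \<eta>"
proof (cases "fisher_information \<eta> = \<infinity>")
  case True
  have "- rel_entropy \<eta> \<noteq> -\<infinity>" using rel_entropy_less_top by auto
  then show ?thesis unfolding deficit_def True by (cases "rel_entropy \<eta>") auto
next
  case False
  then obtain r where r: "fisher_information \<eta> = ennreal r" "0 \<le> r" by (cases "fisher_information \<eta>") auto
  have W: "enn2ereal (wasserstein2_sq (moment_measure V) uniform_cube) = ereal (gradient_sq_mean - 2 * gradient_abs_mean + real CARD('n))"
    unfolding wasserstein_eq by (rule enn2ereal_ennreal[OF wasserstein_nonneg])
  have I: "enn2ereal (fisher_information \<eta>) = ereal r"
    unfolding r(1) by (rule enn2ereal_ennreal[OF r(2)])
  have "rel_entropy \<eta> \<noteq> \<infinity>" using rel_entropy_less_top by simp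
  then show ?thesis
    using entropy_transport_fisher unfolding deficit_def W I by (cases "rel_entropy \<eta>") auto
qed

end

lemma admissible_unconditional_P2:
  assumes "admissible \<mu> V"
  shows "unconditional_P2 V" "\<mu> = exp_neg_measure V"
proof -
  show eta: "\<mu> = exp_neg_measure V" using assms by (simp add: admissible_def)
  have c: "ext_convex V" and lsc: "lower_semicontinuous V" and p: "prob_space (exp_neg_measure V)"
    and u: "unconditional (exp_neg_measure V)" and P2: "moment_measure V \<in> P2"
    using assms by (auto simp: admissible_def essentially_continuous_def)
  have V[measurable]: "V \<in> borel_measurable borel" by (rule lsc_measurable[OF lsc])
  interpret unconditional_potential V
    by (rule unconditional_potential.intro[OF c V p unconditional_imp_flip_invariant[OF c lsc u p]])
  have "(\<integral>\<^sup>+x. ennreal ((norm x)\<^sup>2) \<partial>moment_measure V) < \<infinity>" using P2 unfolding P2_def by blast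
  also have "(\<integral>\<^sup>+x. ennreal ((norm x)\<^sup>2) \<partial>moment_measure V) = (\<integral>\<^sup>+x. ennreal ((norm (g x))\<^sup>2) \<partial>\<eta>)"
    unfolding moment_measure_def by (rule nn_integral_distr) measurable
  finally have fin: "(\<integral>\<^sup>+x. ennreal ((norm (g x))\<^sup>2) \<partial>exp_neg_measure V) < \<infinity>" .
  show "unconditional_P2 V"
    by (rule unconditional_P2.intro[OF unconditional_potential_axioms unconditional_P2_axioms.intro[OF fin]])
qed

section \<open>Power potentials on the line\<close>

lemma even_power_ge:
  assumes "1 \<le> k" shows "(t::real)\<^sup>2 - 1 \<le> t ^ (2 * k)"
proof (cases "1 \<le> t\<^sup>2")
  case True
  then have "t\<^sup>2 \<le> (t\<^sup>2) ^ k" using assms by (intro self_le_power) auto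
  then show ?thesis by (simp add: power_mult)
next
  case False
  have "0 \<le> t ^ (2 * k)" by simp
  then show ?thesis using False by linarith
qed

lemma integrable_gaussian_moment: "integrable lborel (\<lambda>t::real. t ^ j * exp (- t\<^sup>2 / 2))"
proof -
  have "integrable lborel (\<lambda>t. sqrt (2 * pi) * (std_normal_density t * t ^ j))"
    by (intro integrable_mult_right integrable_std_normal_moment)
  then show ?thesis by (simp add: std_normal_density_def mult.commute)
qed

text \<open>A Gaussian majorant that does not depend on \<open>k\<close>; it gives all moments and the domination in
  \<open>normalizer_limit\<close>.\<close>

lemma exp_even_power_le:
  assumes "1 \<le> k" shows "exp (- ((t::real) ^ (2 * k))) \<le> exp 1 * exp (- t\<^sup>2 / 2)"
proof -
  have "- (t ^ (2 * k)) \<le> 1 + (- t\<^sup>2 / 2)" using even_power_ge[OF assms, of t] zero_le_power2[of t] by linarith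
  then have "exp (- (t ^ (2 * k))) \<le> exp (1 + (- t\<^sup>2 / 2))" by (simp only: exp_le_cancel_iff)
  then show ?thesis by (simp only: exp_add)
qed

lemma integrable_power_moment:
  assumes k: "1 \<le> k" shows "integrable lborel (\<lambda>t::real. t ^ j * exp (- (t ^ (2 * k))))"
proof (rule Bochner_Integration.integrable_bound)
  show "integrable lborel (\<lambda>t::real. exp 1 * (t ^ j * exp (- t\<^sup>2 / 2)))"
    by (intro integrable_mult_right integrable_gaussian_moment)
  show "AE t::real in lborel. norm (t ^ j * exp (- (t ^ (2 * k)))) \<le> norm (exp 1 * (t ^ j * exp (- t\<^sup>2 / 2)))"
  proof (rule AE_I2)
    fix t :: real
    have "\<bar>t ^ j\<bar> * exp (- (t ^ (2 * k))) \<le> \<bar>t ^ j\<bar> * (exp 1 * exp (- t\<^sup>2 / 2))"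
      by (rule mult_left_mono[OF exp_even_power_le[OF k]]) simp
    then show "norm (t ^ j * exp (- (t ^ (2 * k)))) \<le> norm (exp 1 * (t ^ j * exp (- t\<^sup>2 / 2)))"
      by (simp add: abs_mult mult_ac)
  qed
qed measurable

definition normalizer :: "nat \<Rightarrow> real" where "normalizer k = (\<integral>t. exp (- ((t::real) ^ (2 * k))) \<partial>lborel)"

lemma integrable_normalizer: "1 \<le> k \<Longrightarrow> integrable lborel (\<lambda>t::real. exp (- (t ^ (2 * k))))"
  using integrable_power_moment[of k 0] by simp

lemma normalizer_pos: assumes k: "1 \<le> k" shows "0 < normalizer k"
proof -
  have "normalizer k \<noteq> 0"
  proof
    assume "normalizer k = 0"
    then have "AE t in lborel. exp (- ((t::real) ^ (2 * k))) = 0"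
      unfolding normalizer_def by (subst (asm) integral_nonneg_eq_0_iff_AE[OF integrable_normalizer[OF k]]) auto
    then have "AE t in (lborel :: real measure). False" by simp
    then show False using AE_ex_Ioo[of "\<lambda>_. False" 0 1] by auto
  qed
  moreover have "0 \<le> normalizer k" unfolding normalizer_def by (intro integral_nonneg_AE) simp
  ultimately show ?thesis by simp
qed

text \<open>The functions \<open>exp (- t ^ (2 k))\<close> tend to the indicator function of \<open>{-1<..<1}\<close>, except at
  \<open>\<plusminus>1\<close>.\<close>

lemma normalizer_limit: "normalizer \<longlonglongrightarrow> 2"
proof -
  \<comment> \<open>The index is shifted since \<open>k = 0\<close> has no finite integral.\<close>
  have "(\<lambda>k. \<integral>t. exp (- ((t::real) ^ (2 * Suc k))) \<partial>lborel) \<longlonglongrightarrow> (\<integral>t. indicator {-1<..<1::real} t \<partial>lborel)"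
  proof (rule integral_dominated_convergence[where w="\<lambda>t. exp 1 * exp (- t\<^sup>2 / 2)"])
    show "integrable lborel (\<lambda>t::real. exp 1 * exp (- t\<^sup>2 / 2))"
      using integrable_gaussian_moment[of 0] by simp
    show "AE t::real in lborel. (\<lambda>k. exp (- (t ^ (2 * Suc k)))) \<longlonglongrightarrow> indicator {-1<..<1::real} t"
      using AE_lborel_singleton[of 1] AE_lborel_singleton[of "-1"]
    proof eventually_elim
      case (elim t)
      consider "t\<^sup>2 < 1" | "1 < t\<^sup>2" using elim by (metis linorder_neqE_linordered_idom power2_eq_1_iff)
      then show ?case
      proof cases
        case 1
        then have t: "t \<in> {-1<..<1}" using abs_square_less_1[of t] by auto
        have "(\<lambda>k. (t\<^sup>2) ^ Suc k) \<longlonglongrightarrow> 0" using 1 by (intro LIMSEQ_Suc LIMSEQ_power_zero) simp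
        then have "(\<lambda>k. exp (- ((t\<^sup>2) ^ Suc k))) \<longlonglongrightarrow> exp (- 0)" by (intro tendsto_intros)
        then show ?thesis unfolding power_mult using t by simp
      next
        case 2
        then have t: "t \<notin> {-1<..<1}" using abs_square_less_1[of t] by auto
        have "filterlim (\<lambda>k. (t\<^sup>2) ^ Suc k) at_infinity sequentially"
          by (rule filterlim_compose[OF filterlim_realpow_sequentially_gt1 filterlim_Suc]) (use 2 in simp)
        moreover have "norm ((t\<^sup>2) ^ Suc k) = (t\<^sup>2) ^ Suc k" for k
          unfolding real_norm_def by (rule abs_of_nonneg) simp
        ultimately have "filterlim (\<lambda>k. (t\<^sup>2) ^ Suc k) at_top sequentially"
          unfolding filterlim_at_infinity_conv_norm_at_top by (simp only:)
        then have "(\<lambda>k. exp (- ((t\<^sup>2) ^ Suc k))) \<longlonglongrightarrow> 0"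
          by (intro filterlim_compose[OF exp_at_bot] filterlim_compose[OF filterlim_uminus_at_bot_at_top])
        then show ?thesis unfolding power_mult using t by simp
      qed
    qed
    show "AE t::real in lborel. norm (exp (- (t ^ (2 * Suc k)))) \<le> exp 1 * exp (- t\<^sup>2 / 2)" for k
      using exp_even_power_le[of "Suc k"] by simp
  qed measurable
  then have "(\<lambda>k. normalizer (Suc k)) \<longlonglongrightarrow> 2" by (simp add: normalizer_def)
  then show ?thesis by (rule LIMSEQ_imp_Suc)
qed

text \<open>As \<open>k\<close> grows, \<open>exp (- t ^ (2 k))\<close> approximates the uniform density on \<open>[-1, 1]\<close> by smooth
  densities of full support.\<close>

definition power_potential :: "nat \<Rightarrow> real \<Rightarrow> real" where "power_potential k t = ln (normalizer k) + t ^ (2 * k)"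
definition power_slope :: "nat \<Rightarrow> real \<Rightarrow> real" where "power_slope k t = 2 * real k * t ^ (2 * k - 1)"
definition power_measure :: "nat \<Rightarrow> real measure" where "power_measure k = density lborel (\<lambda>t. ennreal (exp (- power_potential k t)))"

lemma exp_power_potential: "1 \<le> k \<Longrightarrow> exp (- power_potential k t) = exp (- (t ^ (2 * k))) / normalizer k"
  using normalizer_pos[of k] by (simp add: power_potential_def exp_diff exp_minus field_simps exp_add)

lemma measurable_power_potential [measurable]: "power_potential k \<in> borel_measurable borel" "power_slope k \<in> borel_measurable borel"
  unfolding power_potential_def[abs_def] power_slope_def[abs_def] by measurable

lemma sets_power_measure [simp, measurable_cong]: "sets (power_measure k) = sets borel" by (simp add: power_measure_def)
lemma space_power_measure [simp]: "space (power_measure k) = UNIV" by (simp add: power_measure_def)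

lemma prob_space_power_measure: assumes k: "1 \<le> k" shows "prob_space (power_measure k)"
proof
  have "emeasure (power_measure k) (space (power_measure k)) = (\<integral>\<^sup>+t. ennreal (exp (- (t ^ (2 * k))) / normalizer k) \<partial>lborel)"
    by (simp add: power_measure_def emeasure_density exp_power_potential[OF k])
  also have "\<dots> = ennreal (\<integral>t. exp (- (t ^ (2 * k))) / normalizer k \<partial>lborel)"
    by (rule nn_integral_eq_integral) (use integrable_normalizer[OF k] normalizer_pos[OF k] in \<open>auto simp: less_imp_le\<close>)
  also have "(\<integral>t. exp (- (t ^ (2 * k))) / normalizer k \<partial>lborel) = 1"
    using normalizer_pos[OF k] by (simp add: normalizer_def[symmetric])
  finally show "emeasure (power_measure k) (space (power_measure k)) = 1" by simp
qed

lemma integrable_power_measure_iff: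
  assumes k: "1 \<le> k" and [measurable]: "f \<in> borel_measurable borel"
  shows "integrable (power_measure k) f \<longleftrightarrow> integrable lborel (\<lambda>t. f t * exp (- (t ^ (2 * k))))"
proof -
  have "integrable (power_measure k) f \<longleftrightarrow> integrable lborel (\<lambda>t. (1 / normalizer k) * (f t * exp (- (t ^ (2 * k)))))"
    unfolding power_measure_def using normalizer_pos[OF k] by (subst integrable_density) (auto simp: exp_power_potential[OF k] mult_ac less_imp_le)
  also have "\<dots> \<longleftrightarrow> integrable lborel (\<lambda>t. f t * exp (- (t ^ (2 * k))))"
  proof
    assume "integrable lborel (\<lambda>t. (1 / normalizer k) * (f t * exp (- (t ^ (2 * k)))))"
    then have "integrable lborel (\<lambda>t. normalizer k * ((1 / normalizer k) * (f t * exp (- (t ^ (2 * k))))))" by (rule integrable_mult_right)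
    then show "integrable lborel (\<lambda>t. f t * exp (- (t ^ (2 * k))))" using normalizer_pos[OF k] by simp
  qed (rule integrable_mult_right)
  finally show ?thesis .
qed

lemma integral_power_measure:
  assumes k: "1 \<le> k" and [measurable]: "f \<in> borel_measurable borel"
  shows "(\<integral>t. f t \<partial>power_measure k) = (\<integral>t. f t * exp (- (t ^ (2 * k))) \<partial>lborel) / normalizer k"
  unfolding power_measure_def using normalizer_pos[OF k] by (subst integral_density) (auto simp: exp_power_potential[OF k] mult_ac less_imp_le)

lemma power_slope_mult: "1 \<le> k \<Longrightarrow> t * power_slope k t = 2 * real k * t ^ (2 * k)"
  by (cases "2 * k") (auto simp: power_slope_def)

lemma power_slope_sq: "1 \<le> k \<Longrightarrow> (power_slope k t)\<^sup>2 = (2 * real k)\<^sup>2 * t ^ (2 * (2 * k - 1))"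
  by (simp add: power_slope_def power_mult_distrib power_mult[symmetric] mult.commute)

lemma integrable_power_measure_power: "1 \<le> k \<Longrightarrow> integrable (power_measure k) (\<lambda>t. t ^ j)"
  by (subst integrable_power_measure_iff) (auto intro: integrable_power_moment)

lemma integrable_power_slope_sq: "1 \<le> k \<Longrightarrow> integrable (power_measure k) (\<lambda>t. (power_slope k t)\<^sup>2)"
  by (simp add: power_slope_sq integrable_power_measure_power)

lemma tendsto_mult_exp_power:
  assumes k: "1 \<le> k"
  shows "((\<lambda>t::real. t * exp (- (t ^ (2 * k)))) \<longlongrightarrow> 0) at_top"
proof (rule Lim_null_comparison)
  show "\<forall>\<^sub>F t::real in at_top. norm (t * exp (- (t ^ (2 * k)))) \<le> exp 1 * (2 / t)"
    using eventually_gt_at_top[of 0]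
  proof eventually_elim
    case (elim t)
    have "exp (- t\<^sup>2 / 2) \<le> 1 / (t\<^sup>2 / 2)"
    proof -
      have "t\<^sup>2 / 2 \<le> exp (t\<^sup>2 / 2)" using exp_ge_add_one_self[of "t\<^sup>2 / 2"] by linarith
      then show ?thesis using elim by (simp add: exp_minus divide_simps)
    qed
    then have "t * (exp 1 * exp (- t\<^sup>2 / 2)) \<le> t * (exp 1 * (1 / (t\<^sup>2 / 2)))"
      using elim by (intro mult_left_mono) auto
    also have "\<dots> = exp 1 * (2 / t)" using elim by (simp add: power2_eq_square)
    finally have "t * (exp 1 * exp (- t\<^sup>2 / 2)) \<le> exp 1 * (2 / t)" .
    moreover have "t * exp (- (t ^ (2 * k))) \<le> t * (exp 1 * exp (- t\<^sup>2 / 2))"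
      by (rule mult_left_mono[OF exp_even_power_le[OF k]]) (use elim in simp)
    ultimately have "t * exp (- (t ^ (2 * k))) \<le> exp 1 * (2 / t)" by (rule order_trans[rotated])
    then show ?case using elim by (simp add: abs_mult)
  qed
  show "((\<lambda>t::real. exp 1 * (2 / t)) \<longlongrightarrow> 0) at_top"
    by (intro tendsto_mult_right_zero tendsto_divide_0[OF tendsto_const] filterlim_at_top_imp_at_infinity filterlim_ident)
qed

text \<open>The function \<open>t exp (- t ^ (2 k))\<close> vanishes at both infinities, so the integral of its
  derivative \<open>(1 - 2 k t ^ (2 k)) exp (- t ^ (2 k))\<close> is zero.\<close>

lemma integral_power_power_measure:
  assumes k: "1 \<le> k"
  shows "(\<integral>t. t ^ (2 * k) \<partial>power_measure k) = 1 / (2 * real k)"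
proof -
  define f where "f t = exp (- (t ^ (2 * k))) - 2 * real k * (t ^ (2 * k) * exp (- (t ^ (2 * k))))" for t :: real
  have fi: "integrable lborel f" unfolding f_def
    by (intro Bochner_Integration.integrable_diff integrable_mult_right integrable_power_moment[OF k] integrable_normalizer[OF k])
  have pk: "t * t ^ (2 * k - 1) = t ^ (2 * k)" for t :: real using k by (cases "2 * k") auto
  have top: "((\<lambda>t::real. t * exp (- (t ^ (2 * k)))) \<longlongrightarrow> 0) at_top" by (rule tendsto_mult_exp_power[OF k])
  have bot: "((\<lambda>t::real. t * exp (- (t ^ (2 * k)))) \<longlongrightarrow> 0) at_bot"
    unfolding at_bot_mirror filterlim_filtermap using tendsto_minus[OF top] by simp
  have "(LBINT t=-\<infinity>..\<infinity>. f t) = 0 - 0"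
  proof (rule interval_integral_FTC_integrable[where F="\<lambda>t. t * exp (- (t ^ (2 * k)))"])
    show "set_integrable lborel (einterval (-\<infinity>) \<infinity>) f" using fi by (simp add: set_integrable_def)
    fix t :: real
    have "((\<lambda>t. t * exp (- (t ^ (2 * k)))) has_real_derivative
       (exp (- (t ^ (2 * k))) + t * (exp (- (t ^ (2 * k))) * (- (real (2 * k) * t ^ (2 * k - 1)))))) (at t)"
      by (auto intro!: derivative_eq_intros)
    also have "exp (- (t ^ (2 * k))) + t * (exp (- (t ^ (2 * k))) * (- (real (2 * k) * t ^ (2 * k - 1)))) = f t"
    proof -
      have "e + t * (e * (- (real (2 * k) * q))) = e - 2 * real k * ((t * q) * e)" for e q :: real
        by (simp add: algebra_simps)
      from this[of "exp (- (t ^ (2 * k)))" "t ^ (2 * k - 1)"] show ?thesis unfolding pk f_def .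
    qed
    finally show "((\<lambda>t. t * exp (- (t ^ (2 * k)))) has_vector_derivative f t) (at t)"
      by (simp add: has_real_derivative_iff_has_vector_derivative)
    show "isCont f t" unfolding f_def by (intro continuous_intros)
  next
    show "(((\<lambda>t. t * exp (- (t ^ (2 * k)))) \<circ> real_of_ereal) \<longlongrightarrow> 0) (at_right (-\<infinity>))"
      using bot by (simp add: ereal_tendsto_simps)
    show "(((\<lambda>t. t * exp (- (t ^ (2 * k)))) \<circ> real_of_ereal) \<longlongrightarrow> 0) (at_left \<infinity>)"
      using top by (simp add: ereal_tendsto_simps)
  qed auto
  then have "integral\<^sup>L lborel f = 0"
    by (simp add: interval_lebesgue_integral_def set_lebesgue_integral_def)
  then have "normalizer k = 2 * real k * (\<integral>t. t ^ (2 * k) * exp (- (t ^ (2 * k))) \<partial>lborel)"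
    unfolding f_def normalizer_def using integrable_power_moment[OF k] integrable_normalizer[OF k] by simp
  then have "(\<integral>t. t ^ (2 * k) * exp (- (t ^ (2 * k))) \<partial>lborel) = normalizer k / (2 * real k)" using k by simp
  then show ?thesis using normalizer_pos[OF k] k by (simp add: integral_power_measure[OF k])
qed

lemma convex_power_potential: "convex_on UNIV (power_potential k)"
  unfolding power_potential_def[abs_def] by (intro convex_on_add convex_power_even) (auto simp: convex_on_const)

lemma DERIV_power_potential: "1 \<le> k \<Longrightarrow> (power_potential k has_real_derivative power_slope k t) (at t)"
  unfolding power_potential_def[abs_def] power_slope_def by (auto intro!: derivative_eq_intros)

lemma has_ext_gradient_real:
  fixes u :: "real \<Rightarrow> real"
  assumes "(u has_real_derivative d) (at t)"
  shows "has_ext_gradient (\<lambda>t. ereal (u t)) t d"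
  using assms unfolding has_ext_gradient_def gderiv_def
  by (simp add: has_field_derivative_def mult_commute_abs)

lemma ext_convex_real:
  assumes "convex_on UNIV u"
  shows "ext_convex (\<lambda>x. ereal (u x))"
  unfolding ext_convex_def using convex_onD[OF assms] by auto

text \<open>The variation of the even unimodal density \<open>exp (- t ^ (2 k)) / normalizer k\<close> is twice its
  value at 0.\<close>

lemma integral_abs_power_slope_le:
  assumes k: "1 \<le> k"
  shows "(\<integral>t. \<bar>power_slope k t\<bar> \<partial>power_measure k) \<le> 2 / normalizer k"
proof -
  let ?v = "\<lambda>t. ereal (power_potential k t)"
  have c: "ext_convex ?v" by (rule ext_convex_real[OF convex_power_potential])
  have even: "?v (- t) = ?v t" for t by (simp add: power_potential_def)
  have lg: "line_grad ?v t = ennreal (\<bar>power_slope k t\<bar> * exp (- power_potential k t))" for t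
    using ext_gradient_eq[OF has_ext_gradient_real[OF DERIV_power_potential[OF k]]] by (simp add: line_grad_def ennreal_mult')
  have [measurable]: "line_grad ?v \<in> borel_measurable borel" unfolding lg[abs_def] by measurable
  have i: "integrable (power_measure k) (\<lambda>t. \<bar>power_slope k t\<bar>)" unfolding power_slope_def
    by (intro integrable_abs integrable_mult_right integrable_power_measure_power[OF k])
  have "ennreal (\<integral>t. \<bar>power_slope k t\<bar> \<partial>power_measure k) = (\<integral>\<^sup>+t. ennreal \<bar>power_slope k t\<bar> \<partial>power_measure k)"
    by (rule nn_integral_eq_integral[OF i, symmetric]) simp
  also have "\<dots> = (\<integral>\<^sup>+t. line_grad ?v t \<partial>lborel)"
    unfolding power_measure_def lg by (subst nn_integral_density) (auto simp: ennreal_mult' mult.commute)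
  also have "\<dots> = 2 * (\<integral>\<^sup>+t. line_grad ?v t * indicator {0<..} t \<partial>lborel)"
    by (rule nn_integral_even) (auto simp: line_grad_even[where v="?v", OF even])
  also have "\<dots> \<le> 2 * exp_neg (?v 0)"
    by (intro mult_left_mono line_grad_tail_le[OF c _ even]) auto
  also have "\<dots> = ennreal (2 / normalizer k)"
    using k normalizer_pos[OF k] by (simp add: exp_power_potential[OF k] power_0_left ennreal_mult'[symmetric] flip: ennreal_numeral)
  finally show ?thesis using normalizer_pos[OF k] by (simp add: ennreal_le_iff)
qed

section \<open>Product measures and sharpness\<close>

text \<open>Puts the product of the one-dimensional measures into the form \<open>e\<^sup>-\<^sup>V dx\<close>.\<close>

lemma product_measure_density:
  fixes w :: "real \<Rightarrow> ennreal"
  assumes [measurable]: "w \<in> borel_measurable borel" and p: "prob_space (density lborel w)"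
  shows "(product_measure (density lborel w) :: (real^'n) measure) = density lborel (\<lambda>x. \<Prod>i\<in>UNIV. w (x $ i))"
proof -
  let ?\<mu> = "density lborel w"
  interpret P: product_sigma_finite "\<lambda>_::'n. ?\<mu>"
    using prob_space_imp_sigma_finite[OF p] by (simp add: product_sigma_finite_def)
  have eq: "density (\<Pi>\<^sub>M i\<in>UNIV. lborel) (\<lambda>y. \<Prod>i\<in>UNIV. w (y i)) = (\<Pi>\<^sub>M i\<in>(UNIV :: 'n set). ?\<mu>)"
  proof (rule P.PiM_eqI)
    show "sets (density (\<Pi>\<^sub>M i\<in>UNIV. lborel) (\<lambda>y. \<Prod>i\<in>UNIV. w (y i))) = sets (\<Pi>\<^sub>M i\<in>(UNIV :: 'n set). ?\<mu>)"
      by (simp cong: sets_PiM_cong)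
    fix A :: "'n \<Rightarrow> real set" assume "\<And>i. i \<in> UNIV \<Longrightarrow> A i \<in> sets ?\<mu>"
    then have [measurable]: "A i \<in> sets borel" for i by simp
    have "emeasure (density (\<Pi>\<^sub>M i\<in>UNIV. lborel) (\<lambda>y. \<Prod>i\<in>UNIV. w (y i))) (Pi\<^sub>E UNIV A)
       = (\<integral>\<^sup>+y. (\<Prod>i\<in>UNIV. w (y i)) * indicator (Pi\<^sub>E UNIV A) y \<partial>(\<Pi>\<^sub>M i\<in>UNIV. lborel))"
      by (rule emeasure_density) (auto intro!: sets_PiM_I_finite)
    also have "\<dots> = (\<integral>\<^sup>+y. (\<Prod>i\<in>UNIV. w (y i) * indicator (A i) (y i)) \<partial>(\<Pi>\<^sub>M i\<in>UNIV. lborel))"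
    proof (rule nn_integral_cong)
      fix y :: "'n \<Rightarrow> real"
      have "indicator (Pi\<^sub>E UNIV A) y = (\<Prod>i\<in>UNIV. indicator (A i) (y i) :: ennreal)"
        by (cases "\<forall>i. y i \<in> A i") (auto simp: indicator_def PiE_iff intro!: prod_zero[symmetric])
      then show "(\<Prod>i\<in>UNIV. w (y i)) * indicator (Pi\<^sub>E UNIV A) y = (\<Prod>i\<in>UNIV. w (y i) * indicator (A i) (y i))"
        by (simp add: prod.distrib)
    qed
    also have "\<dots> = (\<Prod>i\<in>UNIV. \<integral>\<^sup>+t. w t * indicator (A i) t \<partial>lborel)"
      by (rule lborel_PiM.product_nn_integral_prod) auto
    also have "\<dots> = (\<Prod>i\<in>UNIV. emeasure ?\<mu> (A i))"
      by (simp add: emeasure_density)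
    finally show "emeasure (density (\<Pi>\<^sub>M i\<in>UNIV. lborel) (\<lambda>y. \<Prod>i\<in>UNIV. w (y i))) (Pi\<^sub>E UNIV A) = (\<Prod>i\<in>UNIV. emeasure ?\<mu> (A i))" .
  qed simp
  have "(product_measure ?\<mu> :: (real^'n) measure) = distr (density (\<Pi>\<^sub>M i\<in>UNIV. lborel) (\<lambda>y. \<Prod>i\<in>UNIV. w (vec_lambda y $ i))) borel vec_lambda"
    unfolding product_measure_def eq[symmetric] by simp
  also have "\<dots> = density (distr (\<Pi>\<^sub>M i\<in>UNIV. lborel) borel vec_lambda) (\<lambda>x. \<Prod>i\<in>UNIV. w (x $ i))"
    by (rule density_distr[symmetric]) measurable
  finally show ?thesis by (simp add: lborel_vec[symmetric])
qed

lemma measurable_vec_lambda_cong: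
  assumes "sets \<mu> = sets borel"
  shows "(\<lambda>f. \<chi> i. f i) \<in> (\<Pi>\<^sub>M i\<in>(UNIV :: 'n::finite set). \<mu>) \<rightarrow>\<^sub>M (borel :: (real^'n) measure)"
  using measurable_vec_lambda_PiM assms by (simp cong: measurable_cong_sets sets_PiM_cong)

lemma distr_product_measure_nth:
  assumes p: "prob_space \<mu>" and s: "sets \<mu> = sets borel"
  shows "distr (product_measure \<mu> :: (real^'n) measure) borel (\<lambda>x. x $ i) = \<mu>"
proof -
  have "distr (product_measure \<mu> :: (real^'n) measure) borel (\<lambda>x. x $ i) = distr (\<Pi>\<^sub>M i\<in>UNIV. \<mu>) borel (\<lambda>f. f i)"
    unfolding product_measure_def by (subst distr_distr) (auto simp: o_def measurable_vec_lambda_cong[OF s])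
  also have "\<dots> = distr (\<Pi>\<^sub>M i\<in>UNIV. \<mu>) \<mu> (\<lambda>f. f i)" by (rule distr_cong) (auto simp: s)
  also have "\<dots> = \<mu>" by (rule distr_PiM_component) (auto simp: p)
  finally show ?thesis .
qed

text \<open>The gradient of a sum of functions of single coordinates acts coordinatewise, so the moment
  measures of the examples will be products.\<close>

lemma product_measure_distr:
  assumes p: "prob_space \<mu>" and s[measurable_cong]: "sets \<mu> = sets borel" and f[measurable]: "f \<in> borel_measurable borel"
  shows "distr (product_measure \<mu>) borel (\<lambda>x::real^'n. \<chi> i. f (x $ i)) = product_measure (distr \<mu> borel f)"
proof -
  have fm: "f \<in> \<mu> \<rightarrow>\<^sub>M \<mu>" using f by (simp cong: measurable_cong_sets add: s)
  have v: "vec_lambda \<in> (\<Pi>\<^sub>M i\<in>(UNIV::'n set). \<mu>) \<rightarrow>\<^sub>M (borel :: (real^'n) measure)" by (rule measurable_vec_lambda_cong[OF s])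
  have d: "distr \<mu> \<mu> f = distr \<mu> borel f" by (rule distr_cong) (auto simp: s)
  have vf: "(\<lambda>x::real^'n. \<chi> i. f (x $ i)) \<in> borel \<rightarrow>\<^sub>M borel" by (rule measurable_vecI) simp
  have cm: "compose UNIV f \<in> (\<Pi>\<^sub>M i\<in>(UNIV::'n set). \<mu>) \<rightarrow>\<^sub>M (\<Pi>\<^sub>M i\<in>(UNIV::'n set). \<mu>)"
    unfolding compose_def
  proof (rule measurable_restrict)
    fix i :: 'n
    show "(\<lambda>x. f (x i)) \<in> (\<Pi>\<^sub>M i\<in>(UNIV::'n set). \<mu>) \<rightarrow>\<^sub>M \<mu>"
      by (rule measurable_compose[where f="\<lambda>x. x i", OF _ fm]) (rule measurable_component_singleton, simp)
  qed
  have "distr (product_measure \<mu>) borel (\<lambda>x::real^'n. \<chi> i. f (x $ i)) = distr (\<Pi>\<^sub>M i\<in>UNIV. \<mu>) borel (\<lambda>y. \<chi> i. f (y i))"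
    unfolding product_measure_def by (subst distr_distr[OF vf v]) (simp add: o_def)
  also have "\<dots> = distr (distr (\<Pi>\<^sub>M i\<in>UNIV. \<mu>) (\<Pi>\<^sub>M i\<in>(UNIV::'n set). \<mu>) (compose UNIV f)) borel vec_lambda"
    by (subst distr_distr[OF v cm]) (simp add: o_def compose_def restrict_UNIV)
  also have "distr (\<Pi>\<^sub>M i\<in>UNIV. \<mu>) (\<Pi>\<^sub>M i\<in>(UNIV::'n set). \<mu>) (compose UNIV f) = (\<Pi>\<^sub>M i\<in>UNIV. distr \<mu> \<mu> f)"
    by (rule distr_PiM_finite_prob_space') (use p fm in auto)
  finally show ?thesis unfolding product_measure_def d .
qed

text \<open>A bound on the derivative over the segment makes the function Lipschitz there.\<close>

lemma abs_continuous_C1: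
  assumes d: "\<And>t. (f has_real_derivative f' t) (at t)" and c: "continuous_on UNIV f'"
  shows "abs_continuous_on_segment a b f"
proof -
  have "compact (f' ` {a..b})" by (intro compact_continuous_image continuous_on_subset[OF c]) auto
  then obtain B where B': "0 < B" "\<forall>x\<in>f' ` {a..b}. norm x \<le> B"
    using compact_imp_bounded[of "f' ` {a..b}"] unfolding bounded_pos by blast
  have B: "\<bar>f' t\<bar> \<le> B" "0 < B" if "t \<in> {a..b}" for t using B' that by auto
  have lip: "\<bar>f v - f u\<bar> \<le> B * (v - u)" if "a \<le> u" "u \<le> v" "v \<le> b" for u v
  proof (cases "u = v")
    case False
    then have "u < v" using that by simp
    from MVT2[OF this, of f f'] obtain z where z: "u < z" "z < v" "f v - f u = (v - u) * f' z" using d by auto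
    then have "\<bar>f v - f u\<bar> = (v - u) * \<bar>f' z\<bar>" using \<open>u < v\<close> by (simp add: abs_mult)
    also have "\<dots> \<le> (v - u) * B" using z that \<open>u < v\<close> by (intro mult_left_mono B(1)) auto
    finally show ?thesis by (simp add: mult.commute)
  qed simp
  show ?thesis unfolding abs_continuous_on_segment_def
  proof (intro allI impI)
    fix e :: real assume e: "0 < e"
    show "\<exists>\<delta>>0. \<forall>D :: (real \<times> real) set. finite D \<and> (\<forall>(u, v)\<in>D. a \<le> u \<and> u \<le> v \<and> v \<le> b) \<and>
        disjoint_family_on (\<lambda>(u, v). {u<..<v}) D \<and> (\<Sum>(u, v)\<in>D. v - u) < \<delta> \<longrightarrow> (\<Sum>(u, v)\<in>D. \<bar>f v - f u\<bar>) < e"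
    proof (rule exI[of _ "e / B"], intro conjI allI impI)
      show "0 < e / B" using e B' by simp
      fix D :: "(real \<times> real) set"
      assume D: "finite D \<and> (\<forall>(u, v)\<in>D. a \<le> u \<and> u \<le> v \<and> v \<le> b) \<and>
        disjoint_family_on (\<lambda>(u, v). {u<..<v}) D \<and> (\<Sum>(u, v)\<in>D. v - u) < e / B"
      have "(\<Sum>(u, v)\<in>D. \<bar>f v - f u\<bar>) \<le> (\<Sum>p\<in>D. B * (case p of (u, v) \<Rightarrow> v - u))"
        by (rule sum_mono) (use D lip in \<open>auto split: prod.splits\<close>)
      also have "\<dots> = B * (\<Sum>(u, v)\<in>D. v - u)" by (rule sum_distrib_left[symmetric])
      also have "\<dots> < e" using D B' by (simp add: field_simps)
      finally show "(\<Sum>(u, v)\<in>D. \<bar>f v - f u\<bar>) < e" .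
    qed
  qed
qed

lemma hausdorff_measure_empty: "hausdorff_measure d {} = 0"
proof -
  have "hausdorff_premeasure d \<delta> ({} :: 'a::metric_space set) = 0" if "0 < \<delta>" for \<delta>
  proof -
    have "hausdorff_premeasure d \<delta> ({} :: 'a set) \<le> (\<Sum>i::nat. if ({} :: 'a set) = {} then 0
       else ennreal (unit_ball_vol (real d) * (diameter ({} :: 'a set) / 2) ^ d))"
      unfolding hausdorff_premeasure_def by (rule INF_lower2[of "\<lambda>_. {}"]) (use that in auto)
    then show ?thesis by simp
  qed
  then show ?thesis unfolding hausdorff_measure_def by (simp add: SUP_constant)
qed

lemma essentially_continuous_real:
  fixes u :: "'a::euclidean_space \<Rightarrow> real"
  assumes conv: "convex_on UNIV u" and cont: "continuous_on UNIV u"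
  shows "essentially_continuous (\<lambda>x. ereal (u x))"
proof -
  have c: "isCont (\<lambda>x. ereal (u x)) x" for x
    using cont by (simp add: isCont_def continuous_on_def)
  have "lower_semicontinuous (\<lambda>x. ereal (u x))"
    unfolding lower_semicontinuous_def
  proof
    fix x
    have "((\<lambda>x. ereal (u x)) \<longlongrightarrow> ereal (u x)) (at x)" using c[of x] by (simp only: isCont_def)
    from lim_imp_Liminf[OF at_neq_bot this] show "ereal (u x) \<le> Liminf (at x) (\<lambda>x. ereal (u x))" by simp
  qed
  then show ?thesis unfolding essentially_continuous_def using ext_convex_real[OF conv] c
    by (auto simp: hausdorff_measure_empty)
qed

definition potential_sum :: "nat \<Rightarrow> real^'n \<Rightarrow> real" where "potential_sum k x = (\<Sum>i\<in>UNIV. power_potential k (x $ i))"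

definition product_potential :: "nat \<Rightarrow> real^'n \<Rightarrow> ereal" where "product_potential k x = ereal (potential_sum k x)"

lemma convex_potential_sum: "convex_on UNIV (potential_sum k :: real^'n \<Rightarrow> real)"
proof (rule convex_onI)
  fix t :: real and x y :: "real^'n" assume t: "0 < t" "t < 1"
  have "potential_sum k ((1 - t) *\<^sub>R x + t *\<^sub>R y) \<le> (\<Sum>i\<in>UNIV. (1 - t) * power_potential k (x $ i) + t * power_potential k (y $ i))"
    unfolding potential_sum_def
  proof (rule sum_mono)
    fix i
    show "power_potential k (((1 - t) *\<^sub>R x + t *\<^sub>R y) $ i) \<le> (1 - t) * power_potential k (x $ i) + t * power_potential k (y $ i)"
      using convex_onD[OF convex_power_potential, of t "x $ i" "y $ i" k] t by simp
  qed
  then show "potential_sum k ((1 - t) *\<^sub>R x + t *\<^sub>R y) \<le> (1 - t) * potential_sum k x + t * potential_sum k y"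
    by (simp add: potential_sum_def sum.distrib sum_distrib_left)
qed simp

lemma continuous_potential_sum: "continuous_on UNIV (potential_sum k :: real^'n \<Rightarrow> real)"
  unfolding potential_sum_def power_potential_def by (intro continuous_intros)

lemma measurable_potential_sum [measurable]: "(potential_sum k :: real^'n \<Rightarrow> real) \<in> borel_measurable borel"
  by (rule borel_measurable_continuous_onI[OF continuous_potential_sum])

lemma measurable_product_potential [measurable]: "(product_potential k :: real^'n \<Rightarrow> ereal) \<in> borel_measurable borel"
  unfolding product_potential_def[abs_def] by measurable

lemma ext_convex_product_potential: "ext_convex (product_potential k)"
  unfolding product_potential_def[abs_def] by (rule ext_convex_real[OF convex_potential_sum])

lemma essentially_continuous_product_potential: "essentially_continuous (product_potential k)"
  unfolding product_potential_def[abs_def] by (rule essentially_continuous_real[OF convex_potential_sum continuous_potential_sum])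

lemma product_power_measure: assumes k: "1 \<le> k" shows "(product_measure (power_measure k) :: (real^'n) measure) = exp_neg_measure (product_potential k)"
proof -
  have "(product_measure (power_measure k) :: (real^'n) measure) = density lborel (\<lambda>x. \<Prod>i\<in>UNIV. ennreal (exp (- power_potential k (x $ i))))"
    unfolding power_measure_def by (rule product_measure_density) (use prob_space_power_measure[OF k] in \<open>auto simp: power_measure_def\<close>)
  then show ?thesis
    by (simp add: exp_neg_measure_def product_potential_def potential_sum_def prod_ennreal exp_sum[symmetric] sum_negf)
qed

lemma product_potential_flip: "\<epsilon> \<in> cube \<Longrightarrow> product_potential k (flip \<epsilon> x) = product_potential k x"
proof -
  assume e: "\<epsilon> \<in> cube"
  have "(\<epsilon> $ i * x $ i) ^ (2 * k) = (x $ i) ^ (2 * k)" for i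
  proof -
    have "(\<epsilon> $ i * x $ i)\<^sup>2 = (\<epsilon> $ i * \<epsilon> $ i) * (x $ i)\<^sup>2" by (simp add: power2_eq_square)
    then show ?thesis unfolding power_mult by (simp add: cube_sq[OF e])
  qed
  then show ?thesis by (simp add: product_potential_def potential_sum_def power_potential_def)
qed

lemma potential_sum_line: "potential_sum k (line i y t) = power_potential k t + (\<Sum>j\<in>UNIV - {i}. power_potential k (y j))"
  unfolding potential_sum_def by (subst sum.remove[of UNIV i]) (auto intro!: sum.cong)

lemma ext_gradient_product_potential: assumes k: "1 \<le> k" shows "ext_gradient (product_potential k) x = (\<chi> i. power_slope k (x $ i))"
proof (rule ext_gradient_eq, rule has_ext_gradient_from_lines[OF ext_convex_product_potential])
  fix i
  have "((\<lambda>t. power_potential k t + (\<Sum>j\<in>UNIV - {i}. power_potential k (x $ j))) has_real_derivative power_slope k (x $ i)) (at (x $ i))"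
    using DERIV_power_potential[OF k] by (auto intro!: derivative_eq_intros)
  from has_ext_gradient_real[OF this]
  show "has_ext_gradient (\<lambda>t. product_potential k (line i (vec_nth x) t)) (x $ i) ((\<chi> i. power_slope k (x $ i)) $ i)"
    by (simp add: product_potential_def potential_sum_line)
qed

text \<open>An upper bound, per coordinate, for the gap in the inequality at \<open>product_potential k\<close>.\<close>

definition gap_bound :: "nat \<Rightarrow> real" where "gap_bound k = ln (normalizer k) + 2 / normalizer k - 1 - ln 2 + 1 / (2 * real k)"

text \<open>The parameter \<open>V\<close> fixes the dimension, so that the facts about unconditional potentials are
  available for one type throughout.\<close>

locale power_example =
  fixes k :: nat and V :: "real^'n \<Rightarrow> ereal"
  assumes k: "1 \<le> k" and V_eq: "V = product_potential k"
begin

lemma V_potential_sum: "V x = ereal (potential_sum k x)"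
  by (simp add: V_eq product_potential_def)

lemma convex_V: "ext_convex V"
  unfolding V_eq by (rule ext_convex_product_potential)

lemma measurable_V [measurable]: "V \<in> borel_measurable borel"
  unfolding V_eq by (rule measurable_product_potential)

lemma gradient_V: "ext_gradient V x = (\<chi> i. power_slope k (x $ i))"
  unfolding V_eq by (rule ext_gradient_product_potential[OF k])

lemma product_V: "product_measure (power_measure k) = exp_neg_measure V"
  unfolding V_eq by (rule product_power_measure[OF k])

lemma distr_eta_nth: "distr (exp_neg_measure V) borel (\<lambda>x. x $ i) = power_measure k"
  using distr_product_measure_nth[OF prob_space_power_measure[OF k] sets_power_measure, of i] by (simp add: product_V)

lemma prob_space_V: "prob_space (exp_neg_measure V)"
proof -
  interpret e: prob_space "power_measure k" by (rule prob_space_power_measure[OF k])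
  interpret P: product_prob_space "\<lambda>_::'n. power_measure k" UNIV by standard
  have "prob_space (product_measure (power_measure k) :: (real^'n) measure)"
    unfolding product_measure_def by (rule P.prob_space_distr) (rule measurable_vec_lambda_cong[OF sets_power_measure])
  then show ?thesis by (simp add: product_V)
qed

lemma integrable_nth:
  fixes F :: "real \<Rightarrow> real"
  assumes [measurable]: "F \<in> borel_measurable borel" and "integrable (power_measure k) F"
  shows "integrable (exp_neg_measure V) (\<lambda>x. F (x $ i))"
proof -
  have m: "(\<lambda>x. x $ i) \<in> exp_neg_measure V \<rightarrow>\<^sub>M borel" by measurable
  show ?thesis using assms(2) integrable_distr_eq[OF m, of F] by (simp add: distr_eta_nth)
qed

lemma integral_nth:
  fixes F :: "real \<Rightarrow> real"
  assumes [measurable]: "F \<in> borel_measurable borel"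
  shows "(\<integral>x. F (x $ i) \<partial>exp_neg_measure V) = (\<integral>t. F t \<partial>power_measure k)"
proof -
  have m: "(\<lambda>x. x $ i) \<in> exp_neg_measure V \<rightarrow>\<^sub>M borel" by measurable
  show ?thesis using integral_distr[OF m, of F] by (simp add: distr_eta_nth)
qed

sublocale unconditional_P2 V
proof (intro unconditional_P2.intro unconditional_potential.intro unconditional_P2_axioms.intro)
  show "V (flip \<epsilon> x) = V x" if "\<epsilon> \<in> cube" for \<epsilon> x using product_potential_flip[OF that] by (simp add: V_eq)
  have sq: "(norm (ext_gradient V x))\<^sup>2 = (\<Sum>i\<in>UNIV. (power_slope k (x $ i))\<^sup>2)" for x
    by (simp add: gradient_V norm_vec_sq)
  have "integrable (exp_neg_measure V) (\<lambda>x. (norm (ext_gradient V x))\<^sup>2)"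
    unfolding sq by (intro Bochner_Integration.integrable_sum integrable_nth integrable_power_slope_sq[OF k]) auto
  then show "(\<integral>\<^sup>+x. ennreal ((norm (ext_gradient V x))\<^sup>2) \<partial>exp_neg_measure V) < \<infinity>"
    by (simp add: integrable_iff_bounded)
qed (rule convex_V measurable_V prob_space_V)+

text \<open>Here the bound of \<open>integral_position_gradient_le\<close> is attained: there is no boundary at which
  the density jumps.\<close>

lemma integral_position_gradient_eq: "(\<integral>x. x $ i * g x $ i \<partial>\<eta>) = 1"
proof -
  have "(\<integral>x. x $ i * g x $ i \<partial>\<eta>) = (\<integral>t. t * power_slope k t \<partial>power_measure k)"
    by (simp add: gradient_V integral_nth[of "\<lambda>t. t * power_slope k t"])
  also have "\<dots> = 1" using k by (simp add: power_slope_mult[OF k] integral_power_power_measure[OF k])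
  finally show ?thesis .
qed

lemma gradient_abs_mean_le: "gradient_abs_mean \<le> real CARD('n) * (2 / normalizer k)"
proof -
  have "gradient_abs_mean = (\<Sum>i\<in>(UNIV :: 'n set). \<integral>t. \<bar>power_slope k t\<bar> \<partial>power_measure k)"
    unfolding gradient_abs_mean_def by (simp add: gradient_V integral_nth[of "\<lambda>t. \<bar>power_slope k t\<bar>"])
  also have "\<dots> \<le> (\<Sum>i\<in>(UNIV :: 'n set). 2 / normalizer k)" by (rule sum_mono) (rule integral_abs_power_slope_le[OF k])
  finally show ?thesis by simp
qed

lemma rel_entropy_eq: "rel_entropy \<eta>
   = ereal (- (real CARD('n) * (ln (normalizer k) + 1 / (2 * real k))) + position_sq_mean / 2 + real CARD('n) / 2 * ln (2 * pi))"
proof -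
  interpret e1: prob_space "power_measure k" by (rule prob_space_power_measure[OF k])
  have pi: "integrable (power_measure k) (power_potential k)" unfolding power_potential_def[abs_def]
    by (intro Bochner_Integration.integrable_add integrable_power_measure_power[OF k]) auto
  have pv: "(\<integral>t. power_potential k t \<partial>power_measure k) = ln (normalizer k) + 1 / (2 * real k)"
    unfolding power_potential_def using integrable_power_measure_power[OF k, of "2 * k"] e1.prob_space integral_power_power_measure[OF k] by simp
  have psi: "integrable \<eta> (potential_sum k)"
    unfolding potential_sum_def[abs_def] by (intro Bochner_Integration.integrable_sum integrable_nth pi) auto
  have psv: "(\<integral>x. potential_sum k x \<partial>\<eta>) = real CARD('n) * (ln (normalizer k) + 1 / (2 * real k))"
    unfolding potential_sum_def by (subst Bochner_Integration.integral_sum) (auto intro!: integrable_nth pi simp: integral_nth pv)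
  have ld: "log_density V x = - potential_sum k x + (norm x)\<^sup>2 / 2 + real CARD('n) / 2 * ln (2 * pi)" for x
    by (simp add: log_density_def V_potential_sum)
  have i1: "integrable \<eta> (\<lambda>x. - potential_sum k x)" by (rule integrable_minus[OF psi])
  have i2: "integrable \<eta> (\<lambda>x. (norm x)\<^sup>2 / 2)" by (rule integrable_divide[OF integrable_position_sq])
  have i3: "integrable \<eta> (\<lambda>x. real CARD('n) / 2 * ln (2 * pi))" by (rule \<eta>.integrable_const)
  have int: "integrable \<eta> (log_density V)"
    unfolding ld[abs_def] by (intro Bochner_Integration.integrable_add i1 i2 i3)
  have "rel_entropy \<eta> = ereal (\<integral>x. log_density V x \<partial>\<eta>)"
    by (subst rel_entropy_exp_neg_measure) (auto simp: ereal_diff_integral[OF int] V_potential_sum)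
  also have "(\<integral>x. log_density V x \<partial>\<eta>)
     = - (real CARD('n) * (ln (normalizer k) + 1 / (2 * real k))) + position_sq_mean / 2 + real CARD('n) / 2 * ln (2 * pi)"
    unfolding ld position_sq_mean_def psv[symmetric]
    using Bochner_Integration.integral_add[OF Bochner_Integration.integrable_add[OF i1 i2] i3]
      Bochner_Integration.integral_add[OF i1 i2] measure_UNIV by simp
  finally show ?thesis .
qed

text \<open>The natural version of the density is smooth and positive, so it is a competitor for the
  Fisher information, and by \<open>partial_deriv_sqrt\<close> it turns \<open>fisher_integral_ge\<close> into an equality.\<close>

lemma fisher_information_le: "fisher_information \<eta> \<le> ennreal (position_sq_mean - 2 * real CARD('n) + gradient_sq_mean)"
proof -
  define h :: "real^'n \<Rightarrow> real" where "h x = exp (- potential_sum k x) / gauss_density x" for x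
  have h[measurable]: "h \<in> borel_measurable borel" unfolding h_def[abs_def] by measurable
  have h0: "0 \<le> h x" for x using gauss_density_pos[of x] by (simp add: h_def)
  have dens: "\<eta> = density gauss (\<lambda>x. ennreal (h x))"
  proof -
    have "exp_neg (V x) * ennreal (1 / gauss_density x) = ennreal (h x)" for x
      by (simp add: V_potential_sum h_def ennreal_mult'[symmetric])
    then show ?thesis using exp_neg_measure_eq_density_gauss[OF measurable_V] by simp
  qed
  have ac: "abs_continuous_on_lines (\<lambda>x. sqrt (h x))"
    unfolding abs_continuous_on_lines_def line_def[symmetric]
  proof (intro allI AE_I2)
    fix i :: 'n and y :: "'n \<Rightarrow> real" and a b :: real
    define K where "K = gauss_density (line i y 0)"
    define S where "S = (\<Sum>j\<in>UNIV - {i}. power_potential k (y j))"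
    define C where "C = sqrt (exp (- S) / K)"
    have K: "0 < K" unfolding K_def by (rule gauss_density_pos)
    have gdl: "gauss_density (line i y t) = K * exp (- t\<^sup>2 / 2)" for t
      using gauss_density_line[of i "vec_lambda y" t] by (simp add: K_def vec_lambda_inverse)
    have "sqrt (h (line i y t)) = exp (- power_potential k t / 2 + t\<^sup>2 / 4) * C" for t
    proof -
      have e1: "(exp (- power_potential k t / 2 + t\<^sup>2 / 4))\<^sup>2 = exp (- power_potential k t + t\<^sup>2 / 2)"
        by (subst exp_double[symmetric]) (simp add: algebra_simps)
      have "exp (- (power_potential k t + S)) = exp (- power_potential k t + t\<^sup>2 / 2) * exp (- S) * exp (- t\<^sup>2 / 2)"
        by (simp add: exp_add[symmetric])
      then have "h (line i y t) = (exp (- power_potential k t / 2 + t\<^sup>2 / 4))\<^sup>2 * (exp (- S) / K)"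
        unfolding h_def potential_sum_line gdl S_def[symmetric] e1 using K by simp
      then show ?thesis unfolding C_def by (simp only: real_sqrt_mult real_sqrt_abs abs_exp_cancel)
    qed
    moreover have "abs_continuous_on_segment a b (\<lambda>t. exp (- power_potential k t / 2 + t\<^sup>2 / 4) * C)"
    proof (rule abs_continuous_C1)
      show "((\<lambda>t. exp (- power_potential k t / 2 + t\<^sup>2 / 4) * C) has_real_derivative
          exp (- power_potential k t / 2 + t\<^sup>2 / 4) * (- power_slope k t / 2 + 2 * t / 4) * C) (at t)" for t
        using DERIV_power_potential[OF k] by (auto intro!: derivative_eq_intros)
      show "continuous_on UNIV (\<lambda>t. exp (- power_potential k t / 2 + t\<^sup>2 / 4) * (- power_slope k t / 2 + 2 * t / 4) * C)"
        unfolding power_potential_def power_slope_def by (intro continuous_intros) auto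
    qed
    ultimately show "abs_continuous_on_segment a b (\<lambda>t. sqrt (h (line i y t)))" by simp
  qed
  interpret F: fisher_version V h
    by (rule fisher_version.intro[OF convex_V measurable_V _ h h0 dens ac]) (simp add: int1)
  let ?S = "\<lambda>x. \<Sum>i\<in>UNIV. (x $ i - g x $ i)\<^sup>2"
  let ?P = "\<lambda>x. \<Sum>i\<in>UNIV. (partial_deriv i (\<lambda>z. sqrt (h z)) x)\<^sup>2"
  have nz: "exp_neg (V x) \<noteq> 0" for x by (simp add: V_potential_sum)
  have "AE x in lborel. \<forall>i. 4 * (partial_deriv i (\<lambda>z. sqrt (h z)) x)\<^sup>2 = (x $ i - g x $ i)\<^sup>2 * h x"
    unfolding AE_all_countable using F.partial_deriv_sqrt nz by simp
  then have AE: "AE x in gauss. ennreal (?P x) = ennreal (h x) * ennreal (?S x / 4)"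
    unfolding gauss_eq
  proof (subst Nonnegative_Lebesgue_Integration.AE_density, simp, eventually_elim, intro impI)
    fix x :: "real^'n" assume *: "\<forall>i. 4 * (partial_deriv i (\<lambda>z. sqrt (h z)) x)\<^sup>2 = (x $ i - g x $ i)\<^sup>2 * h x"
    have "4 * ?P x = ?S x * h x"
      unfolding sum_distrib_left sum_distrib_right by (rule sum.cong[OF refl]) (use * in blast)
    then have "?P x = h x * (?S x / 4)" by (simp add: mult.commute)
    then show "ennreal (?P x) = ennreal (h x) * ennreal (?S x / 4)"
      using h0[of x] by (simp only: ennreal_mult')
  qed
  have "fisher_information \<eta> \<le> 4 * (\<integral>\<^sup>+x. ennreal (?P x) \<partial>gauss)"
    unfolding fisher_information_def by (rule INF_lower) (use h h0 dens ac in simp)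
  also have "(\<integral>\<^sup>+x. ennreal (?P x) \<partial>gauss) = (\<integral>\<^sup>+x. ennreal (h x) * ennreal (?S x / 4) \<partial>gauss)"
    by (rule nn_integral_cong_AE[OF AE])
  also have "\<dots> = (\<integral>\<^sup>+x. ennreal (?S x / 4) \<partial>\<eta>)"
    unfolding dens by (rule nn_integral_density[symmetric]) auto
  also have "4 * \<dots> = (\<integral>\<^sup>+x. 4 * ennreal (?S x / 4) \<partial>\<eta>)"
    by (rule nn_integral_cmult[symmetric]) measurable
  also have "\<dots> = (\<integral>\<^sup>+x. ennreal (?S x) \<partial>\<eta>)"
  proof (rule nn_integral_cong)
    fix x :: "real^'n"
    have "4 * ennreal (?S x / 4) = ennreal 4 * ennreal (?S x / 4)" by simp
    also have "\<dots> = ennreal (4 * (?S x / 4))" by (rule ennreal_mult'[symmetric]) simp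
    finally show "4 * ennreal (?S x / 4) = ennreal (?S x)" by simp
  qed
  also have "\<dots> = ennreal (position_sq_mean - 2 * real CARD('n) + gradient_sq_mean)"
    unfolding gradient_shift_integral integral_position_gradient_eq by simp
  finally show ?thesis .
qed

lemma moment_measure_eq: "moment_measure V = product_measure (distr (power_measure k) borel (power_slope k))"
proof -
  have "g = (\<lambda>x. \<chi> i. power_slope k (x $ i))" by (rule ext) (rule gradient_V)
  then have "moment_measure V = distr (product_measure (power_measure k)) borel (\<lambda>x. \<chi> i. power_slope k (x $ i))"
    unfolding moment_measure_def product_V by simp
  then show ?thesis by (simp add: product_measure_distr[OF prob_space_power_measure[OF k]])
qed

lemma admissible_V: "admissible (product_measure (power_measure k)) V"
proof -
  have "log_concave \<eta>"
    unfolding log_concave_def using convex_V measurable_V by blast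
  moreover have "unconditional \<eta>"
    unfolding unconditional_def flip_def[symmetric]
    by (auto simp: distr_flip_exp_neg_measure inv)
  moreover have "moment_measure V \<in> P2"
  proof -
    have "prob_space (moment_measure V)"
      unfolding moment_measure_def by (rule \<eta>.prob_space_distr) simp
    moreover have "(\<integral>\<^sup>+x. ennreal ((norm x)\<^sup>2) \<partial>moment_measure V) = (\<integral>\<^sup>+x. ennreal ((norm (g x))\<^sup>2) \<partial>\<eta>)"
      unfolding moment_measure_def by (rule nn_integral_distr) measurable
    moreover have "\<dots> < \<infinity>" by (rule P2)
    ultimately show ?thesis by (simp add: P2_def moment_measure_def)
  qed
  moreover have "essentially_continuous V" unfolding V_eq by (rule essentially_continuous_product_potential)
  ultimately show ?thesis
    unfolding admissible_def product_V using prob_space_V by blast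
qed

text \<open>The value is stated through a real number \<open>d\<close>, so that the limit can be taken in the reals.
  It is nonnegative by \<open>deficit_ge\<close>; the upper bound comes from inserting the exact entropy and
  the bounds on \<open>\<integral> |\<partial>\<^sub>iV| d\<eta>\<close> and the Fisher information.\<close>

lemma deficit_gap_bound:
  "\<exists>d. deficit (product_measure (power_measure k) :: (real^'n) measure)
        - ereal (1/2) * enn2ereal (wasserstein2_sq (moment_measure V) uniform_cube)
        + ereal (real CARD('n) / 2 * ln (pi * exp 1 / 2)) = ereal d \<and> 0 \<le> d \<and> d \<le> real CARD('n) * gap_bound k"
proof -
  define n where "n = real CARD('n)"
  define H where "H = - (n * (ln (normalizer k) + 1 / (2 * real k))) + position_sq_mean / 2 + n / 2 * ln (2 * pi)"
  have H: "rel_entropy \<eta> = ereal H"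
    unfolding H_def n_def by (rule rel_entropy_eq)
  have W: "enn2ereal (wasserstein2_sq (moment_measure V) uniform_cube) = ereal (gradient_sq_mean - 2 * gradient_abs_mean + n)"
    unfolding wasserstein_eq n_def by (rule enn2ereal_ennreal[OF wasserstein_nonneg])
  have Ile: "fisher_information \<eta> \<le> ennreal (position_sq_mean - 2 * n + gradient_sq_mean)"
    unfolding n_def by (rule fisher_information_le)
  then have "fisher_information \<eta> \<noteq> \<infinity>" by (auto simp: top_unique)
  then obtain r where r: "fisher_information \<eta> = ennreal r" "0 \<le> r" by (cases "fisher_information \<eta>") auto
  have nn: "0 \<le> position_sq_mean - 2 * n + gradient_sq_mean"
    using gradient_shift_nonneg unfolding n_def integral_position_gradient_eq by simp
  have rle: "r \<le> position_sq_mean - 2 * n + gradient_sq_mean" using Ile nn unfolding r(1) by (simp add: ennreal_le_iff)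
  have I: "enn2ereal (fisher_information \<eta>) = ereal r"
    unfolding r(1) by (rule enn2ereal_ennreal[OF r(2)])
  have ln: "ln (pi * exp 1 / 2) = ln pi + 1 - ln 2" "ln (2 * pi) = ln 2 + ln pi"
    by (simp_all add: ln_mult ln_div)
  define d where "d = 1/2 * r - H - 1/2 * (gradient_sq_mean - 2 * gradient_abs_mean + n) + n / 2 * ln (pi * exp 1 / 2)"
  have eq: "deficit (product_measure (power_measure k) :: (real^'n) measure)
        - ereal (1/2) * enn2ereal (wasserstein2_sq (moment_measure V) uniform_cube)
        + ereal (real CARD('n) / 2 * ln (pi * exp 1 / 2)) = ereal d"
    unfolding deficit_def product_V H W I d_def n_def[symmetric] by simp
  have d0: "0 \<le> d"
    using deficit_ge unfolding deficit_def H W I d_def n_def[symmetric] by simp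
  have "d \<le> n * (ln (normalizer k) + 1 / (2 * real k)) + gradient_abs_mean - n * (1 + ln 2)"
    using rle unfolding d_def H_def ln by (simp add: algebra_simps add_divide_distrib diff_divide_distrib)
  also have "\<dots> \<le> n * (ln (normalizer k) + 1 / (2 * real k)) + n * (2 / normalizer k) - n * (1 + ln 2)"
    using gradient_abs_mean_le unfolding n_def by simp
  also have "\<dots> = n * gap_bound k" by (simp add: gap_bound_def algebra_simps)
  finally show ?thesis using eq d0 by (auto simp: n_def)
qed

end

lemma gap_bound_limit: "(\<lambda>k. gap_bound k) \<longlonglongrightarrow> 0"
proof -
  have "(\<lambda>k. 1 / (2 * real k)) \<longlonglongrightarrow> 0"
    using tendsto_mult_left[OF lim_1_over_n, of "1/2"] by (simp add: field_simps)
  then have "(\<lambda>k. ln (normalizer k) + 2 / normalizer k - 1 - ln 2 + 1 / (2 * real k)) \<longlonglongrightarrow> ln 2 + 2 / 2 - 1 - ln 2 + 0"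
    by (intro tendsto_intros normalizer_limit) auto
  then show ?thesis by (simp add: gap_bound_def[abs_def])
qed

theorem theorem2:
  shows "(\<forall>(\<eta> :: (real^'n) measure) V. admissible \<eta> V \<longrightarrow>
            rel_entropy \<eta> + ereal (1/2) * enn2ereal (wasserstein2_sq (moment_measure V) uniform_cube)
              \<le> ereal (real CARD('n) / 2 * ln (pi * exp 1 / 2))
                + ereal (1/2) * enn2ereal (fisher_information \<eta>)
          \<and> rel_entropy \<eta> < \<infinity>
          \<and> deficit \<eta> \<ge> ereal (1/2) * enn2ereal (wasserstein2_sq (moment_measure V) uniform_cube)
                         - ereal (real CARD('n) / 2 * ln (pi * exp 1 / 2)))
       \<and> (\<exists>(\<eta> :: nat \<Rightarrow> real measure) (\<nu> :: nat \<Rightarrow> real measure) (V :: nat \<Rightarrow> real^'n \<Rightarrow> ereal).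
            (\<forall>k\<ge>1. prob_space (\<eta> k) \<and> sets (\<eta> k) = sets borel \<and>
                   prob_space (\<nu> k) \<and> sets (\<nu> k) = sets borel \<and>
                   admissible (product_measure (\<eta> k)) (V k) \<and>
                   moment_measure (V k) = product_measure (\<nu> k)) \<and>
            (\<lambda>k. deficit (product_measure (\<eta> k) :: (real^'n) measure)
                 - ereal (1/2) * enn2ereal (wasserstein2_sq (product_measure (\<nu> k) :: (real^'n) measure)
                                              uniform_cube)
                 + ereal (real CARD('n) / 2 * ln (pi * exp 1 / 2))) \<longlonglongrightarrow> 0)"
proof (intro conjI allI impI)
  fix \<mu> :: "(real^'n) measure" and V
  assume "admissible \<mu> V"
  note P = admissible_unconditional_P2[OF this]
  show "rel_entropy \<mu> + ereal (1/2) * enn2ereal (wasserstein2_sq (moment_measure V) uniform_cube)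
      \<le> ereal (real CARD('n) / 2 * ln (pi * exp 1 / 2)) + ereal (1/2) * enn2ereal (fisher_information \<mu>)"
    unfolding P(2) by (rule unconditional_P2.entropy_transport_fisher[OF P(1)])
  show "rel_entropy \<mu> < \<infinity>"
    unfolding P(2) by (rule unconditional_P2.rel_entropy_less_top[OF P(1)])
  show "ereal (1/2) * enn2ereal (wasserstein2_sq (moment_measure V) uniform_cube)
      - ereal (real CARD('n) / 2 * ln (pi * exp 1 / 2)) \<le> deficit \<mu>"
    unfolding P(2) by (rule unconditional_P2.deficit_ge[OF P(1)])
next
  let ?\<nu> = "\<lambda>k. distr (power_measure k) borel (power_slope k)"
  let ?d = "\<lambda>k. deficit (product_measure (power_measure k) :: (real^'n) measure)
                 - ereal (1/2) * enn2ereal (wasserstein2_sq (product_measure (?\<nu> k) :: (real^'n) measure) uniform_cube)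
                 + ereal (real CARD('n) / 2 * ln (pi * exp 1 / 2))"
  have family: "\<forall>k\<ge>1. prob_space (power_measure k) \<and> sets (power_measure k) = sets borel \<and>
                   prob_space (?\<nu> k) \<and> sets (?\<nu> k) = sets borel \<and>
                   admissible (product_measure (power_measure k)) (product_potential k :: real^'n \<Rightarrow> ereal) \<and>
                   moment_measure (product_potential k :: real^'n \<Rightarrow> ereal) = product_measure (?\<nu> k)"
  proof (intro allI impI conjI)
    fix k :: nat assume k: "1 \<le> k"
    show "prob_space (power_measure k)" by (rule prob_space_power_measure[OF k])
    show "prob_space (?\<nu> k)" by (rule prob_space.prob_space_distr[OF prob_space_power_measure[OF k]]) simp
    show "admissible (product_measure (power_measure k)) (product_potential k :: real^'n \<Rightarrow> ereal)"
      by (rule power_example.admissible_V[OF power_example.intro[OF k refl]])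
    show "moment_measure (product_potential k :: real^'n \<Rightarrow> ereal) = product_measure (?\<nu> k)"
      by (rule power_example.moment_measure_eq[OF power_example.intro[OF k refl]])
  qed simp_all
  \<comment> \<open>Squeezed between 0 and \<open>n\<close> times \<open>gap_bound\<close>; the bounds hold from \<open>k = 1\<close> on.\<close>
  have lim: "?d \<longlonglongrightarrow> 0"
  proof (rule tendsto_sandwich)
    have b: "0 \<le> ?d k \<and> ?d k \<le> ereal (real CARD('n) * gap_bound k)" if k: "1 \<le> k" for k
      using power_example.deficit_gap_bound[OF power_example.intro[OF k refl[of "product_potential k :: real^'n \<Rightarrow> ereal"]]]
      unfolding power_example.moment_measure_eq[OF power_example.intro[OF k refl]] by auto
    show "\<forall>\<^sub>F k in sequentially. 0 \<le> ?d k" "\<forall>\<^sub>F k in sequentially. ?d k \<le> ereal (real CARD('n) * gap_bound k)"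
      using eventually_ge_at_top[of "1::nat"] by (eventually_elim, use b in blast)+
    have "(\<lambda>k. real CARD('n) * gap_bound k) \<longlonglongrightarrow> real CARD('n) * 0" by (intro tendsto_mult tendsto_const gap_bound_limit)
    then show "(\<lambda>k. ereal (real CARD('n) * gap_bound k)) \<longlonglongrightarrow> 0" by (simp add: zero_ereal_def)
  qed simp
  show "\<exists>(\<eta> :: nat \<Rightarrow> real measure) (\<nu> :: nat \<Rightarrow> real measure) (V :: nat \<Rightarrow> real^'n \<Rightarrow> ereal).
            (\<forall>k\<ge>1. prob_space (\<eta> k) \<and> sets (\<eta> k) = sets borel \<and>
                   prob_space (\<nu> k) \<and> sets (\<nu> k) = sets borel \<and>
                   admissible (product_measure (\<eta> k)) (V k) \<and>
                   moment_measure (V k) = product_measure (\<nu> k)) \<and>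
            (\<lambda>k. deficit (product_measure (\<eta> k) :: (real^'n) measure)
                 - ereal (1/2) * enn2ereal (wasserstein2_sq (product_measure (\<nu> k) :: (real^'n) measure)
                                              uniform_cube)
                 + ereal (real CARD('n) / 2 * ln (pi * exp 1 / 2))) \<longlonglongrightarrow> 0"
    by (rule exI[of _ power_measure], rule exI[of _ ?\<nu>], rule exI[of _ product_potential], rule conjI[OF family lim])
qed

end
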